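(* Let $d,r\in\mathbb{N}$ and $m\in\mathbb{N}_0$. Let $\Lambda=\{\nu_1,\ldots,\nu_r\}\subseteq\Lambda_m$ be an ordered multiset with $\nu_1=\mathbf{0}$, let $T=\{\tau_1,\ldots,\tau_r\}\subseteq\mathbb{R}^d$ be an ordered multiset, and let $\theta:\{1,\ldots,r\}\to\{1,\ldots,r\}$ be a mapping such that $$\nu_{\theta(\ell)}=\nu_\ell\quad\text{and}\quad2\tau_\ell-\tau_{\theta(\ell)}\in\mathbb{Z}^d,\qquad\ell=1,\ldots,r.$$ Let $a\in(l_0(\mathbb{Z}^d))^{r\times r}$ be a finitely supported matrix mask. If (i) the generalized Hermite subdivision scheme of type $\Lambda$ with mask $a$ is convergent with limit functions in $\mathscr{C}^m(\mathbb{R}^d)$; (ii) the generalized Hermite subdivision scheme of type $\Lambda$ with mask $a$ is interpolatory of type $\Lambda$ and translation $T$ (with respect to $\theta$); (iii) the basis vector function $\phi$ associated with mask $a$ satisfies $\operatorname{span}\{\widehat{\phi}(\pi\omega+2\pi k):k\in\mathbb{Z}^d\}=\mathbb{C}^r$ for all $\omega\in[0,1]^d\cap\mathbb{Z}^d$, then all the following statements hold: (1) The mask $a$ satisfies $$a(2k+2\tau_\ell-\tau_{\theta(\ell)})e_{\theta(\ell)}=2^{-d-|\nu_\ell|}\boldsymbol{\delta}(k)e_\ell,\qquad\forall\,k\in\mathbb{Z}^d,\ \ell=1,\ldots,r.$$ (2) The vector function $\phi$ is a refinable generalized Hermite interpolant of type $\Lambda$ and translation $T$: it satisfies $\phi=2^d\sum_{k\in\mathbb{Z}^d}a(k)\phi(2\cdot-k)$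 and $$\phi^{(\nu_\ell)}(k+\tau_\ell)=\boldsymbol{\delta}(k)e_\ell,\qquad\forall\,k\in\mathbb{Z}^d,\ \ell=1,\ldots,r.$$ (3) Let $M\in\mathbb{N}_0$ be the largest possible integer such that the mask $a$ has order $M+1$ sum rules with a matching filter $\upsilon_a\in(l_0(\mathbb{Z}^d))^{1\times r}$ satisfying $\widehat{\upsilon_a}(0)\widehat{\phi}(0)=1$. Then $M\ge m$ and $$\widehat{\upsilon_a}(\xi)=\left[(i\xi)^{\nu_1}e^{i\tau_1\cdot\xi},\ldots,(i\xi)^{\nu_r}e^{i\tau_r\cdot\xi}\right]+\mathscr{O}(\|\xi\|^{M+1}),\quad\xi\to0.$$ (4) With $M$ and $\upsilon_a$ as in item (3), for all $\mu\in\Lambda_M$ the vector polynomial $\vec{\mathsf{p}}_\mu:=\frac{(\cdot)^\mu}{\mu!}*\upsilon_a$ satisfies $\mathcal{S}_a\vec{\mathsf{p}}_\mu=2^{-|\mu|}\vec{\mathsf{p}}_\mu$, $\sum_{k\in\mathbb{Z}^d}\vec{\mathsf{p}}_\mu(k)\phi(\cdot-k)=\frac{(\cdot)^\mu}{\mu!}$ and $$\vec{\mathsf{p}}_\mu(x)e_\ell=\partial^{\nu_\ell}\left(\frac{(x+\tau_\ell)^\mu}{\mu!}\right)=\begin{cases}\frac{(x+\tau_\ell)^{\mu-\nu_\ell}}{(\mu-\nu_\ell)!},&\text{if }\nu_\ell\le\mu,\\0,&\text{otherwise,}\end{cases}\qquad\forall\,\ell=1,\ldots,r.$$ Conversely,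 if a compactly supported refinable vector function $\phi\in(\mathscr{C}^m(\mathbb{R}^d))^r$ associated with the mask $a\in(l_0(\mathbb{Z}^d))^{r\times r}$ (i.e., $\phi=2^d\sum_{k\in\mathbb{Z}^d}a(k)\phi(2\cdot-k)$) is a generalized Hermite interpolant of type $\Lambda$ and translation $T$, i.e., $\phi^{(\nu_\ell)}(k+\tau_\ell)=\boldsymbol{\delta}(k)e_\ell$ for all $k\in\mathbb{Z}^d$ and $\ell=1,\ldots,r$ (equivalently, item (2) holds), then all the items (i)--(iii) and (1)--(4) must hold.
   Context: Notation. $\mathbb{N}_0=\mathbb{N}\cup\{0\}$. $(l(\mathbb{Z}^d))^{s\times r}$ is the space of all sequences $u:\mathbb{Z}^d\to\mathbb{C}^{s\times r}$; $(l_0(\mathbb{Z}^d))^{s\times r}$ the finitely supported ones, with $\widehat{u}(\xi):=\sum_{k}u(k)e^{-ik\cdot\xi}$. Fourier transform: $\widehat{f}(\xi)=\int_{\mathbb{R}^d}f(x)e^{-ix\cdot\xi}dx$. $\boldsymbol{\delta}(0)=1$, $\boldsymbol{\delta}(k)=0$ for $k\in\mathbb{Z}^d\setminus\{0\}$. $e_\ell$ is the $\ell$th unit coordinate column vector of $\mathbb{R}^r$. Usual multi-index notation; $f^{(\mu)}:=\partial^\mu f$; $\nu\le\mu$ means all entries of $\mu-\nu$ are nonnegative; $(i\xi)^\mu=i^{|\mu|}\xi^\mu$. $\Lambda_m:=\{\mu\in\mathbb{N}_0^d:|\mu|\le m\}$. Ordered multisets may have repeated elements. $\mathscr{C}^m(\mathbb{R}^d)$: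 functions with continuous partial derivatives up to order $m$. For a polynomial $\mathsf{p}$ and $v\in(l_0(\mathbb{Z}^d))^{1\times r}$, $\mathsf{p}*v:=\sum_{k}\mathsf{p}(\cdot-k)v(k)$; polynomials are identified with their restrictions to $\mathbb{Z}^d$. "$f(\xi)=g(\xi)+\mathscr{O}(\|\xi\|^{n+1})$, $\xi\to0$" means $f^{(\mu)}(0)=g^{(\mu)}(0)$ for all $|\mu|\le n$. Subdivision operator: $(\mathcal{S}_av)(j):=2^d\sum_{k\in\mathbb{Z}^d}v(k)a(j-2k)$, $j\in\mathbb{Z}^d$, for $v\in(l(\mathbb{Z}^d))^{s\times r}$. Generalized Hermite subdivision scheme of type $\Lambda$ with mask $a$: with $\mathsf{D}_\Lambda:=\mathrm{diag}(2^{-|\nu_1|},\ldots,2^{-|\nu_r|})$, from $w_0\in(l(\mathbb{Z}^d))^{1\times r}$ compute $w_n:=(\mathcal{S}_a^nw_0)\mathsf{D}_\Lambda^{-n}$, $n\in\mathbb{N}$. It is convergent with limit functions in $\mathscr{C}^m(\mathbb{R}^d)$ if for every $w_0\in(l(\mathbb{Z}^d))^{1\times r}$ there is $\eta\in\mathscr{C}^m(\mathbb{R}^d)$ such that for every $K>0$ and all $\ell=1,\ldots,r$, $\lim_{n\to\infty}\max_{k\in\mathbb{Z}^d\cap[-2^nK,2^nK]^d}|w_n(k)e_\ell-\eta^{(\nu_\ell)}(2^{-n}k)|=0$. Its basis vector function $\phi=[\phi_1,\ldots,\phi_r]^{\mathsf{T}}$ is defined by $\lim_{n\to\infty}\sup_{k\in\mathbb{Z}^d}\|(\mathcal{S}_a^n(\boldsymbol{\delta}I_r))(k)e_1-\phi(2^{-n}k)\|=0$;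 i.e. $\phi_j$ is the limit function for $w_0=\boldsymbol{\delta}e_j^{\mathsf{T}}$. Interpolatory scheme: the scheme is interpolatory of type $\Lambda$ and translation $T$ (with respect to $\theta$) if for any $w_0\in(l(\mathbb{Z}^d))^{1\times r}$ the refinement data satisfy $w_n(2k+2\tau_\ell-\tau_{\theta(\ell)})e_{\theta(\ell)}=w_{n-1}(k)e_\ell$ for all $k\in\mathbb{Z}^d$, $n\in\mathbb{N}$, $\ell=1,\ldots,r$. Sum rules: $a$ has order $n+1$ sum rules with a matching filter $\upsilon_a\in(l_0(\mathbb{Z}^d))^{1\times r}$ if $\widehat{\upsilon_a}(0)\ne0$ and, as $\xi\to0$, $\widehat{\upsilon_a}(2\xi)\widehat{a}(\xi)=\widehat{\upsilon_a}(\xi)+\mathscr{O}(\|\xi\|^{n+1})$ and $\widehat{\upsilon_a}(2\xi)\widehat{a}(\xi+\pi\omega)=\mathscr{O}(\|\xi\|^{n+1})$ for all $\omega\in\Gamma\setminus\{0\}$, $\Gamma:=[0,1]^d\cap\mathbb{Z}^d$. *)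

theory Defs
  imports "HOL-Analysis.Analysis"
begin

text \<open>
  Conventions.  The dimensions are \<open>d = CARD('d)\<close> and \<open>r = CARD('r)\<close>; the linear order on the index
  types only serves to order the coordinates and to single out the first one.
  Points of \<open>\<int>\<^sup>d\<close> have type \<open>int^'d\<close>, multi-indices type \<open>nat^'d\<close> (for which \<open>\<le>\<close> and \<open>-\<close> are
  componentwise), and an \<open>s \<times> r\<close> matrix sequence has type \<open>int^'d \<Rightarrow> complex^'r^'s\<close>; row-vector
  sequences are the case \<open>'s = 1\<close>.  An ordered multiset of \<open>r\<close> elements is a family indexed by \<open>'r\<close>.
  All lattice sums below are sums with only finitely many nonzero terms whenever the masks and
  filters involved are finitely supported and \<open>\<phi>\<close> is compactly supported.
\<close>

definition idx1 :: "'r::{finite,linorder}" where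
  "idx1 = Min UNIV"

definition rvec :: "int^'d \<Rightarrow> real^'d" where
  "rvec k = (\<chi> i. real_of_int (k $ i))"

text \<open>The integer vector equal to \<open>x\<close>; it is only applied to vectors with integer entries.\<close>
definition ivec :: "real^'d \<Rightarrow> int^'d" where
  "ivec x = (\<chi> i. \<lfloor>x $ i\<rfloor>)"

definition delta :: "int^'d \<Rightarrow> complex" where
  "delta k = (if k = 0 then 1 else 0)"

definition fin_supp :: "(int^'d \<Rightarrow> 'b::zero) \<Rightarrow> bool" where
  "fin_supp u \<longleftrightarrow> finite {k. u k \<noteq> 0}"

definition unit_cube_pts :: "(int^'d) set" where
  "unit_cube_pts = {\<omega>. \<forall>i. 0 \<le> \<omega> $ i \<and> \<omega> $ i \<le> 1}"


subsection \<open>Multi-indices and partial derivatives\<close>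

definition mabs :: "nat^'d \<Rightarrow> nat" where
  "mabs \<mu> = (\<Sum>i\<in>UNIV. \<mu> $ i)"

definition mfact :: "nat^'d \<Rightarrow> nat" where
  "mfact \<mu> = (\<Prod>i\<in>UNIV. fact (\<mu> $ i))"

definition mpow :: "real^'d \<Rightarrow> nat^'d \<Rightarrow> real" where
  "mpow x \<mu> = (\<Prod>i\<in>UNIV. (x $ i) ^ (\<mu> $ i))"

text \<open>The normalized monomial \<open>x\<^sup>\<mu> / \<mu>!\<close>.\<close>
definition nmonom :: "nat^'d \<Rightarrow> real^'d \<Rightarrow> complex" where
  "nmonom \<mu> x = complex_of_real (mpow x \<mu> / real (mfact \<mu>))"

definition partial_deriv ::
  "'d \<Rightarrow> (real^'d \<Rightarrow> 'b::real_normed_vector) \<Rightarrow> real^'d \<Rightarrow> 'b" where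
  "partial_deriv i f x = vector_derivative (\<lambda>t. f (x + t *\<^sub>R axis i 1)) (at 0)"

text \<open>\<open>mderiv \<mu> f\<close> is \<open>\<partial>\<^sub>1\<^bsup>\<mu>\<^sub>1\<^esup> \<dots> \<partial>\<^sub>d\<^bsup>\<mu>\<^sub>d\<^esup> f\<close>.\<close>
definition mderiv ::
  "nat^'d::{finite,linorder} \<Rightarrow> (real^'d::{finite,linorder} \<Rightarrow> 'b::real_normed_vector) \<Rightarrow>
     real^'d::{finite,linorder} \<Rightarrow> 'b" where
  "mderiv \<mu> f = foldr (\<lambda>i. partial_deriv i ^^ (\<mu> $ i)) (sorted_list_of_set UNIV) f"

text \<open>All iterated partial derivatives of order at most \<open>m\<close> exist everywhere and are continuous.\<close>
fun Cm :: "nat \<Rightarrow> (real^'d \<Rightarrow> 'b::real_normed_vector) \<Rightarrow> bool" where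
  "Cm 0 f \<longleftrightarrow> continuous_on UNIV f"
| "Cm (Suc m) f \<longleftrightarrow> continuous_on UNIV f \<and>
     (\<forall>i. (\<forall>x. (\<lambda>t. f (x + t *\<^sub>R axis i 1)) differentiable (at (0::real))) \<and>
          Cm m (partial_deriv i f))"

text \<open>\<open>f(\<xi>) = g(\<xi>) + O(\<parallel>\<xi>\<parallel>\<^sup>N)\<close> as \<open>\<xi> \<rightarrow> 0\<close>: all derivatives of order less than \<open>N\<close> agree at 0.\<close>
definition eqO :: "nat \<Rightarrow> (real^'d::{finite,linorder} \<Rightarrow> 'b::real_normed_vector) \<Rightarrow>
    (real^'d::{finite,linorder} \<Rightarrow> 'b) \<Rightarrow> bool" where
  "eqO N f g \<longleftrightarrow> (\<forall>\<mu>. mabs \<mu> < N \<longrightarrow> mderiv \<mu> f 0 = mderiv \<mu> g 0)"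


subsection \<open>Fourier series, Fourier transform and convolution with polynomials\<close>

definition fseries :: "(int^'d \<Rightarrow> complex^'r^'s) \<Rightarrow> real^'d \<Rightarrow> complex^'r^'s" where
  "fseries u \<xi> =
     (\<chi> i j. \<Sum>\<^sub>\<infinity>k. u k $ i $ j * exp (- \<i> * complex_of_real (rvec k \<bullet> \<xi>)))"

definition fourier :: "(real^'d \<Rightarrow> complex^'r) \<Rightarrow> real^'d \<Rightarrow> complex^'r" where
  "fourier f \<xi> = (\<chi> j. LINT x|lborel. f x $ j * exp (- \<i> * complex_of_real (x \<bullet> \<xi>)))"

definition poly_conv ::
  "(real^'d \<Rightarrow> complex) \<Rightarrow> (int^'d \<Rightarrow> complex^'r^1) \<Rightarrow> real^'d \<Rightarrow> complex^'r^1" where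
  "poly_conv p v x = (\<chi> i j. \<Sum>\<^sub>\<infinity>k. p (x - rvec k) * v k $ i $ j)"


subsection \<open>Generalized Hermite subdivision schemes\<close>

definition subdiv ::
  "(int^'d \<Rightarrow> complex^'r^'r) \<Rightarrow> (int^'d \<Rightarrow> complex^'r^'s) \<Rightarrow> int^'d \<Rightarrow> complex^'r^'s" where
  "subdiv a v j = 2 ^ CARD('d) *\<^sub>R (\<Sum>\<^sub>\<infinity>k. v k ** a (j - 2 *s k))"

text \<open>The power \<open>D\<^bsup>-n\<^esup>\<close> of the diagonal matrix \<open>D = diag(2\<^bsup>-|\<nu>\<^sub>1|\<^esup>, \<dots>, 2\<^bsup>-|\<nu>\<^sub>r|\<^esup>)\<close>, written out because
  \<open>^\<close> on the matrix type is the entrywise power.\<close>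
definition D_inv_pow :: "('r \<Rightarrow> nat^'d) \<Rightarrow> nat \<Rightarrow> complex^'r^'r" where
  "D_inv_pow \<nu> n =
     (\<chi> i j. if i = j then (2 powi (- int (mabs (\<nu> i)))) powi (- int n) else 0)"

definition refinement_data ::
  "(int^'d \<Rightarrow> complex^'r^'r) \<Rightarrow> ('r \<Rightarrow> nat^'d) \<Rightarrow> (int^'d \<Rightarrow> complex^'r^1) \<Rightarrow> nat \<Rightarrow>
     int^'d \<Rightarrow> complex^'r^1" where
  "refinement_data a \<nu> w0 n k = (subdiv a ^^ n) w0 k ** D_inv_pow \<nu> n"

definition scheme_convergent ::
  "nat \<Rightarrow> ('r \<Rightarrow> nat^'d::{finite,linorder}) \<Rightarrow>
     (int^'d::{finite,linorder} \<Rightarrow> complex^'r^'r) \<Rightarrow> bool" where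
  "scheme_convergent m \<nu> a \<longleftrightarrow>
     (\<forall>w0. \<exists>\<eta>. Cm m \<eta> \<and>
        (\<forall>K>0. \<forall>l.
          (\<lambda>n. Max ((\<lambda>k. cmod (refinement_data a \<nu> w0 n k $ 1 $ l
                               - mderiv (\<nu> l) \<eta> (rvec k /\<^sub>R 2 ^ n)))
                    ` {k. \<forall>i. \<bar>real_of_int (k $ i)\<bar> \<le> 2 ^ n * K})) \<longlonglongrightarrow> 0))"

text \<open>The supremum is taken in the extended reals, as it may be infinite for some \<open>n\<close>.
  The limit only involves the values of \<open>\<phi>\<close> at dyadic points; as a vector of limit functions,
  \<open>\<phi>\<close> belongs to \<open>C\<^sup>m\<close>, which determines it uniquely.\<close>
definition is_basis_vector_function ::
  "nat \<Rightarrow> (int^'d \<Rightarrow> complex^'r::{finite,linorder}^'r::{finite,linorder}) \<Rightarrow>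
     (real^'d \<Rightarrow> complex^'r::{finite,linorder}) \<Rightarrow> bool" where
  "is_basis_vector_function m a \<phi> \<longleftrightarrow> Cm m \<phi> \<and>
     (\<lambda>n. SUP k. ereal (norm ((subdiv a ^^ n) (\<lambda>k. mat (delta k)) k *v axis idx1 1
                               - \<phi> (rvec k /\<^sub>R 2 ^ n)))) \<longlonglongrightarrow> 0"

definition scheme_interpolatory ::
  "('r \<Rightarrow> nat^'d) \<Rightarrow> ('r \<Rightarrow> real^'d) \<Rightarrow> ('r \<Rightarrow> 'r) \<Rightarrow> (int^'d \<Rightarrow> complex^'r^'r) \<Rightarrow> bool" where
  "scheme_interpolatory \<nu> \<tau> \<theta> a \<longleftrightarrow>
     (\<forall>w0 k l. \<forall>n\<ge>1.
        refinement_data a \<nu> w0 n (2 *s k + ivec (2 *\<^sub>R \<tau> l - \<tau> (\<theta> l))) $ 1 $ \<theta> l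
        = refinement_data a \<nu> w0 (n - 1) k $ 1 $ l)"

definition spanning_condition :: "(real^'d \<Rightarrow> complex^'r) \<Rightarrow> bool" where
  "spanning_condition \<phi> \<longleftrightarrow>
     (\<forall>\<omega>\<in>unit_cube_pts.
        vec.span (range (\<lambda>k. fourier \<phi> (pi *\<^sub>R rvec \<omega> + (2 * pi) *\<^sub>R rvec k))) = UNIV)"

definition interpolatory_mask ::
  "('r \<Rightarrow> nat^'d) \<Rightarrow> ('r \<Rightarrow> real^'d) \<Rightarrow> ('r \<Rightarrow> 'r) \<Rightarrow> (int^'d \<Rightarrow> complex^'r^'r) \<Rightarrow> bool" where
  "interpolatory_mask \<nu> \<tau> \<theta> a \<longleftrightarrow>
     (\<forall>k l. a (2 *s k + ivec (2 *\<^sub>R \<tau> l - \<tau> (\<theta> l))) *v axis (\<theta> l) 1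
            = (2 powi (- int CARD('d) - int (mabs (\<nu> l))) * delta k) *s axis l 1)"

definition refinable :: "(int^'d \<Rightarrow> complex^'r^'r) \<Rightarrow> (real^'d \<Rightarrow> complex^'r) \<Rightarrow> bool" where
  "refinable a \<phi> \<longleftrightarrow>
     (\<forall>x. \<phi> x = 2 ^ CARD('d) *\<^sub>R (\<Sum>\<^sub>\<infinity>k. a k *v \<phi> (2 *\<^sub>R x - rvec k)))"

definition hermite_interpolant ::
  "('r \<Rightarrow> nat^'d::{finite,linorder}) \<Rightarrow> ('r \<Rightarrow> real^'d::{finite,linorder}) \<Rightarrow>
     (real^'d::{finite,linorder} \<Rightarrow> complex^'r) \<Rightarrow> bool" where
  "hermite_interpolant \<nu> \<tau> \<phi> \<longleftrightarrow>
     (\<forall>k l. mderiv (\<nu> l) \<phi> (rvec k + \<tau> l) = delta k *s axis l 1)"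

definition compactly_supported :: "(real^'d \<Rightarrow> complex^'r) \<Rightarrow> bool" where
  "compactly_supported \<phi> \<longleftrightarrow> compact (closure {x. \<phi> x \<noteq> 0})"


subsection \<open>Sum rules\<close>

definition sum_rules ::
  "nat \<Rightarrow> (int^'d::{finite,linorder} \<Rightarrow> complex^'r^'r) \<Rightarrow>
     (int^'d::{finite,linorder} \<Rightarrow> complex^'r^1) \<Rightarrow> bool" where
  "sum_rules N a \<upsilon> \<longleftrightarrow>
     fin_supp \<upsilon> \<and> fseries \<upsilon> 0 \<noteq> 0 \<and>
     eqO N (\<lambda>\<xi>. fseries \<upsilon> (2 *\<^sub>R \<xi>) ** fseries a \<xi>) (fseries \<upsilon>) \<and>
     (\<forall>\<omega>\<in>unit_cube_pts - {0}.
        eqO N (\<lambda>\<xi>. fseries \<upsilon> (2 *\<^sub>R \<xi>) ** fseries a (\<xi> + pi *\<^sub>R rvec \<omega>)) (\<lambda>\<xi>. 0))"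

definition normalized_matching_filter ::
  "nat \<Rightarrow> (int^'d::{finite,linorder} \<Rightarrow> complex^'r^'r) \<Rightarrow>
     (real^'d::{finite,linorder} \<Rightarrow> complex^'r) \<Rightarrow>
     (int^'d::{finite,linorder} \<Rightarrow> complex^'r^1) \<Rightarrow> bool" where
  "normalized_matching_filter N a \<phi> \<upsilon> \<longleftrightarrow>
     sum_rules N a \<upsilon> \<and> (fseries \<upsilon> 0 *v fourier \<phi> 0) $ 1 = 1"

definition largest_sum_rules ::
  "nat \<Rightarrow> (int^'d::{finite,linorder} \<Rightarrow> complex^'r^'r) \<Rightarrow>
     (real^'d::{finite,linorder} \<Rightarrow> complex^'r) \<Rightarrow> bool" where
  "largest_sum_rules M a \<phi> \<longleftrightarrow>
     (\<exists>\<upsilon>. normalized_matching_filter (M + 1) a \<phi> \<upsilon>) \<and>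
     (\<forall>n. (\<exists>\<upsilon>. normalized_matching_filter (n + 1) a \<phi> \<upsilon>) \<longrightarrow> n \<le> M)"

text \<open>The largest \<open>M\<close> exists and is at least \<open>m\<close>, and every normalized matching filter of order
  \<open>M + 1\<close> has the stated Taylor expansion.\<close>
definition matching_filter_property ::
  "nat \<Rightarrow> ('r \<Rightarrow> nat^'d::{finite,linorder}) \<Rightarrow>
     ('r \<Rightarrow> real^'d::{finite,linorder}) \<Rightarrow>
     (int^'d::{finite,linorder} \<Rightarrow> complex^'r^'r) \<Rightarrow>
     (real^'d::{finite,linorder} \<Rightarrow> complex^'r) \<Rightarrow> bool" where
  "matching_filter_property m \<nu> \<tau> a \<phi> \<longleftrightarrow>
     (\<exists>M. largest_sum_rules M a \<phi> \<and> m \<le> M \<and>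
        (\<forall>\<upsilon>. normalized_matching_filter (M + 1) a \<phi> \<upsilon> \<longrightarrow>
           eqO (M + 1) (fseries \<upsilon>)
             (\<lambda>\<xi>. \<chi> i l. \<i> ^ mabs (\<nu> l) * complex_of_real (mpow \<xi> (\<nu> l))
                          * exp (\<i> * complex_of_real (\<tau> l \<bullet> \<xi>)))))"

definition polynomial_property ::
  "('r \<Rightarrow> nat^'d::{finite,linorder}) \<Rightarrow>
     ('r \<Rightarrow> real^'d::{finite,linorder}) \<Rightarrow>
     (int^'d::{finite,linorder} \<Rightarrow> complex^'r^'r) \<Rightarrow>
     (real^'d::{finite,linorder} \<Rightarrow> complex^'r) \<Rightarrow> bool" where
  "polynomial_property \<nu> \<tau> a \<phi> \<longleftrightarrow>
     (\<forall>M \<upsilon>. largest_sum_rules M a \<phi> \<longrightarrow> normalized_matching_filter (M + 1) a \<phi> \<upsilon> \<longrightarrow>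
       (\<forall>\<mu>. mabs \<mu> \<le> M \<longrightarrow>
         (let p = poly_conv (nmonom \<mu>) \<upsilon> in
            (\<forall>j. subdiv a (\<lambda>k. p (rvec k)) j = (1 / 2 ^ mabs \<mu>) *\<^sub>R p (rvec j)) \<and>
            (\<forall>x. (\<Sum>\<^sub>\<infinity>k. (p (rvec k) *v \<phi> (x - rvec k)) $ 1) = nmonom \<mu> x) \<and>
            (\<forall>x l. p x $ 1 $ l = mderiv (\<nu> l) (\<lambda>y. nmonom \<mu> (y + \<tau> l)) x \<and>
                   mderiv (\<nu> l) (\<lambda>y. nmonom \<mu> (y + \<tau> l)) x =
                     (if \<nu> l \<le> \<mu> then nmonom (\<mu> - \<nu> l) (x + \<tau> l) else 0)))))"

end

theory Submission
  imports Defs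
begin

text \<open>
  Everything is derived from the Hermite interpolation property. If \<open>\<phi>\<close> is a refinable Hermite
  interpolant, then \<open>f = \<Sum>\<^sub>k w\<^sub>0(k) \<phi>(\<cdot> - k)\<close> satisfies \<open>f = \<Sum>\<^sub>k (S\<^sub>a\<^sup>n w\<^sub>0)(k) \<phi>(2\<^sup>n \<cdot> - k)\<close>, so the
  refinement data are exactly the values \<open>f\<^sup>(\<^sup>\<nu>\<^sup>)(2\<^sup>-\<^sup>n(k + \<tau>))\<close>; convergence and the interpolatory property
  follow at once. The spanning condition holds since a row vector annihilating all
  \<open>\<phi>\<close>-transforms on a coset yields a vanishing twisted periodization of \<open>\<phi>\<close>, whose derivatives at
  \<open>\<tau>\<close> are the entries of that vector. Polynomials of degree at most \<open>m\<close> are reproduced because Taylor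
  expansion of the interpolation identity on the grids \<open>2\<^sup>-\<^sup>n \<int>\<^sup>d\<close> produces, for the reproduction error,
  a homogeneous constant-coefficient differential equation solved by an entry of \<open>\<phi>\<close>, and a
  nonzero compactly supported function solves only the trivial one. The sum rules are moment
  conditions equivalent to \<open>S\<^sub>a p\<^sub>\<mu> = 2\<^bsup>-|\<mu>|\<^esup> p\<^sub>\<mu>\<close>. Conversely, sum rules of any order force reproduction, as
  \<open>\<Sum>\<^sub>k p\<^sub>\<mu>(k) \<phi>(\<cdot> - k) - x\<^sup>\<mu>/\<mu>!\<close> is, inductively, periodic and homogeneous of degree \<open>|\<mu>|\<close>, hence zero; evaluating
  derivatives at \<open>k + \<tau>\<close> then determines \<open>p\<^sub>\<mu>\<close> and the Taylor expansion of the matching filter.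
  Under (i)--(iii), the interpolation property of \<open>\<phi>\<close> is read off by following one datum through all
  refinement levels.
\<close>

section \<open>Partial derivatives\<close>

text \<open>Two features of the definitions shape the proof. \<open>Cm\<close> and
  \<open>mderiv\<close> speak only of derivatives along coordinate lines, composed in a fixed order,
  so the symmetry of mixed partials, the chain rule for dilations and Taylor's theorem are built on
  that basis. The remainder has Peano's form because \<phi> has just m derivatives to spend and the
  error must still be o(t^m). Moreover, the scheme samples at 2^-n k, while a Hermite interpolant
  knows its data at 2^-n (k + \<tau> l); continuity of the limit absorbs the vanishing offset.
  Everything that follows from interpolation is proved in the locale \<open>hermite_system\<close>,
  which both implications enter. Reproduction is proved twice, for different reasons: up to degree m
  from smoothness, which produces a matching filter of order m + 1, and up to the order of any given
  filter from its sum rules, which forces its moments. The existence of a largest M is a separate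
  matter: reproducing ever higher degrees on a ball would take ever more linearly independent
  shifts, and only finitely many meet the ball.\<close>

declare Cm.simps(2) [simp del]

text \<open>The relational form of \<open>partial_deriv\<close>: existence and value come together,
  so sum, product and chain rules compose without choosing a \<open>vector_derivative\<close> at
  each stage.\<close>

definition has_pd ::
  "'d \<Rightarrow> (real^'d \<Rightarrow> 'b::real_normed_vector) \<Rightarrow> (real^'d \<Rightarrow> 'b) \<Rightarrow> bool" where
  "has_pd i f f' \<longleftrightarrow>
     (\<forall>x. ((\<lambda>t. f (x + t *\<^sub>R axis i 1)) has_vector_derivative f' x) (at 0))"

lemma has_pd_partial_deriv: "has_pd i f f' \<Longrightarrow> partial_deriv i f = f'"
  by (auto simp: has_pd_def partial_deriv_def fun_eq_iff intro: vector_derivative_at)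

lemma has_pd_iff:
  "(\<forall>x. (\<lambda>t. f (x + t *\<^sub>R axis i 1)) differentiable (at (0::real)))
     \<longleftrightarrow> has_pd i f (partial_deriv i f)"
  unfolding has_pd_def partial_deriv_def by (metis differentiableI_vector vector_derivative_works)

text \<open>\<open>has_pd\<close> constrains the derivative at parameter 0 for every base point;
  moving the base point along the line gives every parameter s.\<close>

lemma has_pd_line:
  assumes "has_pd i f f'"
  shows "((\<lambda>t. f (x + t *\<^sub>R axis i 1)) has_vector_derivative f' (x + s *\<^sub>R axis i 1)) (at s)"
proof -
  have 1: "((\<lambda>t. t - s) has_vector_derivative 1) (at s)"
    by (auto intro!: derivative_eq_intros)
  have 2: "((\<lambda>t. f ((x + s *\<^sub>R axis i 1) + t *\<^sub>R axis i 1))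
      has_vector_derivative f' (x + s *\<^sub>R axis i 1)) (at (s - s))"
    using assms by (simp add: has_pd_def)
  have "(\<lambda>t. f ((x + s *\<^sub>R axis i 1) + t *\<^sub>R axis i 1)) \<circ> (\<lambda>t. t - s)
      = (\<lambda>t. f (x + t *\<^sub>R axis i 1))"
    by (auto simp: fun_eq_iff scaleR_diff_left)
  with vector_diff_chain_at[OF 1 2] show ?thesis by simp
qed

lemma Cm_Suc_iff:
  "Cm (Suc m) f \<longleftrightarrow> continuous_on UNIV f \<and> (\<forall>i. \<exists>f'. has_pd i f f' \<and> Cm m f')"
  unfolding Cm.simps has_pd_iff using has_pd_partial_deriv by metis

lemma Cm_continuous: "Cm m f \<Longrightarrow> continuous_on UNIV f"
  by (cases m) (auto simp: Cm.simps)

lemma Cm_Suc_has_pd: "Cm (Suc m) f \<Longrightarrow> has_pd i f (partial_deriv i f)"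
  by (simp add: has_pd_iff Cm.simps)

lemma Cm_Suc_pd: "Cm (Suc m) f \<Longrightarrow> Cm m (partial_deriv i f)"
  by (simp add: Cm.simps)

lemma Cm_SucD: "Cm (Suc m) f \<Longrightarrow> Cm m f"
  by (induction m arbitrary: f) (auto simp: Cm.simps)

lemma Cm_mono: "Cm m f \<Longrightarrow> k \<le> m \<Longrightarrow> Cm k f"
  by (induction m) (use Cm_SucD le_SucE in blast)+

text \<open>Closure under partial derivatives lets the induction on m run inside F. This settles
  constants, monomials and waves without tracking the order of differentiation.\<close>

lemma Cm_family:
  assumes "f \<in> F"
    and "\<And>f. f \<in> F \<Longrightarrow> continuous_on UNIV f"
    and "\<And>f i. f \<in> F \<Longrightarrow> \<exists>f'\<in>F. has_pd i f f'"
  shows "Cm m f"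
  using assms(1)
proof (induction m arbitrary: f)
  case (Suc m)
  then show ?case unfolding Cm_Suc_iff using assms(2,3) by blast
qed (simp add: assms(2))

lemma has_pd_linear:
  assumes "bounded_linear L" "has_pd i f f'"
  shows "has_pd i (\<lambda>x. L (f x)) (\<lambda>x. L (f' x))"
  using assms bounded_linear.has_vector_derivative unfolding has_pd_def by blast

lemma has_pd_add:
  "has_pd i f f' \<Longrightarrow> has_pd i g g' \<Longrightarrow> has_pd i (\<lambda>x. f x + g x) (\<lambda>x. f' x + g' x)"
  unfolding has_pd_def by (auto intro: has_vector_derivative_add)

lemma has_pd_diff:
  "has_pd i f f' \<Longrightarrow> has_pd i g g' \<Longrightarrow> has_pd i (\<lambda>x. f x - g x) (\<lambda>x. f' x - g' x)"
  unfolding has_pd_def by (auto intro: has_vector_derivative_diff)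

lemma has_pd_sum:
  "(\<And>k. k \<in> F \<Longrightarrow> has_pd i (f k) (f' k)) \<Longrightarrow>
     has_pd i (\<lambda>x. \<Sum>k\<in>F. f k x) (\<lambda>x. \<Sum>k\<in>F. f' k x)"
  unfolding has_pd_def by (auto intro: has_vector_derivative_sum)

lemma has_pd_const: "has_pd i (\<lambda>x. c) (\<lambda>x. 0)"
  unfolding has_pd_def by auto

lemma has_pd_mult:
  fixes f g :: "real^'d \<Rightarrow> 'b::real_normed_algebra"
  assumes "has_pd i f f'" "has_pd i g g'"
  shows "has_pd i (\<lambda>x. f x * g x) (\<lambda>x. f x * g' x + f' x * g x)"
  unfolding has_pd_def
proof
  fix x
  show "((\<lambda>t. f (x + t *\<^sub>R axis i 1) * g (x + t *\<^sub>R axis i 1)) has_vector_derivative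
      f x * g' x + f' x * g x) (at 0)"
    using has_vector_derivative_mult[OF assms[unfolded has_pd_def, rule_format, of x]] by simp
qed

lemma has_pd_affine:
  assumes "has_pd i f f'"
  shows "has_pd i (\<lambda>x. f (c *\<^sub>R x + b)) (\<lambda>x. c *\<^sub>R f' (c *\<^sub>R x + b))"
  unfolding has_pd_def
proof
  fix x
  have 1: "((\<lambda>t. c * t) has_vector_derivative c) (at 0)"
    by (auto intro!: derivative_eq_intros)
  have 2: "((\<lambda>t. f ((c *\<^sub>R x + b) + t *\<^sub>R axis i 1))
      has_vector_derivative f' (c *\<^sub>R x + b)) (at (c * 0))"
    using assms by (simp add: has_pd_def)
  have "(\<lambda>t. f ((c *\<^sub>R x + b) + t *\<^sub>R axis i 1)) \<circ> (\<lambda>t. c * t)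
      = (\<lambda>t. f (c *\<^sub>R (x + t *\<^sub>R axis i 1) + b))"
    by (auto simp: fun_eq_iff algebra_simps)
  with vector_diff_chain_at[OF 1 2]
  show "((\<lambda>t. f (c *\<^sub>R (x + t *\<^sub>R axis i 1) + b)) has_vector_derivative
      c *\<^sub>R f' (c *\<^sub>R x + b)) (at 0)" by simp
qed

lemma Cm_linear:
  assumes "bounded_linear L"
  shows "Cm m f \<Longrightarrow> Cm m (\<lambda>x. L (f x))"
proof (induction m arbitrary: f)
  case 0
  then show ?case by (auto intro: bounded_linear.continuous_on[OF assms])
next
  case (Suc m)
  then have "continuous_on UNIV (\<lambda>x. L (f x))"
    by (intro bounded_linear.continuous_on[OF assms] Cm_continuous)
  with Suc show ?case unfolding Cm_Suc_iff using has_pd_linear[OF assms] by blast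
qed

lemma Cm_add: "Cm m f \<Longrightarrow> Cm m g \<Longrightarrow> Cm m (\<lambda>x. f x + g x)"
proof (induction m arbitrary: f g)
  case 0
  then show ?case by (auto intro: continuous_intros)
next
  case (Suc m)
  then show ?case unfolding Cm_Suc_iff using continuous_on_add has_pd_add by blast
qed

lemma Cm_const: "Cm m (\<lambda>x. c)"
  by (rule Cm_family[where F = "range (\<lambda>c x. c)"]) (auto intro: has_pd_const)

lemma Cm_sum: "(\<And>k. k \<in> F \<Longrightarrow> Cm m (f k)) \<Longrightarrow> Cm m (\<lambda>x. \<Sum>k\<in>F. f k x)"
  by (induction F rule: infinite_finite_induct) (auto intro: Cm_const Cm_add)

lemma Cm_affine: "Cm m f \<Longrightarrow> Cm m (\<lambda>x. f (c *\<^sub>R x + b))"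
proof (induction m arbitrary: f)
  case 0
  then show ?case
    by (auto intro!: continuous_on_compose2[where g = f and t = UNIV] continuous_intros)
next
  case (Suc m)
  have "continuous_on UNIV (\<lambda>x. f (c *\<^sub>R x + b))"
    by (rule continuous_on_compose2[OF Cm_continuous[OF Suc.prems]]) (auto intro!: continuous_intros)
  moreover have "\<exists>f'. has_pd i (\<lambda>x. f (c *\<^sub>R x + b)) f' \<and> Cm m f'" for i
  proof -
    obtain f' where f': "has_pd i f f'" "Cm m f'"
      using Suc.prems unfolding Cm_Suc_iff by blast
    from Cm_linear[OF bounded_linear_scaleR_right[of c] Suc.IH[OF f'(2)]] has_pd_affine[OF f'(1)]
    show ?thesis by blast
  qed
  ultimately show ?case unfolding Cm_Suc_iff by blast
qed

section \<open>Mean value estimates and the symmetry of mixed partial derivatives\<close>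

lemma mvt_bound:
  fixes g :: "real \<Rightarrow> 'b::real_normed_vector"
  assumes "\<And>u. \<bar>u\<bar> \<le> \<bar>s\<bar> \<Longrightarrow> (g has_vector_derivative g' u) (at u)"
    and "\<And>u. \<bar>u\<bar> \<le> \<bar>s\<bar> \<Longrightarrow> norm (g' u) \<le> B"
  shows "norm (g s - g 0) \<le> B * \<bar>s\<bar>"
proof -
  have "norm (g s - g 0) \<le> B * norm (s - 0)"
  \<comment> \<open>The symmetric interval covers negative s as well.\<close>
  proof (rule differentiable_bound[where S = "{-\<bar>s\<bar>..\<bar>s\<bar>}" and f' = "\<lambda>u h. h *\<^sub>R g' u"])
    fix u assume "u \<in> {-\<bar>s\<bar>..\<bar>s\<bar>}"
    then have u: "\<bar>u\<bar> \<le> \<bar>s\<bar>" by auto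
    show "(g has_derivative (\<lambda>h. h *\<^sub>R g' u)) (at u within {-\<bar>s\<bar>..\<bar>s\<bar>})"
      using assms(1)[OF u] has_derivative_at_withinI unfolding has_vector_derivative_def by blast
    show "onorm (\<lambda>h. h *\<^sub>R g' u) \<le> B"
      using assms(2)[OF u] by (intro onorm_le) (auto simp: mult_right_mono mult.commute[of B] mult_left_mono)
  qed auto
  then show ?thesis by simp
qed

text \<open>The mean value bound is applied twice: in direction i to the difference G, whose
  derivative is in turn estimated by the bound in direction j for H. The subtracted linear terms
  leave only the oscillation of \<open>fij\<close> near x.\<close>

lemma mixed_difference_bound:
  fixes f :: "real^'d \<Rightarrow> 'b::real_normed_vector"
  assumes fi: "has_pd i f fi" and fij: "has_pd j fi fij" and cont: "continuous_on UNIV fij"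
    and e: "0 < e"
  obtains \<delta> where "0 < \<delta>"
    "\<And>s. 0 \<le> s \<Longrightarrow> s < \<delta> \<Longrightarrow>
       norm (f (x + s *\<^sub>R axis i 1 + s *\<^sub>R axis j 1) - f (x + s *\<^sub>R axis i 1)
         - (f (x + s *\<^sub>R axis j 1) - f x) - (s * s) *\<^sub>R fij x) \<le> e * s * s"
proof -
  have "isCont fij x" using cont by (simp add: continuous_on_eq_continuous_at)
  then obtain d where d: "d > 0" "\<And>y. norm (y - x) < d \<Longrightarrow> norm (fij y - fij x) < e"
    unfolding isCont_def LIM_eq using e by (metis diff_self norm_zero)
  show thesis
  \<comment> \<open>Half of d: a displacement by u in direction i and by v in direction j, both at
    most s in absolute value, stays within distance d.\<close>
  proof (rule that[of "d / 2"])
    show "0 < d / 2" using d by simp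
    fix s :: real assume s: "0 \<le> s" "s < d / 2"
    define G where "G u = f (x + s *\<^sub>R axis j 1 + u *\<^sub>R axis i 1) - f (x + u *\<^sub>R axis i 1)
        - (u * s) *\<^sub>R fij x" for u
    have dG: "(G has_vector_derivative fi (x + s *\<^sub>R axis j 1 + u *\<^sub>R axis i 1)
        - fi (x + u *\<^sub>R axis i 1) - s *\<^sub>R fij x) (at u)" for u
      unfolding G_def
      by (intro has_vector_derivative_diff has_pd_line[OF fi])
         (auto intro!: derivative_eq_intros)
    have bG: "norm (fi (x + s *\<^sub>R axis j 1 + u *\<^sub>R axis i 1)
        - fi (x + u *\<^sub>R axis i 1) - s *\<^sub>R fij x) \<le> e * s" if u: "\<bar>u\<bar> \<le> \<bar>s\<bar>" for u
    proof -
      define H where "H v = fi (x + u *\<^sub>R axis i 1 + v *\<^sub>R axis j 1) - v *\<^sub>R fij x" for v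
      have "norm (H s - H 0) \<le> e * \<bar>s\<bar>"
      proof (rule mvt_bound)
        fix v assume v: "\<bar>v\<bar> \<le> \<bar>s\<bar>"
        show "(H has_vector_derivative fij (x + u *\<^sub>R axis i 1 + v *\<^sub>R axis j 1) - fij x) (at v)"
          unfolding H_def
          by (intro has_vector_derivative_diff has_pd_line[OF fij])
             (auto intro!: derivative_eq_intros)
        have "norm (u *\<^sub>R axis i (1::real) + v *\<^sub>R axis j 1) \<le> \<bar>u\<bar> + \<bar>v\<bar>"
          by (rule order_trans[OF norm_triangle_ineq]) auto
        also have "\<dots> < d" using u v s by auto
        finally show "norm (fij (x + u *\<^sub>R axis i 1 + v *\<^sub>R axis j 1) - fij x) \<le> e"
          by (intro less_imp_le d(2)) (simp add: add.assoc)
      qed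
      then show ?thesis using s by (simp add: H_def algebra_simps)
    qed
    have "norm (G s - G 0) \<le> e * s * \<bar>s\<bar>"
      by (rule mvt_bound[OF dG bG])
    then show "norm (f (x + s *\<^sub>R axis i 1 + s *\<^sub>R axis j 1) - f (x + s *\<^sub>R axis i 1)
         - (f (x + s *\<^sub>R axis j 1) - f x) - (s * s) *\<^sub>R fij x) \<le> e * s * s"
      using s by (simp add: G_def algebra_simps)
  qed
qed

text \<open>Schwarz's theorem: the second difference over a square is symmetric in i and j, while
  the two orders of estimating it lead to \<open>fij x\<close> and \<open>fji x\<close>.\<close>

lemma mixed_partials_eq:
  fixes f :: "real^'d \<Rightarrow> 'b::real_normed_vector"
  assumes "has_pd i f fi" "has_pd j fi fij" "continuous_on UNIV fij"
    and "has_pd j f fj" "has_pd i fj fji" "continuous_on UNIV fji"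
  shows "fij = fji"
proof
  fix x
  show "fij x = fji x"
  proof (rule ccontr)
    assume "fij x \<noteq> fji x"
    \<comment> \<open>A quarter of the gap: two errors of e * s * s each can close only half of
      it.\<close>
    define e where "e = norm (fij x - fji x) / 4"
    have e: "e > 0" using \<open>fij x \<noteq> fji x\<close> by (simp add: e_def)
    obtain d1 where d1: "0 < d1" "\<And>s. 0 \<le> s \<Longrightarrow> s < d1 \<Longrightarrow>
       norm (f (x + s *\<^sub>R axis i 1 + s *\<^sub>R axis j 1) - f (x + s *\<^sub>R axis i 1)
         - (f (x + s *\<^sub>R axis j 1) - f x) - (s * s) *\<^sub>R fij x) \<le> e * s * s"
      using mixed_difference_bound[OF assms(1-3) e] by metis
    obtain d2 where d2: "0 < d2" "\<And>s. 0 \<le> s \<Longrightarrow> s < d2 \<Longrightarrow>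
       norm (f (x + s *\<^sub>R axis j 1 + s *\<^sub>R axis i 1) - f (x + s *\<^sub>R axis j 1)
         - (f (x + s *\<^sub>R axis i 1) - f x) - (s * s) *\<^sub>R fji x) \<le> e * s * s"
      using mixed_difference_bound[OF assms(4-6) e] by metis
    define s where "s = min d1 d2 / 2"
    have s: "0 < s" "s < d1" "s < d2" using d1(1) d2(1) by (auto simp: s_def)
    define A where "A = f (x + s *\<^sub>R axis i 1 + s *\<^sub>R axis j 1) - f (x + s *\<^sub>R axis i 1)
         - (f (x + s *\<^sub>R axis j 1) - f x)"
    have "norm (A - (s * s) *\<^sub>R fij x) \<le> e * s * s"
      using d1(2)[of s] s by (simp add: A_def)
    moreover have "norm (A - (s * s) *\<^sub>R fji x) \<le> e * s * s"
      using d2(2)[of s] s by (simp add: A_def algebra_simps)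
    ultimately have "norm ((s * s) *\<^sub>R fij x - (s * s) *\<^sub>R fji x) \<le> 2 * (e * s * s)"
      using norm_triangle_ineq4[of "A - (s * s) *\<^sub>R fji x" "A - (s * s) *\<^sub>R fij x"] by simp
    then have "(s * s) * norm (fij x - fji x) \<le> 2 * (e * s * s)"
      by (metis abs_of_nonneg norm_scaleR s(1) scaleR_right_diff_distrib zero_le_square)
    then have "(s * s) * (4 * e) \<le> (s * s) * (2 * e)" by (simp add: e_def)
    then show False using s e by (simp add: mult_le_cancel_left)
  qed
qed

lemma pd_commute:
  assumes "Cm (Suc (Suc 0)) f"
  shows "partial_deriv i (partial_deriv j f) = partial_deriv j (partial_deriv i f)"
proof -
  have *: "has_pd j (partial_deriv i f) (partial_deriv j (partial_deriv i f))"
    "continuous_on UNIV (partial_deriv j (partial_deriv i f))" for i j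
    using Cm_Suc_has_pd[OF Cm_Suc_pd[OF assms]] Cm_Suc_pd[OF Cm_Suc_pd[OF assms]] by simp_all
  show ?thesis
    by (rule mixed_partials_eq[OF Cm_Suc_has_pd[OF assms] * Cm_Suc_has_pd[OF assms] *])
qed

section \<open>Multi-index derivatives\<close>

lemma Cm_pd_pow: "Cm (n + k) f \<Longrightarrow> Cm k ((partial_deriv i ^^ n) f)"
  by (induction n arbitrary: f) (auto simp: funpow_swap1 Cm_Suc_pd)

lemma pd_pow_commute:
  "Cm (Suc n) f \<Longrightarrow> (partial_deriv i ^^ n) (partial_deriv j f) = partial_deriv j ((partial_deriv i ^^ n) f)"
proof (induction n arbitrary: f)
  case (Suc n)
  have "(partial_deriv i ^^ Suc n) (partial_deriv j f)
      = (partial_deriv i ^^ n) (partial_deriv i (partial_deriv j f))"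
    by (simp add: funpow_swap1)
  also have "partial_deriv i (partial_deriv j f) = partial_deriv j (partial_deriv i f)"
    by (rule pd_commute) (rule Cm_mono[OF Suc.prems], simp)
  also have "(partial_deriv i ^^ n) \<dots> = partial_deriv j ((partial_deriv i ^^ n) (partial_deriv i f))"
    by (rule Suc.IH) (rule Cm_Suc_pd[OF Suc.prems])
  finally show ?case by (simp add: funpow_swap1)
qed simp

abbreviation pdfold where
  "pdfold \<mu> xs f \<equiv> foldr (\<lambda>i. partial_deriv i ^^ (\<mu> $ i)) xs f"

lemma Cm_pdfold: "Cm ((\<Sum>i\<leftarrow>xs. \<mu> $ i) + k) f \<Longrightarrow> Cm k (pdfold \<mu> xs f)"
proof (induction xs arbitrary: k)
  case (Cons x xs)
  then have "Cm (\<mu> $ x + k) (pdfold \<mu> xs f)" by (simp add: add_ac)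
  then show ?case by (simp add: Cm_pd_pow)
qed simp

lemma pdfold_commute:
  "Cm (Suc (\<Sum>i\<leftarrow>xs. \<mu> $ i)) f \<Longrightarrow> pdfold \<mu> xs (partial_deriv j f) = partial_deriv j (pdfold \<mu> xs f)"
proof (induction xs)
  case (Cons x xs)
  have 1: "Cm (Suc (\<Sum>i\<leftarrow>xs. \<mu> $ i)) f" by (rule Cm_mono[OF Cons.prems]) simp
  have 2: "Cm (Suc (\<mu> $ x)) (pdfold \<mu> xs f)"
    by (rule Cm_pdfold, rule Cm_mono[OF Cons.prems]) simp
  show ?case using Cons.IH[OF 1] pd_pow_commute[OF 2] by simp
qed simp

text \<open>\<open>mderiv\<close> applies the partial derivatives in the sorted order of the
  coordinates. The additional derivative in direction j arises in the middle of that list and is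
  moved to the outside by symmetry; \<open>distinct\<close> makes it arise only once.\<close>

lemma pdfold_add_axis:
  assumes "distinct xs" "j \<in> set xs" "Cm (Suc (\<Sum>i\<leftarrow>xs. \<mu> $ i)) f"
  shows "pdfold (\<mu> + axis j 1) xs f = partial_deriv j (pdfold \<mu> xs f)"
  using assms
proof (induction xs)
  case (Cons x xs)
  have 1: "Cm (Suc (\<Sum>i\<leftarrow>xs. \<mu> $ i)) f" by (rule Cm_mono[OF Cons.prems(3)]) simp
  have 2: "Cm (Suc (\<mu> $ x)) (pdfold \<mu> xs f)"
    by (rule Cm_pdfold, rule Cm_mono[OF Cons.prems(3)]) simp
  show ?case
  proof (cases "x = j")
    case True
    have "pdfold (\<mu> + axis j 1) xs f = pdfold \<mu> xs f"
      using Cons.prems(1) True by (intro foldr_cong) (auto simp: axis_def)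
    then show ?thesis using True by (simp add: axis_def)
  next
    case False
    with Cons.IH[OF _ _ 1] Cons.prems pd_pow_commute[OF 2] show ?thesis
      by (auto simp: axis_def)
  qed
qed simp

lemma mabs_sum_list: "mabs (\<mu> :: nat^'d::{finite,linorder}) = (\<Sum>i\<leftarrow>sorted_list_of_set UNIV. \<mu> $ i)"
  by (simp add: mabs_def sum_list_distinct_conv_sum_set)

lemma mderiv_0 [simp]: "mderiv 0 f = f"
proof -
  have "pdfold 0 xs f = f" for xs by (induction xs) auto
  then show ?thesis by (simp add: mderiv_def)
qed

lemma Cm_mderiv: "Cm (mabs \<mu> + k) f \<Longrightarrow> Cm k (mderiv \<mu> f)"
  unfolding mderiv_def by (rule Cm_pdfold) (simp add: mabs_sum_list)

lemma Cm_mderiv': "Cm m f \<Longrightarrow> mabs \<mu> + k \<le> m \<Longrightarrow> Cm k (mderiv \<mu> f)"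
  using Cm_mderiv Cm_mono by blast

lemma mderiv_pd: "Cm (Suc (mabs \<mu>)) f \<Longrightarrow> mderiv \<mu> (partial_deriv j f) = partial_deriv j (mderiv \<mu> f)"
  unfolding mderiv_def by (rule pdfold_commute) (simp add: mabs_sum_list)

lemma mderiv_add_axis_left:
  "Cm (Suc (mabs \<mu>)) f \<Longrightarrow> mderiv (\<mu> + axis j 1) f = partial_deriv j (mderiv \<mu> f)"
  unfolding mderiv_def mabs_sum_list by (rule pdfold_add_axis) simp_all

lemma mderiv_add_axis:
  "Cm (Suc (mabs \<mu>)) f \<Longrightarrow> mderiv (\<mu> + axis j 1) f = mderiv \<mu> (partial_deriv j f)"
  by (metis mderiv_add_axis_left mderiv_pd)

lemma mabs_0 [simp]: "mabs 0 = 0"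
  by (simp add: mabs_def)

lemma mabs_add [simp]: "mabs (\<mu> + \<kappa>) = mabs \<mu> + mabs \<kappa>"
  by (simp add: mabs_def sum.distrib)

lemma mabs_axis [simp]: "mabs (axis i n) = n"
  by (simp add: mabs_def axis_def)

text \<open>Every multi-index is reached from 0 by unit steps, so with
  \<open>mderiv_add_axis\<close> each fact about \<open>mderiv\<close> reduces to one about a single
  partial derivative.\<close>

lemma multiindex_induct [case_names zero add]:
  assumes "P 0" and "\<And>\<mu> i. P \<mu> \<Longrightarrow> P (\<mu> + axis i 1)"
  shows "P (\<mu> :: nat^'d)"
proof (induction "mabs \<mu>" arbitrary: \<mu>)
  case 0
  then have "\<mu> = 0" by (simp add: mabs_def vec_eq_iff)
  then show ?case using assms(1) by simp
next
  case (Suc n)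
  then have "mabs \<mu> \<noteq> 0" by simp
  then obtain i where i: "\<mu> $ i \<noteq> 0" unfolding mabs_def by (meson sum.neutral)
  have eq: "\<mu> = (\<mu> - axis i 1) + axis i 1" using i by (auto simp: vec_eq_iff axis_def)
  then have "mabs \<mu> = mabs (\<mu> - axis i 1) + 1" by (metis mabs_add mabs_axis)
  then have "P (\<mu> - axis i 1)" using Suc by simp
  then show ?case using assms(2) eq by metis
qed

lemma mderiv_linear:
  assumes L: "bounded_linear L"
  shows "Cm (mabs \<mu>) f \<Longrightarrow> mderiv \<mu> (\<lambda>x. L (f x)) = (\<lambda>x. L (mderiv \<mu> f x))"
proof (induction \<mu> arbitrary: f rule: multiindex_induct)
  case (add \<mu> i)
  have C: "Cm (Suc (mabs \<mu>)) f" using add.prems by simp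
  have "mderiv (\<mu> + axis i 1) (\<lambda>x. L (f x)) = mderiv \<mu> (partial_deriv i (\<lambda>x. L (f x)))"
    by (rule mderiv_add_axis[OF Cm_linear[OF L C]])
  also have "partial_deriv i (\<lambda>x. L (f x)) = (\<lambda>x. L (partial_deriv i f x))"
    by (rule has_pd_partial_deriv[OF has_pd_linear[OF L Cm_Suc_has_pd[OF C]]])
  also have "mderiv \<mu> \<dots> = (\<lambda>x. L (mderiv \<mu> (partial_deriv i f) x))"
    by (rule add.IH[OF Cm_Suc_pd[OF C]])
  finally show ?case using mderiv_add_axis[OF C] by simp
qed simp

lemma mderiv_add:
  "Cm (mabs \<mu>) f \<Longrightarrow> Cm (mabs \<mu>) g \<Longrightarrow>
     mderiv \<mu> (\<lambda>x. f x + g x) = (\<lambda>x. mderiv \<mu> f x + mderiv \<mu> g x)"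
proof (induction \<mu> arbitrary: f g rule: multiindex_induct)
  case (add \<mu> i)
  have C: "Cm (Suc (mabs \<mu>)) f" "Cm (Suc (mabs \<mu>)) g" using add.prems by simp_all
  have "mderiv (\<mu> + axis i 1) (\<lambda>x. f x + g x) = mderiv \<mu> (partial_deriv i (\<lambda>x. f x + g x))"
    by (rule mderiv_add_axis[OF Cm_add[OF C]])
  also have "partial_deriv i (\<lambda>x. f x + g x) = (\<lambda>x. partial_deriv i f x + partial_deriv i g x)"
    by (rule has_pd_partial_deriv[OF has_pd_add[OF C[THEN Cm_Suc_has_pd]]])
  also have "mderiv \<mu> \<dots> = (\<lambda>x. mderiv \<mu> (partial_deriv i f) x + mderiv \<mu> (partial_deriv i g) x)"
    by (rule add.IH[OF C[THEN Cm_Suc_pd]])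
  finally show ?case using C[THEN mderiv_add_axis] by simp
qed simp

lemma mderiv_const_0 [simp]: "mderiv \<mu> (\<lambda>x. 0) = (\<lambda>x. 0)"
  using mderiv_linear[OF bounded_linear_zero Cm_const[of _ "0::'b"], of \<mu>] by simp

lemma mderiv_sum:
  "(\<And>k. k \<in> F \<Longrightarrow> Cm (mabs \<mu>) (f k)) \<Longrightarrow>
     mderiv \<mu> (\<lambda>x. \<Sum>k\<in>F. f k x) = (\<lambda>x. \<Sum>k\<in>F. mderiv \<mu> (f k) x)"
proof (induction F rule: infinite_finite_induct)
  case (insert k F)
  then show ?case using mderiv_add[of \<mu> "f k" "\<lambda>x. \<Sum>k\<in>F. f k x"] Cm_sum[of F "mabs \<mu>" f] by simp
qed simp_all

lemma mderiv_affine: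
  "Cm (mabs \<mu>) f \<Longrightarrow> mderiv \<mu> (\<lambda>x. f (c *\<^sub>R x + b)) = (\<lambda>x. c ^ mabs \<mu> *\<^sub>R mderiv \<mu> f (c *\<^sub>R x + b))"
proof (induction \<mu> arbitrary: f rule: multiindex_induct)
  case (add \<mu> i)
  have C: "Cm (Suc (mabs \<mu>)) f" using add.prems by simp
  have C': "Cm (mabs \<mu>) (\<lambda>x. partial_deriv i f (c *\<^sub>R x + b))"
    by (rule Cm_affine[OF Cm_Suc_pd[OF C]])
  have "mderiv (\<mu> + axis i 1) (\<lambda>x. f (c *\<^sub>R x + b)) = mderiv \<mu> (partial_deriv i (\<lambda>x. f (c *\<^sub>R x + b)))"
    by (rule mderiv_add_axis[OF Cm_affine[OF C]])
  also have "partial_deriv i (\<lambda>x. f (c *\<^sub>R x + b)) = (\<lambda>x. c *\<^sub>R partial_deriv i f (c *\<^sub>R x + b))"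
    by (rule has_pd_partial_deriv[OF has_pd_affine[OF Cm_Suc_has_pd[OF C]]])
  also have "mderiv \<mu> \<dots> = (\<lambda>x. c *\<^sub>R mderiv \<mu> (\<lambda>x. partial_deriv i f (c *\<^sub>R x + b)) x)"
    by (rule mderiv_linear[OF bounded_linear_scaleR_right C'])
  also have "\<dots> = (\<lambda>x. c *\<^sub>R c ^ mabs \<mu> *\<^sub>R mderiv \<mu> (partial_deriv i f) (c *\<^sub>R x + b))"
    by (subst add.IH[OF Cm_Suc_pd[OF C]]) simp
  finally show ?case using mderiv_add_axis[OF C] by (simp add: mult.commute)
qed simp

lemma mderiv_translate:
  "Cm (mabs \<mu>) f \<Longrightarrow> mderiv \<mu> (\<lambda>x. f (x + b)) = (\<lambda>x. mderiv \<mu> f (x + b))"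
  using mderiv_affine[of \<mu> f 1 b] by simp

lemma mderiv_add_multiindex:
  "Cm (mabs \<kappa> + mabs \<mu>) f \<Longrightarrow> mderiv \<kappa> (mderiv \<mu> f) = mderiv (\<kappa> + \<mu>) f"
proof (induction \<mu> arbitrary: f rule: multiindex_induct)
  case (add \<mu> i)
  then have C: "Cm (Suc (mabs \<kappa> + mabs \<mu>)) f" by simp
  have "mderiv \<kappa> (mderiv (\<mu> + axis i 1) f) = mderiv \<kappa> (mderiv \<mu> (partial_deriv i f))"
    by (subst mderiv_add_axis) (auto intro: Cm_mono[OF C])
  also have "\<dots> = mderiv (\<kappa> + \<mu>) (partial_deriv i f)"
    by (rule add.IH[OF Cm_Suc_pd[OF C]])
  also have "\<dots> = mderiv (\<kappa> + \<mu> + axis i 1) f"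
    by (rule mderiv_add_axis[symmetric]) (use C in simp)
  finally show ?case by (simp add: add.assoc)
qed simp

section \<open>Locality of derivatives and of smoothness\<close>

lemma pd_local:
  assumes "open U" "\<And>x. x \<in> U \<Longrightarrow> f x = g x" "x \<in> U"
  shows "partial_deriv i f x = partial_deriv i g x"
proof -
  have "continuous (at 0) (\<lambda>t::real. x + t *\<^sub>R axis i 1)" by (intro continuous_intros)
  then have "\<forall>\<^sub>F t in at 0. x + t *\<^sub>R axis i 1 \<in> U"
    using assms unfolding continuous_within by (intro topological_tendstoD) auto
  then have "\<forall>\<^sub>F t in nhds 0. f (x + t *\<^sub>R axis i 1) = g (x + t *\<^sub>R axis i 1)"
    using assms by (auto simp: eventually_at_filter elim!: eventually_mono)
  then show ?thesis unfolding partial_deriv_def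
    by (intro vector_derivative_cong_eq) auto
qed

text \<open>This turns locally finite lattice sums into finite ones under the derivative, and makes
  derivatives vanish outside the support.\<close>

lemma mderiv_local:
  fixes f g :: "real^'d::{finite,linorder} \<Rightarrow> 'b::real_normed_vector"
  assumes "open U" "\<And>x. x \<in> U \<Longrightarrow> f x = g x" "x \<in> U"
  shows "mderiv \<mu> f x = mderiv \<mu> g x"
proof -
  have pow: "\<forall>x\<in>U. (partial_deriv i ^^ n) f x = (partial_deriv i ^^ n) g x"
    if "\<forall>x\<in>U. f x = g x" for f g :: "real^'d::{finite,linorder} \<Rightarrow> 'b" and i n
    using that by (induction n) (auto intro!: pd_local[OF assms(1)])
  have "\<forall>x\<in>U. pdfold \<mu> xs f x = pdfold \<mu> xs g x" for xs
    using assms(2) by (induction xs) (auto intro!: pow[rule_format])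
  then show ?thesis using assms(3) by (simp add: mderiv_def)
qed

text \<open>Meant for \<open>shift_sum\<close>, an infinite sum that agrees with a different finite
  sum near each point.\<close>

lemma Cm_local:
  "(\<And>x. \<exists>U g. open U \<and> x \<in> U \<and> (\<forall>y\<in>U. f y = g y) \<and> Cm m g) \<Longrightarrow> Cm m f"
proof (induction m arbitrary: f)
  case 0
  have "isCont f x" for x
  proof -
    obtain U g where U: "open U" "x \<in> U" "\<forall>y\<in>U. f y = g y" "continuous_on UNIV g"
      using "0"[of x] by auto
    then have "isCont g x" by (simp add: continuous_on_eq_continuous_at)
    moreover have "\<forall>\<^sub>F y in nhds x. f y = g y"
      using U eventually_nhds by blast
    ultimately show ?thesis by (simp add: isCont_cong)
  qed
  then show ?case by (simp add: continuous_at_imp_continuous_on)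
next
  case (Suc m)
  have "continuous_on UNIV f"
  proof -
    have "isCont f x" for x
    proof -
      obtain U g where U: "open U" "x \<in> U" "\<forall>y\<in>U. f y = g y" "continuous_on UNIV g"
        using Suc.prems[of x] Cm_continuous by metis
      then have "isCont g x" by (simp add: continuous_on_eq_continuous_at)
      moreover have "\<forall>\<^sub>F y in nhds x. f y = g y"
        using U eventually_nhds by blast
      ultimately show ?thesis by (simp add: isCont_cong)
    qed
    then show ?thesis by (simp add: continuous_at_imp_continuous_on)
  qed
  moreover have "has_pd i f (partial_deriv i f)" for i
    unfolding has_pd_def
  proof
    fix x
    obtain U g where U: "open U" "x \<in> U" "\<forall>y\<in>U. f y = g y" "Cm (Suc m) g"
      using Suc.prems[of x] by auto
    have "continuous (at 0) (\<lambda>t::real. x + t *\<^sub>R axis i 1)" by (intro continuous_intros)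
    then have "\<forall>\<^sub>F t in at 0. x + t *\<^sub>R axis i 1 \<in> U"
      using U unfolding continuous_within by (intro topological_tendstoD) auto
    then have "\<forall>\<^sub>F t in nhds 0. f (x + t *\<^sub>R axis i 1) = g (x + t *\<^sub>R axis i 1)"
      using U by (auto simp: eventually_at_filter elim!: eventually_mono)
    moreover have "((\<lambda>t. g (x + t *\<^sub>R axis i 1)) has_vector_derivative partial_deriv i g x) (at 0)"
      using Cm_Suc_has_pd[OF U(4)] by (simp add: has_pd_def)
    ultimately have "((\<lambda>t. f (x + t *\<^sub>R axis i 1)) has_vector_derivative partial_deriv i g x) (at 0)"
      by (subst has_vector_derivative_cong_ev[where g = "\<lambda>t. g (x + t *\<^sub>R axis i 1)"])
         (auto simp: eventually_nhds elim: eventually_mono dest: eventually_nhds_x_imp_x)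
    moreover have "partial_deriv i f x = partial_deriv i g x"
      using U by (intro pd_local[of U]) auto
    ultimately show "((\<lambda>t. f (x + t *\<^sub>R axis i 1)) has_vector_derivative partial_deriv i f x) (at 0)"
      by simp
  qed
  moreover have "Cm m (partial_deriv i f)" for i
  proof (rule Suc.IH)
    fix x
    obtain U g where U: "open U" "x \<in> U" "\<forall>y\<in>U. f y = g y" "Cm (Suc m) g"
      using Suc.prems[of x] by auto
    then have "\<forall>y\<in>U. partial_deriv i f y = partial_deriv i g y"
      using pd_local[of U] by blast
    then show "\<exists>U g. open U \<and> x \<in> U \<and> (\<forall>y\<in>U. partial_deriv i f y = g y) \<and> Cm m g"
      using U(1,2) Cm_Suc_pd[OF U(4)] by blast
  qed
  ultimately show ?case unfolding Cm_Suc_iff by blast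
qed

lemma Cm_vec:
  fixes f :: "real^'d \<Rightarrow> 'b::real_normed_vector^'n"
  assumes "\<And>i. Cm m (\<lambda>x. f x $ i)"
  shows "Cm m f"
proof -
  have bl: "bounded_linear (axis i :: 'b \<Rightarrow> 'b^'n)" for i
  proof (rule bounded_linear_intro[where K = 1])
    show "norm (axis i x :: 'b^'n) \<le> norm x * 1" for x
      by (simp add: norm_vec_def L2_set_def axis_def if_distrib[of norm] if_distrib[of "\<lambda>x. x^2"] cong: if_cong)
  qed (auto simp: axis_def vec_eq_iff)
  have "f = (\<lambda>x. \<Sum>i\<in>UNIV. axis i (f x $ i))"
    by (auto simp: fun_eq_iff vec_eq_iff axis_def)
  moreover have "Cm m (\<lambda>x. \<Sum>i\<in>UNIV. axis i (f x $ i))"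
    by (intro Cm_sum Cm_linear[OF bl] assms)
  ultimately show ?thesis by simp
qed

lemma Cm_nth: "Cm m f \<Longrightarrow> Cm m (\<lambda>x. f x $ i)"
  by (rule Cm_linear[OF bounded_linear_vec_nth])

lemma mderiv_nth: "Cm (mabs \<mu>) f \<Longrightarrow> mderiv \<mu> f x $ i = mderiv \<mu> (\<lambda>x. f x $ i) x"
  by (simp add: mderiv_linear[OF bounded_linear_vec_nth])

text \<open>The path from 0 to h switches on one coordinate after another. Its points are dominated
  by h in each coordinate, so B applies to them, and each of the d pieces contributes at most
  \<open>norm h * B\<close>.\<close>

lemma coordinate_mvt_bound:
  fixes g :: "real^'d \<Rightarrow> 'b::real_normed_vector"
  assumes pd: "\<And>i. has_pd i g (g' i)"
    and B: "\<And>i h'. norm h' \<le> norm h \<Longrightarrow> norm (g' i h') \<le> B"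
  shows "norm (g h - g 0) \<le> real CARD('d) * (norm h * B)"
proof -
  define r where "r I = (\<chi> j. if j \<in> I then h $ j else 0)" for I :: "'d set"
  have B0: "0 \<le> B" using order_trans[OF norm_ge_zero B[of 0]] by simp
  have "norm (g (r I) - g 0) \<le> real (card I) * (norm h * B)" if "finite I" for I
    using that
  proof induction
    case empty
    have "r {} = 0" by (simp add: r_def vec_eq_iff)
    then show ?case by simp
  next
    case (insert i I)
    have ri: "r (insert i I) = r I + (h $ i) *\<^sub>R axis i 1"
      using insert by (auto simp: r_def vec_eq_iff axis_def)
    have "norm (g (r I + (h $ i) *\<^sub>R axis i 1) - g (r I + 0 *\<^sub>R axis i 1)) \<le> B * \<bar>h $ i\<bar>"
    proof (rule mvt_bound[where g = "\<lambda>u. g (r I + u *\<^sub>R axis i 1)"])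
      fix u assume u: "\<bar>u\<bar> \<le> \<bar>h $ i\<bar>"
      show "((\<lambda>u. g (r I + u *\<^sub>R axis i 1)) has_vector_derivative g' i (r I + u *\<^sub>R axis i 1)) (at u)"
        by (rule has_pd_line[OF pd])
      show "norm (g' i (r I + u *\<^sub>R axis i 1)) \<le> B"
      proof (rule B, rule norm_le_componentwise_cart)
        show "norm ((r I + u *\<^sub>R axis i 1) $ j) \<le> norm (h $ j)" for j
          using u insert(2) by (auto simp: r_def axis_def)
      qed
    qed
    also have "\<dots> \<le> norm h * B"
      using mult_left_mono[OF component_le_norm_cart[of h i] B0] by (simp add: mult.commute)
    finally have "norm (g (r (insert i I)) - g (r I)) \<le> norm h * B" by (simp add: ri)
    then have "norm (g (r (insert i I)) - g 0) \<le> norm h * B + real (card I) * (norm h * B)"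
      using insert.IH norm_triangle_le[of "g (r (insert i I)) - g (r I)" "g (r I) - g 0"] by simp
    then show ?case using insert by (simp add: algebra_simps)
  qed
  from this[of UNIV] show ?thesis by (simp add: r_def vec_nth_inverse)
qed

section \<open>Monomials and Taylor's theorem\<close>

lemma finite_vec_set:
  assumes "\<And>i. finite (S i)"
  shows "finite {x :: 'a^'n. \<forall>i. x $ i \<in> S i}"
proof (rule finite_subset)
  show "{x :: 'a^'n. \<forall>i. x $ i \<in> S i} \<subseteq> vec_lambda ` (\<Pi>\<^sub>E i\<in>UNIV. S i)"
  proof
    fix x :: "'a^'n" assume "x \<in> {x. \<forall>i. x $ i \<in> S i}"
    then have "vec_nth x \<in> (\<Pi>\<^sub>E i\<in>UNIV. S i)" by auto
    then show "x \<in> vec_lambda ` (\<Pi>\<^sub>E i\<in>UNIV. S i)"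
      by (metis image_eqI vec_nth_inverse)
  qed
  show "finite (vec_lambda ` (\<Pi>\<^sub>E i\<in>UNIV. S i) :: ('a^'n) set)"
    using assms by (intro finite_imageI finite_PiE) auto
qed

text \<open>Distributivity over all coordinates at once: it turns one-dimensional identities
  (binomial expansion, character sums, interpolation weights) into their tensor products.\<close>

lemma prod_sum_vec:
  fixes f :: "'n::finite \<Rightarrow> 'a \<Rightarrow> 'b::comm_semiring_1"
  assumes "\<And>i. finite (S i)"
  shows "(\<Prod>i\<in>UNIV. \<Sum>k\<in>S i. f i k) = (\<Sum>x | \<forall>i. x $ i \<in> S i. \<Prod>i\<in>UNIV. f i (x $ i))"
proof -
  have "(\<Prod>i\<in>UNIV. \<Sum>k\<in>S i. f i k) = (\<Sum>g\<in>(\<Pi>\<^sub>E i\<in>UNIV. S i). \<Prod>i\<in>UNIV. f i (g i))"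
    using assms by (intro prod_sum_PiE) auto
  also have "\<dots> = (\<Sum>x | \<forall>i. x $ i \<in> S i. \<Prod>i\<in>UNIV. f i (x $ i))"
    by (rule sum.reindex_bij_witness[of _ vec_nth vec_lambda]) auto
  finally show ?thesis .
qed

lemma finite_mabs_le: "finite {\<mu> :: nat^'d. mabs \<mu> \<le> n}"
proof (rule finite_subset)
  show "{\<mu> :: nat^'d. mabs \<mu> \<le> n} \<subseteq> {\<mu>. \<forall>i. \<mu> $ i \<in> {..n}}"
    unfolding mabs_def
    by (auto intro: order_trans[OF member_le_sum[of _ UNIV "\<lambda>i. \<mu> $ i" for \<mu> :: "nat^'d"]])
  show "finite {\<mu> :: nat^'d. \<forall>i. \<mu> $ i \<in> {..n}}" by (rule finite_vec_set) simp
qed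

lemma finite_mabs_eq: "finite {\<mu> :: nat^'d. mabs \<mu> = n}"
  by (rule finite_subset[OF _ finite_mabs_le[of n]]) auto

lemma finite_multiindex_le: "finite {\<kappa> :: nat^'d. \<kappa> \<le> \<mu>}"
  using finite_vec_set[of "\<lambda>i. {..\<mu> $ i}"] by (simp add: less_eq_vec_def)

lemma multiindex_diff_add: "\<kappa> \<le> \<mu> \<Longrightarrow> \<mu> - \<kappa> + \<kappa> = (\<mu> :: nat^'d)"
  by (auto simp: vec_eq_iff less_eq_vec_def)

lemma mabs_diff: "\<kappa> \<le> \<mu> \<Longrightarrow> mabs (\<mu> - \<kappa>) + mabs \<kappa> = mabs \<mu>"
  by (metis mabs_add multiindex_diff_add)

lemma mabs_pos_if_le: "\<kappa> \<le> \<mu> \<Longrightarrow> \<kappa> \<noteq> \<mu> \<Longrightarrow> mabs \<kappa> < mabs (\<mu> :: nat^'d)"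
proof -
  assume a: "\<kappa> \<le> \<mu>" "\<kappa> \<noteq> \<mu>"
  then obtain i where "\<kappa> $ i < \<mu> $ i" by (metis less_eq_vec_def order_le_less vec_eq_iff)
  with a show ?thesis unfolding mabs_def by (intro sum_strict_mono_ex1) (auto simp: less_eq_vec_def)
qed

lemma mabs_eq_0_iff: "mabs \<mu> = 0 \<longleftrightarrow> \<mu> = 0"
  by (auto simp: mabs_def vec_eq_iff)

lemma nmonom_prod: "nmonom \<mu> x = (\<Prod>i\<in>UNIV. complex_of_real ((x $ i) ^ (\<mu> $ i) / fact (\<mu> $ i)))"
  by (simp add: nmonom_def mpow_def mfact_def prod_dividef)

lemma nmonom_0 [simp]: "nmonom 0 x = 1"
  by (simp add: nmonom_prod)

lemma nmonom_at_0: "nmonom (\<mu> :: nat^'d) 0 = (if \<mu> = 0 then 1 else 0)"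
proof (cases "\<mu> = 0")
  case False
  then obtain i where "\<mu> $ i \<noteq> 0" by (auto simp: vec_eq_iff)
  then have "complex_of_real (((0::real^'d) $ i) ^ (\<mu> $ i) / fact (\<mu> $ i)) = 0" by simp
  with False show ?thesis unfolding nmonom_prod by (subst prod_zero) auto
qed simp

lemma nmonom_scale: "nmonom \<mu> (c *\<^sub>R x) = of_real c ^ mabs \<mu> * nmonom \<mu> x"
proof -
  have "nmonom \<mu> (c *\<^sub>R x) = (\<Prod>i\<in>UNIV. of_real c ^ (\<mu> $ i) * complex_of_real ((x $ i) ^ (\<mu> $ i) / fact (\<mu> $ i)))"
    unfolding nmonom_prod by (simp add: power_mult_distrib)
  also have "\<dots> = of_real c ^ mabs \<mu> * nmonom \<mu> x"
    unfolding nmonom_prod prod.distrib mabs_def power_sum ..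
  finally show ?thesis .
qed

text \<open>A product of one-dimensional binomial theorems; the division by factorials has absorbed
  the binomial coefficients.\<close>

lemma nmonom_add: "nmonom \<mu> (x + y) = (\<Sum>\<kappa> | \<kappa> \<le> \<mu>. nmonom \<kappa> x * nmonom (\<mu> - \<kappa>) y)"
proof -
  have bin: "(a + b) ^ n / fact n = (\<Sum>k\<in>{..n}. (a ^ k / fact k) * (b ^ (n - k) / fact (n - k)))"
    for a b :: real and n
    unfolding binomial_ring sum_divide_distrib
    by (rule sum.cong) (auto simp: binomial_fact field_simps)
  have "nmonom \<mu> (x + y) = (\<Prod>i\<in>UNIV. \<Sum>k\<in>{..\<mu> $ i}.
      complex_of_real (((x $ i) ^ k / fact k) * ((y $ i) ^ (\<mu> $ i - k) / fact (\<mu> $ i - k))))"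
    unfolding nmonom_prod vector_add_component bin by simp
  also have "\<dots> = (\<Sum>\<kappa> | \<forall>i. \<kappa> $ i \<in> {..\<mu> $ i}. \<Prod>i\<in>UNIV.
      complex_of_real (((x $ i) ^ (\<kappa> $ i) / fact (\<kappa> $ i)) * ((y $ i) ^ (\<mu> $ i - \<kappa> $ i) / fact (\<mu> $ i - \<kappa> $ i))))"
    by (rule prod_sum_vec) simp
  also have "\<dots> = (\<Sum>\<kappa> | \<kappa> \<le> \<mu>. nmonom \<kappa> x * nmonom (\<mu> - \<kappa>) y)"
    unfolding nmonom_prod of_real_mult prod.distrib by (simp add: less_eq_vec_def)
  finally show ?thesis .
qed

lemma continuous_nmonom: "continuous_on UNIV (nmonom \<mu>)"
  unfolding nmonom_def mpow_def mfact_def by (intro continuous_intros) auto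

lemma has_pd_nmonom:
  "has_pd i (nmonom \<mu>) (\<lambda>x. if \<mu> $ i = 0 then 0 else nmonom (\<mu> - axis i 1) x)"
  unfolding has_pd_def
proof
  fix x :: "real^'a"
  define C where "C = (\<Prod>j\<in>UNIV - {i}. (x $ j) ^ (\<mu> $ j) / fact (\<mu> $ j))"
  have eq: "nmonom \<mu> (x + t *\<^sub>R axis i 1) = complex_of_real ((x $ i + t) ^ (\<mu> $ i) / fact (\<mu> $ i) * C)" for t
    unfolding nmonom_prod of_real_prod[symmetric] C_def
    by (subst prod.remove[of UNIV i]) (auto simp: axis_def intro!: prod.cong)
  have "((\<lambda>t. (x $ i + t) ^ (\<mu> $ i) / fact (\<mu> $ i) * C) has_real_derivative
      (if \<mu> $ i = 0 then 0 else (x $ i) ^ (\<mu> $ i - 1) / fact (\<mu> $ i - 1)) * C) (at 0)"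
  proof (rule DERIV_cong)
    show "((\<lambda>t. (x $ i + t) ^ (\<mu> $ i) / fact (\<mu> $ i) * C) has_real_derivative
        real (\<mu> $ i) * (x $ i) ^ (\<mu> $ i - 1) / fact (\<mu> $ i) * C) (at 0)"
      by (auto intro!: derivative_eq_intros)
    show "real (\<mu> $ i) * (x $ i) ^ (\<mu> $ i - 1) / fact (\<mu> $ i) * C
        = (if \<mu> $ i = 0 then 0 else (x $ i) ^ (\<mu> $ i - 1) / fact (\<mu> $ i - 1)) * C"
      by (cases "\<mu> $ i") (simp_all del: of_nat_Suc)
  qed
  then have "((\<lambda>t. nmonom \<mu> (x + t *\<^sub>R axis i 1)) has_vector_derivative
      complex_of_real ((if \<mu> $ i = 0 then 0 else (x $ i) ^ (\<mu> $ i - 1) / fact (\<mu> $ i - 1)) * C)) (at 0)"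
    unfolding eq has_real_derivative_iff_has_vector_derivative
    by (rule bounded_linear.has_vector_derivative[OF bounded_linear_of_real])
  also have "complex_of_real ((if \<mu> $ i = 0 then 0 else (x $ i) ^ (\<mu> $ i - 1) / fact (\<mu> $ i - 1)) * C)
      = (if \<mu> $ i = 0 then 0 else nmonom (\<mu> - axis i 1) x)"
    unfolding nmonom_prod of_real_prod[symmetric] C_def
    by (subst prod.remove[of UNIV i]) (auto simp: axis_def intro!: prod.cong)
  finally show "((\<lambda>t. nmonom \<mu> (x + t *\<^sub>R axis i 1)) has_vector_derivative
      (if \<mu> $ i = 0 then 0 else nmonom (\<mu> - axis i 1) x)) (at 0)" .
qed

lemma Cm_nmonom: "Cm m (nmonom \<mu>)"
\<comment> \<open>The zero function belongs to the family because a derivative in a direction absent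
  from the monomial vanishes.\<close>
proof (rule Cm_family[where F = "insert (\<lambda>x. 0) (range nmonom)"])
  fix f :: "real^'a \<Rightarrow> complex" and i assume f: "f \<in> insert (\<lambda>x. 0) (range nmonom)"
  show "\<exists>f'\<in>insert (\<lambda>x. 0) (range nmonom). has_pd i f f'"
  proof (cases "f = (\<lambda>x. 0)")
    case True
    then show ?thesis using has_pd_const[of i "0::complex"] by auto
  next
    case False
    with f obtain \<kappa> where "f = nmonom \<kappa>" by auto
    with has_pd_nmonom[of i \<kappa>] show ?thesis by (cases "\<kappa> $ i = 0") auto
  qed
qed (auto intro: continuous_nmonom)

text \<open>The case distinction guards against the truncating \<open>-\<close> on
  multi-indices.\<close>

lemma mderiv_nmonom:
  "mderiv \<nu> (nmonom \<mu>) = (\<lambda>x. if \<nu> \<le> \<mu> then nmonom (\<mu> - \<nu>) x else 0)"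
proof (induction \<nu> arbitrary: \<mu> rule: multiindex_induct)
  case zero
  then show ?case by (simp add: less_eq_vec_def)
next
  case (add \<nu> i)
  have "mderiv (\<nu> + axis i 1) (nmonom \<mu>) = mderiv \<nu> (partial_deriv i (nmonom \<mu>))"
    by (rule mderiv_add_axis[OF Cm_nmonom])
  also have "partial_deriv i (nmonom \<mu>) = (\<lambda>x. if \<mu> $ i = 0 then 0 else nmonom (\<mu> - axis i 1) x)"
    by (rule has_pd_partial_deriv[OF has_pd_nmonom])
  also have "mderiv \<nu> \<dots> = (\<lambda>x. if \<nu> + axis i 1 \<le> \<mu> then nmonom (\<mu> - (\<nu> + axis i 1)) x else 0)"
  proof (cases "\<mu> $ i = 0")
    case True
    then have "\<not> \<nu> + axis i 1 \<le> \<mu>" by (auto simp: less_eq_vec_def axis_def intro!: exI[of _ i])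
    with True show ?thesis by simp
  next
    case False
    then have "\<nu> + axis i 1 \<le> \<mu> \<longleftrightarrow> \<nu> \<le> \<mu> - axis i 1"
      by (auto simp: less_eq_vec_def axis_def; metis Suc_leI Suc_le_mono Suc_pred le_diff_conv2 add.commute plus_1_eq_Suc not_gr_zero)
    moreover have "\<mu> - axis i 1 - \<nu> = \<mu> - (\<nu> + axis i 1)"
      by (auto simp: vec_eq_iff)
    ultimately show ?thesis using False add.IH[of "\<mu> - axis i 1"] by (simp del: One_nat_def cong: if_cong)
  qed
  finally show ?case .
qed

text \<open>Differentiating by \<kappa> isolates its coefficient: among monomials of the same
  degree, \<kappa> \<le> \<mu> forces \<mu> = \<kappa>. An open set is enough because derivatives
  are local.\<close>

lemma nmonom_sum_unique:
  fixes c :: "nat^'d::{finite,linorder} \<Rightarrow> complex"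
  assumes "open U" "U \<noteq> {}"
    and zero: "\<And>x. x \<in> U \<Longrightarrow> (\<Sum>\<mu> | mabs \<mu> = s. c \<mu> * nmonom \<mu> x) = 0"
    and "mabs \<kappa> = s"
  shows "c \<kappa> = 0"
proof -
  obtain x where x: "x \<in> U" using assms by auto
  have C: "Cm k (\<lambda>x. c \<mu> * nmonom \<mu> x)" for \<mu> k
    by (rule Cm_linear[OF bounded_linear_mult_right Cm_nmonom])
  have "mderiv \<kappa> (\<lambda>x. \<Sum>\<mu> | mabs \<mu> = s. c \<mu> * nmonom \<mu> x) x = mderiv \<kappa> (\<lambda>x. 0) x"
    using zero x by (intro mderiv_local[OF assms(1)])
  then have "0 = mderiv \<kappa> (\<lambda>x. \<Sum>\<mu> | mabs \<mu> = s. c \<mu> * nmonom \<mu> x) x" by simp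
  also have "\<dots> = (\<Sum>\<mu> | mabs \<mu> = s. c \<mu> * mderiv \<kappa> (nmonom \<mu>) x)"
    by (simp add: mderiv_sum[OF C] mderiv_linear[OF bounded_linear_mult_right Cm_nmonom])
  also have "\<dots> = (\<Sum>\<mu> | mabs \<mu> = s. if \<mu> = \<kappa> then c \<kappa> else 0)"
  proof (rule sum.cong[OF refl])
    fix \<mu> :: "nat^'d::{finite,linorder}" assume "\<mu> \<in> {\<mu>. mabs \<mu> = s}"
    then have "\<kappa> \<le> \<mu> \<longleftrightarrow> \<mu> = \<kappa>" using assms(4) mabs_pos_if_le[of \<kappa> \<mu>] by fastforce
    then show "c \<mu> * mderiv \<kappa> (nmonom \<mu>) x = (if \<mu> = \<kappa> then c \<kappa> else 0)"
      by (auto simp: mderiv_nmonom)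
  qed
  also have "\<dots> = c \<kappa>" by (subst sum.delta[OF finite_mabs_eq]) (simp add: assms(4))
  finally show ?thesis by simp
qed

text \<open>The partial derivatives of the remainder of g are the remainders, of one order less, of
  the partial derivatives of g; the mean value bound integrates them and gains the factor
  \<open>norm h\<close>.\<close>

lemma taylor_peano:
  fixes g :: "real^'d::{finite,linorder} \<Rightarrow> complex"
  assumes "Cm k g" "0 < \<epsilon>"
  shows "\<exists>\<delta>>0. \<forall>h. norm h < \<delta> \<longrightarrow>
    norm (g (x + h) - (\<Sum>\<kappa> | mabs \<kappa> \<le> k. nmonom \<kappa> h * mderiv \<kappa> g x)) \<le> \<epsilon> * norm h ^ k"
  using assms
proof (induction k arbitrary: g \<epsilon>)
  case 0
  then have "isCont g x" by (simp add: continuous_on_eq_continuous_at)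
  then obtain d where d: "d > 0" "\<And>y. norm (y - x) < d \<Longrightarrow> norm (g y - g x) < \<epsilon>"
    unfolding isCont_def LIM_eq using 0 by (metis diff_self norm_zero)
  have "{\<kappa> :: nat^'d::{finite,linorder}. mabs \<kappa> \<le> 0} = {0}" by (auto simp: mabs_eq_0_iff)
  then show ?case using d(1) d(2)[of "x + h" for h] by (auto intro!: exI[of _ d] less_imp_le)
next
  case (Suc k)
  define R where "R h = g (x + h) - (\<Sum>\<kappa> | mabs \<kappa> \<le> Suc k. nmonom \<kappa> h * mderiv \<kappa> g x)" for h
  define R' where "R' i h = partial_deriv i g (x + h)
      - (\<Sum>\<kappa> | mabs \<kappa> \<le> k. nmonom \<kappa> h * mderiv \<kappa> (partial_deriv i g) x)" for i h
  have pdR: "has_pd i R (R' i)" for i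
  proof -
    have "has_pd i (\<lambda>h. g (x + h)) (\<lambda>h. partial_deriv i g (x + h))"
      using has_pd_affine[OF Cm_Suc_has_pd[OF Suc.prems(1)], of i 1 x] by (simp add: add.commute)
    moreover have "has_pd i (\<lambda>h. \<Sum>\<kappa> | mabs \<kappa> \<le> Suc k. nmonom \<kappa> h * mderiv \<kappa> g x)
      (\<lambda>h. \<Sum>\<kappa> | mabs \<kappa> \<le> Suc k. (if \<kappa> $ i = 0 then 0 else nmonom (\<kappa> - axis i 1) h) * mderiv \<kappa> g x)"
      by (intro has_pd_sum has_pd_linear[OF bounded_linear_mult_left] has_pd_nmonom)
    moreover have "(\<Sum>\<kappa> | mabs \<kappa> \<le> Suc k. (if \<kappa> $ i = 0 then 0 else nmonom (\<kappa> - axis i 1) h) * mderiv \<kappa> g x)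
      = (\<Sum>\<kappa> | mabs \<kappa> \<le> k. nmonom \<kappa> h * mderiv \<kappa> (partial_deriv i g) x)" for h
    proof -
      have "(\<Sum>\<kappa> | mabs \<kappa> \<le> Suc k. (if \<kappa> $ i = 0 then 0 else nmonom (\<kappa> - axis i 1) h) * mderiv \<kappa> g x)
        = (\<Sum>\<kappa> | mabs \<kappa> \<le> Suc k \<and> \<kappa> $ i \<noteq> 0. nmonom (\<kappa> - axis i 1) h * mderiv \<kappa> g x)"
        by (rule sum.mono_neutral_cong_right[OF finite_mabs_le]) auto
      also have "\<dots> = (\<Sum>\<kappa> | mabs \<kappa> \<le> k. nmonom \<kappa> h * mderiv \<kappa> (partial_deriv i g) x)"
      proof (rule sum.reindex_bij_witness[of _ "\<lambda>\<kappa>. \<kappa> + axis i 1" "\<lambda>\<kappa>. \<kappa> - axis i 1"])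
        fix \<kappa> :: "nat^'d::{finite,linorder}" assume \<kappa>: "\<kappa> \<in> {\<kappa>. mabs \<kappa> \<le> Suc k \<and> \<kappa> $ i \<noteq> 0}"
        show eq: "\<kappa> - axis i 1 + axis i 1 = \<kappa>" using \<kappa> by (auto simp: vec_eq_iff axis_def)
        have "mabs (\<kappa> - axis i 1) + 1 = mabs \<kappa>"
          using arg_cong[OF eq, of mabs] by simp
        then show le: "\<kappa> - axis i 1 \<in> {\<kappa>. mabs \<kappa> \<le> k}" using \<kappa> by simp
        have "mderiv (\<kappa> - axis i 1 + axis i 1) g = mderiv (\<kappa> - axis i 1) (partial_deriv i g)"
          by (rule mderiv_add_axis[OF Cm_mono[OF Suc.prems(1)]]) (use le in simp)
        then show "nmonom (\<kappa> - axis i 1) h * mderiv (\<kappa> - axis i 1) (partial_deriv i g) x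
          = nmonom (\<kappa> - axis i 1) h * mderiv \<kappa> g x" unfolding eq by simp
      qed auto
      finally show ?thesis .
    qed
    ultimately show ?thesis unfolding R_def R'_def using has_pd_diff by simp
  qed
  have R0: "R 0 = 0"
  proof -
    have "(\<Sum>\<kappa> :: nat^'d::{finite,linorder} | mabs \<kappa> \<le> Suc k. nmonom \<kappa> 0 * mderiv \<kappa> g x)
        = (\<Sum>\<kappa> :: nat^'d::{finite,linorder} | mabs \<kappa> \<le> Suc k. if 0 = \<kappa> then g x else 0)"
      by (rule sum.cong) (auto simp: nmonom_at_0)
    also have "\<dots> = g x" by (subst sum.delta'[OF finite_mabs_le]) simp
    finally show ?thesis by (simp add: R_def)
  qed
  \<comment> \<open>Compensates the factor d lost in \<open>coordinate_mvt_bound\<close>.\<close>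
  define e where "e = \<epsilon> / real CARD('d)"
  have e: "e > 0" using Suc.prems(2) by (simp add: e_def)
  have "\<forall>i. \<exists>\<delta>>0. \<forall>h. norm h < \<delta> \<longrightarrow> norm (R' i h) \<le> e * norm h ^ k"
    unfolding R'_def using Suc.IH[OF Cm_Suc_pd[OF Suc.prems(1)] e] by blast
  then obtain D where D: "\<And>i. D i > 0" "\<And>i h. norm h < D i \<Longrightarrow> norm (R' i h) \<le> e * norm h ^ k"
    by metis
  define \<delta> where "\<delta> = Min (range D)"
  have \<delta>: "\<delta> > 0" "\<And>i. \<delta> \<le> D i" using D(1) by (auto simp: \<delta>_def)
  have "norm (R h) \<le> \<epsilon> * norm h ^ Suc k" if h: "norm h < \<delta>" for h
  proof -
    have "norm (R h - R 0) \<le> real CARD('d) * (norm h * (e * norm h ^ k))"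
    proof (rule coordinate_mvt_bound[OF pdR])
      fix i and h' :: "real^'d::{finite,linorder}" assume h': "norm h' \<le> norm h"
      then have "norm (R' i h') \<le> e * norm h' ^ k" using h \<delta>(2)[of i] by (intro D(2)) simp
      also have "\<dots> \<le> e * norm h ^ k" using h' e by (intro mult_left_mono power_mono) auto
      finally show "norm (R' i h') \<le> e * norm h ^ k" .
    qed
    then show ?thesis by (simp add: R0 e_def algebra_simps)
  qed
  with \<delta>(1) show ?case unfolding R_def by blast
qed

text \<open>The factor t^|\<nu>| makes the first term the derivative in z of F(x + t z), to be
  compared with the derivative in z of its Taylor polynomial. It also supplies the missing powers of
  t: the error is o(t^m) and not merely o(t^(m - |\<nu>|)).\<close>

lemma taylor_mderiv_limit:
  fixes F :: "real^'d::{finite,linorder} \<Rightarrow> complex"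
  assumes "Cm m F" "mabs \<nu> \<le> m" and t: "\<And>n. 0 < t n" "t \<longlonglongrightarrow> 0"
  shows "(\<lambda>n. (of_real (t n) ^ mabs \<nu> * mderiv \<nu> F (x + t n *\<^sub>R z)
      - (\<Sum>\<mu> | mabs \<mu> \<le> m. of_real (t n) ^ mabs \<mu> * mderiv \<mu> F x * mderiv \<nu> (nmonom \<mu>) z))
      / of_real (t n) ^ m) \<longlonglongrightarrow> 0"
proof -
  define k where "k = m - mabs \<nu>"
  have km: "k + mabs \<nu> = m" using assms(2) by (simp add: k_def)
  have C: "Cm k (mderiv \<nu> F)" by (rule Cm_mderiv'[OF assms(1)]) (use km in simp)
  define P where "P h = (\<Sum>\<kappa> | mabs \<kappa> \<le> k. nmonom \<kappa> h * mderiv \<kappa> (mderiv \<nu> F) x)" for h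
  have sum_eq: "(\<Sum>\<mu> | mabs \<mu> \<le> m. of_real s ^ mabs \<mu> * mderiv \<mu> F x * mderiv \<nu> (nmonom \<mu>) z)
      = of_real s ^ mabs \<nu> * P (s *\<^sub>R z)" for s
  proof -
    have "(\<Sum>\<mu> | mabs \<mu> \<le> m. of_real s ^ mabs \<mu> * mderiv \<mu> F x * mderiv \<nu> (nmonom \<mu>) z)
      = (\<Sum>\<mu> | mabs \<mu> \<le> m \<and> \<nu> \<le> \<mu>. of_real s ^ mabs \<mu> * mderiv \<mu> F x * nmonom (\<mu> - \<nu>) z)"
      by (rule sum.mono_neutral_cong_right[OF finite_mabs_le]) (auto simp: mderiv_nmonom)
    also have "\<dots> = (\<Sum>\<kappa> | mabs \<kappa> \<le> k. of_real s ^ mabs (\<kappa> + \<nu>) * mderiv (\<kappa> + \<nu>) F x * nmonom \<kappa> z)"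
    proof (rule sum.reindex_bij_witness[of _ "\<lambda>\<kappa>. \<kappa> + \<nu>" "\<lambda>\<mu>. \<mu> - \<nu>"])
      fix \<mu> assume "\<mu> \<in> {\<mu>. mabs \<mu> \<le> m \<and> \<nu> \<le> \<mu>}"
      then show "\<mu> - \<nu> \<in> {\<kappa>. mabs \<kappa> \<le> k}" using mabs_diff[of \<nu> \<mu>] km by simp
    qed (use km in \<open>auto simp: multiindex_diff_add less_eq_vec_def\<close>)
    also have "\<dots> = of_real s ^ mabs \<nu> * P (s *\<^sub>R z)"
      unfolding P_def sum_distrib_left
    proof (rule sum.cong[OF refl])
      fix \<kappa> :: "nat^'d::{finite,linorder}" assume "\<kappa> \<in> {\<kappa>. mabs \<kappa> \<le> k}"
      then have "mderiv \<kappa> (mderiv \<nu> F) = mderiv (\<kappa> + \<nu>) F"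
        using km by (intro mderiv_add_multiindex Cm_mono[OF assms(1)]) auto
      then show "of_real s ^ mabs (\<kappa> + \<nu>) * mderiv (\<kappa> + \<nu>) F x * nmonom \<kappa> z
        = of_real s ^ mabs \<nu> * (nmonom \<kappa> (s *\<^sub>R z) * mderiv \<kappa> (mderiv \<nu> F) x)"
        by (simp add: nmonom_scale power_add)
    qed
    finally show ?thesis .
  qed
  show ?thesis
  proof (rule LIMSEQ_I)
    fix e :: real assume e: "e > 0"
    \<comment> \<open>\<open>norm z + 1\<close> keeps the denominator positive even for z = 0, and
      the 2 makes the final inequality strict.\<close>
    define \<epsilon> where "\<epsilon> = e / (2 * (norm z + 1) ^ k)"
    have pos: "(norm z + 1) ^ k > 0" by (intro zero_less_power) (use norm_ge_zero[of z] in linarith)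
    have \<epsilon>: "\<epsilon> > 0" using e pos by (simp add: \<epsilon>_def)
    obtain \<delta> where \<delta>: "\<delta> > 0" "\<And>h. norm h < \<delta> \<Longrightarrow> norm (mderiv \<nu> F (x + h) - P h) \<le> \<epsilon> * norm h ^ k"
      using taylor_peano[OF C \<epsilon>, of x] unfolding P_def by blast
    have "(\<lambda>n. t n * norm z) \<longlonglongrightarrow> 0 * norm z" by (intro tendsto_intros t)
    then have "\<forall>\<^sub>F n in sequentially. t n * norm z < \<delta>"
      using \<delta>(1) by (intro order_tendstoD(2)) auto
    then obtain N where N: "\<And>n. n \<ge> N \<Longrightarrow> t n * norm z < \<delta>"
      by (auto simp: eventually_sequentially)
    show "\<exists>no. \<forall>n\<ge>no. norm ((of_real (t n) ^ mabs \<nu> * mderiv \<nu> F (x + t n *\<^sub>R z)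
      - (\<Sum>\<mu> | mabs \<mu> \<le> m. of_real (t n) ^ mabs \<mu> * mderiv \<mu> F x * mderiv \<nu> (nmonom \<mu>) z))
      / of_real (t n) ^ m - 0) < e"
    proof (intro exI allI impI)
      fix n assume n: "n \<ge> N"
      define s where "s = t n"
      have s: "s > 0" using t(1) by (simp add: s_def)
      have ns: "norm (s *\<^sub>R z) = s * norm z" using s by simp
      have "norm (mderiv \<nu> F (x + s *\<^sub>R z) - P (s *\<^sub>R z)) \<le> \<epsilon> * norm (s *\<^sub>R z) ^ k"
        by (rule \<delta>(2)) (unfold ns, use N[OF n] in \<open>simp add: s_def\<close>)
      also have "\<dots> = \<epsilon> * s ^ k * norm z ^ k" using s by (simp add: power_mult_distrib)
      also have "\<dots> \<le> \<epsilon> * s ^ k * (norm z + 1) ^ k"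
        using \<epsilon> s by (intro mult_left_mono power_mono) auto
      also have "\<dots> = s ^ k * (e / 2)" proof -
        have "\<epsilon> * (norm z + 1) ^ k = e / 2" using pos unfolding \<epsilon>_def by (metis less_irrefl nonzero_eq_divide_eq divide_divide_eq_left)
        then show ?thesis by (metis mult.commute mult.assoc)
      qed
      also have "\<dots> < s ^ k * e" using s e by simp
      finally have lt: "norm (mderiv \<nu> F (x + s *\<^sub>R z) - P (s *\<^sub>R z)) < s ^ k * e" .
      have "norm ((of_real s ^ mabs \<nu> * mderiv \<nu> F (x + s *\<^sub>R z) - of_real s ^ mabs \<nu> * P (s *\<^sub>R z))
          / of_real s ^ m) = s ^ mabs \<nu> * norm (mderiv \<nu> F (x + s *\<^sub>R z) - P (s *\<^sub>R z)) / s ^ m"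
        using s by (simp add: right_diff_distrib[symmetric] norm_divide norm_mult norm_power)
      also have "\<dots> = norm (mderiv \<nu> F (x + s *\<^sub>R z) - P (s *\<^sub>R z)) / s ^ k"
        using s unfolding km[symmetric] by (simp add: power_add)
      also have "\<dots> < e" using lt s by (simp add: field_simps)
      finally show "norm ((of_real (t n) ^ mabs \<nu> * mderiv \<nu> F (x + t n *\<^sub>R z)
      - (\<Sum>\<mu> | mabs \<mu> \<le> m. of_real (t n) ^ mabs \<mu> * mderiv \<mu> F x * mderiv \<nu> (nmonom \<mu>) z))
      / of_real (t n) ^ m - 0) < e"
        unfolding sum_eq s_def[symmetric] by simp
    qed
  qed
qed

text \<open>Multiplying the quotient by t^m shows that the constant term vanishes; dividing the rest
  by t lowers the degree and the power in the denominator together.\<close>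

lemma polynomial_little_o_zero:
  fixes C :: "nat \<Rightarrow> complex" and t :: "nat \<Rightarrow> real"
  assumes t: "\<And>n. 0 < t n" "t \<longlonglongrightarrow> 0"
    and lim: "(\<lambda>n. (\<Sum>s\<le>m. C s * of_real (t n) ^ s) / of_real (t n) ^ m) \<longlonglongrightarrow> 0"
    and "s \<le> m"
  shows "C s = 0"
  using lim assms(4)
proof (induction m arbitrary: C s)
  case 0
  then show ?case by (simp add: LIMSEQ_const_iff)
next
  case (Suc m)
  have tc: "(\<lambda>n. complex_of_real (t n)) \<longlonglongrightarrow> 0" using tendsto_of_real[OF t(2)] by simp
  have "(\<lambda>n. (\<Sum>s\<le>Suc m. C s * of_real (t n) ^ s) / of_real (t n) ^ Suc m * of_real (t n) ^ Suc m)
      \<longlonglongrightarrow> 0 * 0 ^ Suc m"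
    by (intro tendsto_mult tendsto_power Suc.prems tc)
  moreover have "(\<Sum>s\<le>Suc m. C s * of_real (t n) ^ s) / of_real (t n) ^ Suc m * of_real (t n) ^ Suc m
      = (\<Sum>s\<le>Suc m. C s * of_real (t n) ^ s)" for n
    using t(1)[of n] by simp
  ultimately have "(\<lambda>n. \<Sum>s\<le>Suc m. C s * of_real (t n) ^ s) \<longlonglongrightarrow> 0" by simp
  moreover have "(\<lambda>n. \<Sum>s\<le>Suc m. C s * of_real (t n) ^ s) \<longlonglongrightarrow> (\<Sum>s\<le>Suc m. C s * 0 ^ s)"
    by (intro tendsto_sum tendsto_mult tendsto_power tendsto_const tc)
  moreover have "(\<Sum>s\<le>Suc m. C s * 0 ^ s) = C 0"
    by (simp add: sum.atMost_shift)
  ultimately have C0: "C 0 = 0" using LIMSEQ_unique by metis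
  have "(\<Sum>s\<le>Suc m. C s * of_real (t n) ^ s) / of_real (t n) ^ Suc m
      = (\<Sum>s\<le>m. C (Suc s) * of_real (t n) ^ s) / of_real (t n) ^ m" for n
  proof -
    have "(\<Sum>s\<le>Suc m. C s * of_real (t n) ^ s) = of_real (t n) * (\<Sum>s\<le>m. C (Suc s) * of_real (t n) ^ s)"
      by (simp only: sum.atMost_Suc_shift C0 sum_distrib_left) (simp add: mult_ac)
    then show ?thesis using t(1)[of n] by simp
  qed
  then have "(\<lambda>n. (\<Sum>s\<le>m. C (Suc s) * of_real (t n) ^ s) / of_real (t n) ^ m) \<longlonglongrightarrow> 0"
    using Suc.prems(1) by simp
  from Suc.IH[OF this] have "C (Suc s) = 0" if "s \<le> m" for s using that by blast
  with C0 Suc.prems(2) show ?case by (cases s) auto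
qed

section \<open>Lattice sums\<close>

lemma infsum_finite_support:
  assumes "finite F" "\<And>k. k \<notin> F \<Longrightarrow> f k = 0"
  shows "infsum f UNIV = sum f F"
proof -
  have "infsum f UNIV = infsum f F" by (rule infsum_cong_neutral) (use assms in auto)
  then show ?thesis using assms(1) by simp
qed

lemma rvec_0 [simp]: "rvec 0 = 0"
  and rvec_add: "rvec (k + j) = rvec k + rvec j"
  and rvec_diff: "rvec (k - j) = rvec k - rvec j"
  and rvec_minus: "rvec (- k) = - rvec k"
  and rvec_scale: "rvec (c *s k) = real_of_int c *\<^sub>R rvec k"
  by (simp_all add: rvec_def vec_eq_iff)

lemma rvec_nth [simp]: "rvec k $ i = real_of_int (k $ i)"
  by (simp add: rvec_def)

lemma rvec_ivec: "(\<And>i. x $ i \<in> \<int>) \<Longrightarrow> rvec (ivec x) = x"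
  by (auto simp: vec_eq_iff ivec_def elim!: Ints_cases)

lemma finite_int_box: "finite {k :: int^'d. \<forall>i. \<bar>real_of_int (k $ i)\<bar> \<le> B}"
proof -
  have "\<bar>real_of_int z\<bar> \<le> B \<longleftrightarrow> z \<in> {\<lceil>- B\<rceil>..\<lfloor>B\<rfloor>}" for z
    by (auto simp: abs_le_iff le_floor_iff ceiling_le_iff)
  then show ?thesis using finite_vec_set[of "\<lambda>i::'d. {\<lceil>- B\<rceil>..\<lfloor>B\<rfloor>}"] by simp
qed

lemma finite_lattice_ball: "finite {k :: int^'d. norm (rvec k) \<le> B}"
  by (rule finite_subset[OF _ finite_int_box[of B]])
     (auto intro: order_trans[OF component_le_norm_cart[of "rvec k" for k, unfolded rvec_nth]])

text \<open>Compact support with an explicit radius, from which the finite index sets of lattice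
  sums can be read off.\<close>

definition supp_ball :: "real \<Rightarrow> (real^'d \<Rightarrow> 'b::zero) \<Rightarrow> bool" where
  "supp_ball R \<phi> \<longleftrightarrow> (\<forall>x. R < norm x \<longrightarrow> \<phi> x = 0)"

lemma supp_ballD: "supp_ball R \<phi> \<Longrightarrow> R < norm x \<Longrightarrow> \<phi> x = 0"
  by (simp add: supp_ball_def)

text \<open>The semi-discrete convolution of w with \<phi>. The coefficients w may be arbitrary, for
  instance growing polynomially; a compactly supported \<phi> leaves finitely many terms at each
  point.\<close>

definition shift_sum ::
  "(real^'d \<Rightarrow> complex^'r) \<Rightarrow> (int^'d \<Rightarrow> complex^'r^1) \<Rightarrow> real^'d \<Rightarrow> complex" where
  "shift_sum \<phi> w x = (\<Sum>\<^sub>\<infinity>k. (w k *v \<phi> (x - rvec k)) $ 1)"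

lemma row_mult: "((w :: complex^'r^1) *v v) $ 1 = (\<Sum>l\<in>UNIV. w $ 1 $ l * v $ l)"
  by (simp add: matrix_vector_mult_def)

text \<open>Any finite set containing the active shifts will do, so a common F can serve several
  points or several coefficient sequences.\<close>

lemma shift_sum_finite:
  assumes "supp_ball R \<phi>" "finite F" "\<And>k. norm (rvec k) \<le> norm x + R \<Longrightarrow> k \<in> F"
  shows "shift_sum \<phi> w x = (\<Sum>k\<in>F. (w k *v \<phi> (x - rvec k)) $ 1)"
  unfolding shift_sum_def
proof (rule infsum_finite_support[OF assms(2)])
  fix k assume "k \<notin> F"
  then have "norm (rvec k) > norm x + R" using assms(3) not_less by blast
  then have "norm (x - rvec k) > R"
    using norm_triangle_ineq3[of x "rvec k"] by linarith
  then show "(w k *v \<phi> (x - rvec k)) $ 1 = 0" using supp_ballD[OF assms(1)] by (simp add: row_mult)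
qed

lemma shift_sum_translate: "shift_sum \<phi> w (rvec j + y) = shift_sum \<phi> (\<lambda>k. w (k + j)) y"
proof -
  have "bij_betw (\<lambda>k. k + j) UNIV (UNIV :: (int^'a) set)"
    by (rule bij_betwI[where g = "\<lambda>k. k - j"]) auto
  from infsum_reindex_bij_betw[OF this, of "\<lambda>k. (w k *v \<phi> (rvec j + y - rvec k)) $ 1"]
  show ?thesis unfolding shift_sum_def by (simp add: rvec_add algebra_simps)
qed

lemma supp_ball_mderiv:
  assumes "supp_ball R \<phi>"
  shows "supp_ball R (mderiv \<nu> \<phi>)"
  unfolding supp_ball_def
proof (intro allI impI)
  fix x :: "real^'a::{finite,linorder}" assume "R < norm x"
  then have "mderiv \<nu> \<phi> x = mderiv \<nu> (\<lambda>x. 0) x"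
    by (intro mderiv_local[of "{x. R < norm x}"])
       (auto intro: open_Collect_less continuous_intros supp_ballD[OF assms])
  then show "mderiv \<nu> \<phi> x = 0" by simp
qed

text \<open>One index set for a whole open ball, which is what differentiating the sum term by term
  requires.\<close>

lemma shift_sum_local:
  assumes "supp_ball R \<phi>" "norm y < B"
  shows "shift_sum \<phi> w y = (\<Sum>k | norm (rvec k) \<le> B + R. (w k *v \<phi> (y - rvec k)) $ 1)"
  using assms by (intro shift_sum_finite[OF assms(1)] finite_lattice_ball) auto

lemma bounded_linear_row: "bounded_linear (\<lambda>v. ((w :: complex^'r^1) *v v) $ 1)"
  unfolding row_mult
  by (intro bounded_linear_sum bounded_linear_compose[OF bounded_linear_mult_right bounded_linear_vec_nth])

lemma Cm_shift_sum_term: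
  "Cm m \<phi> \<Longrightarrow> Cm m (\<lambda>y. ((w :: complex^'r^1) *v \<phi> (y - b)) $ 1)"
  using Cm_linear[OF bounded_linear_row Cm_affine[of m \<phi> 1 "- b"]] by simp

lemma Cm_shift_sum:
  fixes \<phi> :: "real^'a \<Rightarrow> complex^'r"
  assumes "Cm m \<phi>" "supp_ball R \<phi>"
  shows "Cm m (shift_sum \<phi> w)"
proof (rule Cm_local)
  fix x :: "real^'a"
  show "\<exists>U g. open U \<and> x \<in> U \<and> (\<forall>y\<in>U. shift_sum \<phi> w y = g y) \<and> Cm m g"
  proof (intro exI conjI ballI)
    show "open {y :: real^'a. norm y < norm x + 1}" by (intro open_Collect_less continuous_intros)
    show "shift_sum \<phi> w y = (\<Sum>k | norm (rvec k) \<le> norm x + 1 + R. (w k *v \<phi> (y - rvec k)) $ 1)"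
      if "y \<in> {y. norm y < norm x + 1}" for y
      using that by (intro shift_sum_local[OF assms(2)]) auto
    show "Cm m (\<lambda>y. \<Sum>k | norm (rvec k) \<le> norm x + 1 + R. (w k *v \<phi> (y - rvec k)) $ 1)"
      by (intro Cm_sum Cm_shift_sum_term assms)
  qed auto
qed

lemma mderiv_shift_sum:
  assumes "Cm (mabs \<nu>) \<phi>" "supp_ball R \<phi>"
  shows "mderiv \<nu> (shift_sum \<phi> w) x = shift_sum (mderiv \<nu> \<phi>) w x"
proof -
  let ?F = "{k. norm (rvec k) \<le> norm x + 1 + R}"
  have "mderiv \<nu> (shift_sum \<phi> w) x = mderiv \<nu> (\<lambda>y. \<Sum>k\<in>?F. (w k *v \<phi> (y - rvec k)) $ 1) x"
  proof (rule mderiv_local)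
    show "open {y :: real^'a::{finite,linorder}. norm y < norm x + 1}" by (intro open_Collect_less continuous_intros)
    show "shift_sum \<phi> w y = (\<Sum>k\<in>?F. (w k *v \<phi> (y - rvec k)) $ 1)"
      if "y \<in> {y. norm y < norm x + 1}" for y
      using that by (intro shift_sum_local[OF assms(2)]) auto
  qed auto
  also have "\<dots> = (\<Sum>k\<in>?F. mderiv \<nu> (\<lambda>y. (w k *v \<phi> (y - rvec k)) $ 1) x)"
    by (simp add: mderiv_sum[OF Cm_shift_sum_term[OF assms(1)]])
  also have "\<dots> = (\<Sum>k\<in>?F. (w k *v mderiv \<nu> \<phi> (x - rvec k)) $ 1)"
  proof (rule sum.cong[OF refl])
    fix k
    have "Cm (mabs \<nu>) (\<lambda>y. \<phi> (y - rvec k))" using Cm_affine[OF assms(1), of 1 "- rvec k"] by simp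
    then have "mderiv \<nu> (\<lambda>y. (w k *v \<phi> (y - rvec k)) $ 1) x
        = (w k *v mderiv \<nu> (\<lambda>y. \<phi> (y - rvec k)) x) $ 1"
      by (simp add: mderiv_linear[OF bounded_linear_row])
    then show "mderiv \<nu> (\<lambda>y. (w k *v \<phi> (y - rvec k)) $ 1) x = (w k *v mderiv \<nu> \<phi> (x - rvec k)) $ 1"
      using mderiv_translate[OF assms(1), of "- rvec k"] by simp
  qed
  also have "\<dots> = shift_sum (mderiv \<nu> \<phi>) w x"
    by (rule shift_sum_local[symmetric, of R]) (auto intro: supp_ball_mderiv assms(2))
  finally show ?thesis .
qed

text \<open>At k + \<tau> l only the shift by k contributes, and only in its entry l. All later
  identifications of coefficients with derivatives rest on this.\<close>

lemma shift_sum_hermite: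
  assumes "hermite_interpolant \<nu> \<tau> \<phi>"
  shows "shift_sum (mderiv (\<nu> l) \<phi>) w (rvec k + \<tau> l) = w k $ 1 $ l"
proof -
  have *: "mderiv (\<nu> l) \<phi> (rvec k + \<tau> l - rvec j) = delta (k - j) *s axis l 1" for j
    using assms[unfolded hermite_interpolant_def, rule_format, of l "k - j"]
    by (simp add: rvec_diff algebra_simps)
  have "shift_sum (mderiv (\<nu> l) \<phi>) w (rvec k + \<tau> l)
      = (\<Sum>j\<in>{k}. (w j *v mderiv (\<nu> l) \<phi> (rvec k + \<tau> l - rvec j)) $ 1)"
    unfolding shift_sum_def by (rule infsum_finite_support) (auto simp: * delta_def)
  also have "\<dots> = w k $ 1 $ l"
    unfolding * by (simp add: delta_def row_mult axis_def if_distrib[of "(*) x" for x] cong: if_cong)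
  finally show ?thesis .
qed

section \<open>The subdivision operator\<close>

lemma finite_mask_preimage:
  assumes "fin_supp a"
  shows "finite {k. a (j - 2 *s k) \<noteq> 0}"
proof -
  have "inj (\<lambda>k. j - 2 *s k)" by (auto simp: inj_def vec_eq_iff)
  from finite_vimageI[OF assms[unfolded fin_supp_def] this]
  show ?thesis by (simp add: vimage_def)
qed

lemma subdiv_finite:
  assumes "finite F" "\<And>k. a (j - 2 *s k) \<noteq> 0 \<Longrightarrow> k \<in> F"
  shows "subdiv a v j = 2 ^ CARD('d) *\<^sub>R (\<Sum>k\<in>F. v k ** a (j - 2 *s (k :: int^'d)))"
proof -
  have "v k ** a (j - 2 *s k) = 0" if "k \<notin> F" for k
  proof -
    have "a (j - 2 *s k) = 0" using assms(2) that by blast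
    then show ?thesis by (simp add: matrix_matrix_mult_def vec_eq_iff)
  qed
  then have "(\<Sum>\<^sub>\<infinity>k. v k ** a (j - 2 *s k)) = (\<Sum>k\<in>F. v k ** a (j - 2 *s k))"
    by (intro infsum_finite_support assms(1))
  then show ?thesis unfolding subdiv_def by simp
qed

lemma subdiv_nth:
  assumes "finite F" "\<And>k. a (j - 2 *s k) \<noteq> 0 \<Longrightarrow> k \<in> F"
  shows "subdiv a v j $ i $ l = 2 ^ CARD('d) * (\<Sum>k\<in>F. \<Sum>q\<in>UNIV. v k $ i $ q * a (j - 2 *s (k :: int^'d)) $ q $ l)"
  by (simp add: subdiv_finite[OF assms] matrix_matrix_mult_def) (simp add: scaleR_conv_of_real)

text \<open>Substituting the refinement equation for each shift and collecting the terms \<phi>(2x -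
  j) produces the coefficient \<open>subdiv a w j\<close>.\<close>

lemma shift_sum_refine:
  fixes a :: "int^'d \<Rightarrow> complex^'r^'r"
  assumes ref: "refinable a \<phi>" and a: "fin_supp a" and van: "supp_ball R \<phi>"
  shows "shift_sum \<phi> w x = shift_sum \<phi> (subdiv a w) (2 *\<^sub>R x)"
proof -
  define J where "J = {j :: int^'d. norm (rvec j) \<le> norm (2 *\<^sub>R x) + R}"
  \<comment> \<open>K contains the shifts active at x and every k that feeds some j in J through the
    mask, so the same finite set serves for \<open>shift_sum\<close> and for all
    \<open>subdiv a w j\<close>.\<close>
  define K where "K = {k :: int^'d. norm (rvec k) \<le> norm x + R} \<union> (\<Union>j\<in>J. {k. a (j - 2 *s k) \<noteq> 0})"
  have fJ: "finite J" unfolding J_def by (rule finite_lattice_ball)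
  have fK: "finite K" unfolding K_def using fJ finite_lattice_ball finite_mask_preimage[OF a] by auto
  have ph: "\<phi> (x - rvec k) $ q = 2 ^ CARD('d) *
      (\<Sum>j\<in>J. \<Sum>l\<in>UNIV. a (j - 2 *s k) $ q $ l * \<phi> (2 *\<^sub>R x - rvec j) $ l)" for k q
  proof -
    have bij: "bij_betw (\<lambda>j. j - 2 *s k) UNIV (UNIV :: (int^'d) set)"
      by (rule bij_betwI[where g = "\<lambda>j. j + 2 *s k"]) auto
    have "\<phi> (x - rvec k) = 2 ^ CARD('d) *\<^sub>R (\<Sum>\<^sub>\<infinity>j. a j *v \<phi> (2 *\<^sub>R (x - rvec k) - rvec j))"
      using ref unfolding refinable_def by blast
    also have "(\<Sum>\<^sub>\<infinity>j. a j *v \<phi> (2 *\<^sub>R (x - rvec k) - rvec j))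
        = (\<Sum>\<^sub>\<infinity>j. a (j - 2 *s k) *v \<phi> (2 *\<^sub>R x - rvec j))"
      using infsum_reindex_bij_betw[OF bij, of "\<lambda>j. a j *v \<phi> (2 *\<^sub>R (x - rvec k) - rvec j)"]
      by (simp add: rvec_diff rvec_scale algebra_simps)
    also have "\<dots> = (\<Sum>j\<in>J. a (j - 2 *s k) *v \<phi> (2 *\<^sub>R x - rvec j))"
    proof (rule infsum_finite_support[OF fJ])
      fix j assume "j \<notin> J"
      then have "norm (2 *\<^sub>R x - rvec j) > R"
        using norm_triangle_ineq3[of "2 *\<^sub>R x" "rvec j"] by (simp add: J_def)
      then show "a (j - 2 *s k) *v \<phi> (2 *\<^sub>R x - rvec j) = 0" using supp_ballD[OF van] by simp
    qed
    finally show ?thesis by (simp add: matrix_vector_mult_def) (simp add: scaleR_conv_of_real)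
  qed
  have "shift_sum \<phi> w x = (\<Sum>k\<in>K. (w k *v \<phi> (x - rvec k)) $ 1)"
    using fK by (intro shift_sum_finite[OF van]) (auto simp: K_def)
  also have "\<dots> = (\<Sum>k\<in>K. \<Sum>q\<in>UNIV. \<Sum>j\<in>J. \<Sum>l\<in>UNIV.
      2 ^ CARD('d) * (w k $ 1 $ q * a (j - 2 *s k) $ q $ l) * \<phi> (2 *\<^sub>R x - rvec j) $ l)"
    unfolding row_mult ph by (simp add: sum_distrib_left mult_ac)
  also have "\<dots> = (\<Sum>k\<in>K. \<Sum>j\<in>J. \<Sum>l\<in>UNIV. \<Sum>q\<in>UNIV.
      2 ^ CARD('d) * (w k $ 1 $ q * a (j - 2 *s k) $ q $ l) * \<phi> (2 *\<^sub>R x - rvec j) $ l)"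
    by (rule sum.cong[OF refl], rule trans[OF sum.swap], rule sum.cong[OF refl], rule sum.swap)
  also have "\<dots> = (\<Sum>j\<in>J. \<Sum>k\<in>K. \<Sum>l\<in>UNIV. \<Sum>q\<in>UNIV.
      2 ^ CARD('d) * (w k $ 1 $ q * a (j - 2 *s k) $ q $ l) * \<phi> (2 *\<^sub>R x - rvec j) $ l)"
    by (rule sum.swap)
  also have "\<dots> = (\<Sum>j\<in>J. \<Sum>l\<in>UNIV. \<Sum>k\<in>K. \<Sum>q\<in>UNIV.
      2 ^ CARD('d) * (w k $ 1 $ q * a (j - 2 *s k) $ q $ l) * \<phi> (2 *\<^sub>R x - rvec j) $ l)"
    by (intro sum.cong refl sum.swap)
  also have "\<dots> = (\<Sum>j\<in>J. \<Sum>l\<in>UNIV. subdiv a w j $ 1 $ l * \<phi> (2 *\<^sub>R x - rvec j) $ l)"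
  proof (intro sum.cong refl)
    fix j and l :: 'r assume "j \<in> J"
    then have "subdiv a w j $ 1 $ l = 2 ^ CARD('d) * (\<Sum>k\<in>K. \<Sum>q\<in>UNIV. w k $ 1 $ q * a (j - 2 *s k) $ q $ l)"
      by (intro subdiv_nth fK) (auto simp: K_def)
    then show "(\<Sum>k\<in>K. \<Sum>q\<in>UNIV. 2 ^ CARD('d) * (w k $ 1 $ q * a (j - 2 *s k) $ q $ l) * \<phi> (2 *\<^sub>R x - rvec j) $ l)
        = subdiv a w j $ 1 $ l * \<phi> (2 *\<^sub>R x - rvec j) $ l"
      by (simp add: sum_distrib_left sum_distrib_right mult_ac)
  qed
  also have "\<dots> = shift_sum \<phi> (subdiv a w) (2 *\<^sub>R x)"
    unfolding row_mult[symmetric] by (rule shift_sum_finite[OF van fJ, symmetric]) (auto simp: J_def)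
  finally show ?thesis .
qed

lemma shift_sum_refine_pow:
  assumes "refinable a \<phi>" "fin_supp a" "supp_ball R \<phi>"
  shows "shift_sum \<phi> w x = shift_sum \<phi> ((subdiv a ^^ n) w) (2 ^ n *\<^sub>R x)"
proof (induction n)
  case (Suc n)
  then show ?case using shift_sum_refine[OF assms, of "(subdiv a ^^ n) w" "2 ^ n *\<^sub>R x"] by simp
qed simp

text \<open>After n refinements the point 2^-n (k + \<tau> l) becomes the interpolation node k +
  \<tau> l, and the chain rule contributes 2^(n |\<nu> l|). That is the factor in
  \<open>D_inv_pow\<close>, so the right side is the refinement datum.\<close>

lemma mderiv_shift_sum_refine:
  assumes ref: "refinable a \<phi>" "fin_supp a" "supp_ball R \<phi>"
    and h: "hermite_interpolant \<nu> \<tau> \<phi>" and C: "Cm (mabs (\<nu> l)) \<phi>"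
  shows "mderiv (\<nu> l) (shift_sum \<phi> w) ((1 / 2 ^ n) *\<^sub>R (rvec k + \<tau> l))
    = 2 ^ (n * mabs (\<nu> l)) * (subdiv a ^^ n) w k $ 1 $ l"
proof -
  have "shift_sum \<phi> w = (\<lambda>x. shift_sum \<phi> ((subdiv a ^^ n) w) (2 ^ n *\<^sub>R x + 0))"
    using shift_sum_refine_pow[OF ref] by auto
  then have "mderiv (\<nu> l) (shift_sum \<phi> w)
    = (\<lambda>x. (2 ^ n) ^ mabs (\<nu> l) *\<^sub>R mderiv (\<nu> l) (shift_sum \<phi> ((subdiv a ^^ n) w)) (2 ^ n *\<^sub>R x + 0))"
    using mderiv_affine[OF Cm_shift_sum[OF C ref(3)]] by metis
  then have "mderiv (\<nu> l) (shift_sum \<phi> w) ((1 / 2 ^ n) *\<^sub>R (rvec k + \<tau> l))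
    = (2 ^ n) ^ mabs (\<nu> l) *\<^sub>R mderiv (\<nu> l) (shift_sum \<phi> ((subdiv a ^^ n) w)) (rvec k + \<tau> l)"
    by simp
  also have "mderiv (\<nu> l) (shift_sum \<phi> ((subdiv a ^^ n) w)) (rvec k + \<tau> l) = (subdiv a ^^ n) w k $ 1 $ l"
    using mderiv_shift_sum[OF C ref(3)] shift_sum_hermite[OF h] by simp
  finally show ?thesis by (simp add: scaleR_conv_of_real power_mult)
qed

lemma D_inv_pow_mult: "(w ** D_inv_pow \<nu> n) $ i $ l = w $ i $ l * 2 ^ (n * mabs (\<nu> l))"
proof -
  have "((2::complex) powi (- int k)) powi (- int n) = 2 ^ (n * k)" for k
    by (simp add: power_int_def power_mult[symmetric] mult.commute inverse_eq_divide power_divide)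
  then show ?thesis
    by (simp add: matrix_matrix_mult_def D_inv_pow_def if_distrib[of "(*) x" for x] cong: if_cong)
qed

lemma refinement_data_nth:
  "refinement_data a \<nu> w0 n k $ 1 $ l = (subdiv a ^^ n) w0 k $ 1 $ l * 2 ^ (n * mabs (\<nu> l))"
  by (simp add: refinement_data_def D_inv_pow_mult)

section \<open>From the interpolant to the scheme\<close>

text \<open>The initial datum whose limit function is the entry q of the basis vector
  function.\<close>

definition row_delta :: "'r \<Rightarrow> int^'d \<Rightarrow> complex^'r^1" where
  "row_delta q k = (\<chi> _ l. if k = 0 \<and> l = q then 1 else 0)"

lemma row_delta_nth [simp]: "row_delta q k $ i $ l = (if k = 0 \<and> l = q then 1 else 0)"
  by (simp add: row_delta_def)

lemma shift_sum_row_delta: "shift_sum \<phi> (row_delta q) x = \<phi> x $ q"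
proof -
  have "shift_sum \<phi> (row_delta q) x = (\<Sum>k\<in>{0}. (row_delta q k *v \<phi> (x - rvec k)) $ 1)"
    unfolding shift_sum_def by (rule infsum_finite_support) (auto simp: row_mult)
  then show ?thesis by (simp add: row_mult if_distrib[of "\<lambda>y. y * z" for z] cong: if_cong)
qed

lemma subdiv_row_delta:
  assumes "fin_supp a"
  shows "subdiv a (row_delta q) j $ 1 $ l = 2 ^ CARD('d) * a (j :: int^'d) $ q $ l"
proof -
  define F where "F = insert 0 {k. a (j - 2 *s k) \<noteq> 0}"
  have fF: "finite F" using finite_mask_preimage[OF assms] by (simp add: F_def)
  have "subdiv a (row_delta q) j $ 1 $ l
      = 2 ^ CARD('d) * (\<Sum>k\<in>F. \<Sum>p\<in>UNIV. row_delta q k $ 1 $ p * a (j - 2 *s k) $ p $ l)"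
    by (rule subdiv_nth[OF fF]) (simp add: F_def)
  also have "(\<Sum>k\<in>F. \<Sum>p\<in>UNIV. row_delta q k $ 1 $ p * a (j - 2 *s k) $ p $ l)
      = (\<Sum>k\<in>F. if k = 0 then a j $ q $ l else 0)"
    by (rule sum.cong) (auto simp: if_distrib[of "\<lambda>y. y * z" for z] cong: if_cong)
  also have "\<dots> = a j $ q $ l" using fF by (simp add: F_def)
  finally show ?thesis .
qed

lemma axis_nth_if: "axis i x $ j = (if j = i then x else 0)"
  by (simp add: axis_def)

lemma matrix_vector_mult_axis: "((A :: complex^'n^'m) *v axis j 1) $ q = A $ q $ j"
  by (simp add: matrix_vector_mult_def axis_def if_distrib[of "(*) x" for x] cong: if_cong)

text \<open>Testing the one-step identity on \<open>row_delta q\<close> reads off the entries in row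
  q of the mask, up to the factor 2^d from \<open>subdiv\<close>.\<close>

lemma interpolatory_maskI:
  fixes a :: "int^'d \<Rightarrow> complex^'r^'r"
  assumes a: "fin_supp a"
    and step: "\<And>(w :: int^'d \<Rightarrow> complex^'r^1) k l. 2 ^ mabs (\<nu> l) * subdiv a w (2 *s k + ivec (2 *\<^sub>R \<tau> l - \<tau> (\<theta> l))) $ 1 $ \<theta> l = w k $ 1 $ l"
  shows "interpolatory_mask \<nu> \<tau> \<theta> a"
  unfolding interpolatory_mask_def
proof (intro allI)
  fix k l
  let ?j = "2 *s k + ivec (2 *\<^sub>R \<tau> l - \<tau> (\<theta> l))"
  have p: "(2::complex) powi (- int CARD('d) - int (mabs (\<nu> l))) = 1 / (2 ^ CARD('d) * 2 ^ mabs (\<nu> l))"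
    by (simp add: power_int_diff power_int_minus divide_simps)
  have "a ?j $ q $ \<theta> l = (if k = 0 \<and> l = q then 1 / (2 ^ CARD('d) * 2 ^ mabs (\<nu> l)) else 0)" for q
    using step[of l "row_delta q" k] unfolding subdiv_row_delta[OF a]
    by (auto simp: field_simps)
  then show "a ?j *v axis (\<theta> l) 1
      = (2 powi (- int CARD('d) - int (mabs (\<nu> l))) * delta k) *s axis l 1"
    unfolding p
    by (intro vec_eq_iff[THEN iffD2] allI)
       (simp add: matrix_vector_mult_axis delta_def axis_nth_if)
qed

text \<open>The mask multiplies from the right, so the rows of the data evolve independently. This
  connects the matrix iteration in the definition of the basis vector function with row
  data.\<close>

lemma subdiv_pow_row:
  fixes v :: "int^'d \<Rightarrow> complex^'r^'s" and w :: "int^'d \<Rightarrow> complex^'r^'t"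
  assumes a: "fin_supp a" and eq: "\<And>k. w k $ i' = v k $ i"
  shows "(subdiv a ^^ n) w k $ i' = (subdiv a ^^ n) v k $ i"
proof (induction n arbitrary: k)
  case (Suc n)
  have "finite {j. a (k - 2 *s j) \<noteq> 0}" by (rule finite_mask_preimage[OF a])
  then have "subdiv a ((subdiv a ^^ n) w) k $ i' $ l = subdiv a ((subdiv a ^^ n) v) k $ i $ l" for l
    by (subst (1 2) subdiv_nth) (auto simp: Suc.IH)
  then show ?case by (simp add: vec_eq_iff)
qed (simp add: eq)

text \<open>The common hub of both implications. The radius R stands for compactness of the support;
  \<theta> is an additional argument of the interpolatory statements below.\<close>

locale hermite_system =
  fixes m :: nat
    and \<nu> :: "'r::{finite,linorder} \<Rightarrow> nat^'d::{finite,linorder}"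
    and \<tau> :: "'r::{finite,linorder} \<Rightarrow> real^'d::{finite,linorder}"
    and a :: "int^'d::{finite,linorder} \<Rightarrow> complex^'r::{finite,linorder}^'r::{finite,linorder}"
    and \<phi> :: "real^'d::{finite,linorder} \<Rightarrow> complex^'r::{finite,linorder}"
    and R :: real
  assumes \<nu>_le: "mabs (\<nu> l) \<le> m"
    and mask: "fin_supp a"
    and Cm_\<phi>: "Cm m \<phi>"
    and supp: "supp_ball R \<phi>"
    and refine: "refinable a \<phi>"
    and hermite: "hermite_interpolant \<nu> \<tau> \<phi>"
begin

lemma Cm_\<nu>: "Cm (mabs (\<nu> l)) \<phi>"
  using Cm_mono[OF Cm_\<phi> \<nu>_le] .

lemma mderiv_shift_sum_dyadic:
  "mderiv (\<nu> l) (shift_sum \<phi> w) ((1 / 2 ^ n) *\<^sub>R (rvec k + \<tau> l))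
    = 2 ^ (n * mabs (\<nu> l)) * (subdiv a ^^ n) w k $ 1 $ l"
  by (rule mderiv_shift_sum_refine[OF refine mask supp hermite Cm_\<nu>])

lemma refinement_data_eq:
  "refinement_data a \<nu> w n k $ 1 $ l
    = mderiv (\<nu> l) (shift_sum \<phi> w) ((1 / 2 ^ n) *\<^sub>R (rvec k + \<tau> l))"
  by (simp add: refinement_data_nth mderiv_shift_sum_dyadic)

text \<open>Both sides are the value of one derivative at one point: with j = 2k + 2 \<tau> l -
  \<tau> (\<theta> l), the node (j + \<tau> (\<theta> l)) / 2 of level 1 coincides with the node k +
  \<tau> l of level 0.\<close>

lemma subdiv_step:
  fixes w :: "int^'d::{finite,linorder} \<Rightarrow> complex^'r::{finite,linorder}^1"
  assumes "\<nu> (\<theta> l) = \<nu> l" "\<And>i. (2 *\<^sub>R \<tau> l - \<tau> (\<theta> l)) $ i \<in> \<int>"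
  shows "2 ^ mabs (\<nu> l) * subdiv a w (2 *s k + ivec (2 *\<^sub>R \<tau> l - \<tau> (\<theta> l))) $ 1 $ \<theta> l = w k $ 1 $ l"
proof -
  let ?j = "2 *s k + ivec (2 *\<^sub>R \<tau> l - \<tau> (\<theta> l))"
  have "(1 / 2 ^ 1) *\<^sub>R (rvec ?j + \<tau> (\<theta> l)) = (1 / 2 ^ 0) *\<^sub>R (rvec k + \<tau> l)"
    by (simp add: rvec_add rvec_scale rvec_ivec[OF assms(2)] algebra_simps)
  then show ?thesis
    using mderiv_shift_sum_dyadic[of "\<theta> l" w 1 ?j] mderiv_shift_sum_dyadic[of l w 0 k]
    by (simp add: assms(1))
qed

lemma interpolatory:
  assumes \<theta>: "\<And>l. \<nu> (\<theta> l) = \<nu> l" "\<And>l i. (2 *\<^sub>R \<tau> l - \<tau> (\<theta> l)) $ i \<in> \<int>"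
  shows "interpolatory_mask \<nu> \<tau> \<theta> a" "scheme_interpolatory \<nu> \<tau> \<theta> a"
proof -
  show "interpolatory_mask \<nu> \<tau> \<theta> a"
    by (intro interpolatory_maskI mask subdiv_step \<theta>)
  show "scheme_interpolatory \<nu> \<tau> \<theta> a"
    unfolding scheme_interpolatory_def
  proof (intro allI impI)
    fix w0 :: "int^'d::{finite,linorder} \<Rightarrow> complex^'r::{finite,linorder}^1" and k l and n :: nat assume "1 \<le> n"
    then obtain n' where n': "n = Suc n'" by (cases n) auto
    show "refinement_data a \<nu> w0 n (2 *s k + ivec (2 *\<^sub>R \<tau> l - \<tau> (\<theta> l))) $ 1 $ \<theta> l
        = refinement_data a \<nu> w0 (n - 1) k $ 1 $ l"
      using subdiv_step[of \<theta> l "(subdiv a ^^ n') w0" k, OF \<theta>]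
      by (simp add: n' refinement_data_nth \<theta>(1) power_add mult_ac)
  qed
qed

text \<open>The data are exact derivatives of \<open>shift_sum \<phi> w0\<close> at 2^-n (k + \<tau>
  l), whereas the definition compares at 2^-n k. The gap tends to 0, and uniform continuity on a
  ball makes the estimate uniform in k.\<close>

lemma convergent: "scheme_convergent m \<nu> a"
  unfolding scheme_convergent_def
proof
  fix w0 :: "int^'d::{finite,linorder} \<Rightarrow> complex^'r::{finite,linorder}^1"
  define \<eta> where "\<eta> = shift_sum \<phi> w0"
  have C: "Cm m \<eta>" unfolding \<eta>_def by (rule Cm_shift_sum[OF Cm_\<phi> supp])
  have "(\<lambda>n. Max ((\<lambda>k. cmod (refinement_data a \<nu> w0 n k $ 1 $ l
                               - mderiv (\<nu> l) \<eta> (rvec k /\<^sub>R 2 ^ n)))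
                    ` {k. \<forall>i. \<bar>real_of_int (k $ i)\<bar> \<le> 2 ^ n * K})) \<longlonglongrightarrow> 0"
    if K: "K > 0" for K :: real and l
  proof (rule LIMSEQ_I)
    fix e :: real assume e: "e > 0"
    \<comment> \<open>The ball contains the cube of half-width K, by the l1 bound on the norm, and
      all its points displaced by at most \<open>norm (\<tau> l)\<close>.\<close>
    define B where "B = real CARD('d::{finite,linorder}) * K + norm (\<tau> l)"
    have "Cm 0 (mderiv (\<nu> l) \<eta>)" by (rule Cm_mderiv'[OF C]) (simp add: \<nu>_le)
    then have "uniformly_continuous_on (cball 0 B) (mderiv (\<nu> l) \<eta>)"
      by (intro compact_uniformly_continuous compact_cball) (auto intro: continuous_on_subset)
    then obtain d where d: "d > 0" "\<And>x y. x \<in> cball 0 B \<Longrightarrow> y \<in> cball 0 B \<Longrightarrow> dist y x < d \<Longrightarrow>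
        dist (mderiv (\<nu> l) \<eta> y) (mderiv (\<nu> l) \<eta> x) < e"
      unfolding uniformly_continuous_on_def using e by metis
    have "(\<lambda>n. norm (\<tau> l) * (1 / 2) ^ n) \<longlonglongrightarrow> norm (\<tau> l) * 0"
      by (intro tendsto_mult tendsto_const LIMSEQ_power_zero) simp
    then have "\<forall>\<^sub>F n in sequentially. norm (\<tau> l) * (1 / 2) ^ n < d"
      using d(1) by (intro order_tendstoD(2)) auto
    then obtain N where N: "\<And>n. n \<ge> N \<Longrightarrow> norm (\<tau> l) * (1 / 2) ^ n < d"
      by (auto simp: eventually_sequentially)
    show "\<exists>no. \<forall>n\<ge>no. norm (Max ((\<lambda>k. cmod (refinement_data a \<nu> w0 n k $ 1 $ l
                               - mderiv (\<nu> l) \<eta> (rvec k /\<^sub>R 2 ^ n)))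
                    ` {k. \<forall>i. \<bar>real_of_int (k $ i)\<bar> \<le> 2 ^ n * K}) - 0) < e"
    proof (intro exI allI impI)
      fix n assume n: "n \<ge> N"
      let ?S = "{k :: int^'d::{finite,linorder}. \<forall>i. \<bar>real_of_int (k $ i)\<bar> \<le> 2 ^ n * K}"
      let ?f = "\<lambda>k. cmod (refinement_data a \<nu> w0 n k $ 1 $ l - mderiv (\<nu> l) \<eta> (rvec k /\<^sub>R 2 ^ n))"
      have fin: "finite ?S" by (rule finite_int_box)
      have ne: "0 \<in> ?S" using K by simp
      have "?f k < e" if k: "k \<in> ?S" for k
      proof -
        have "norm (rvec k) \<le> (\<Sum>i\<in>UNIV. \<bar>rvec k $ i\<bar>)" by (rule norm_le_l1_cart)
        also have "\<dots> \<le> (\<Sum>i\<in>(UNIV::'d::{finite,linorder} set). 2 ^ n * K)" using k by (intro sum_mono) auto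
        also have "\<dots> = 2 ^ n * (real CARD('d::{finite,linorder}) * K)" by simp
        finally have nk: "norm (rvec k /\<^sub>R 2 ^ n) \<le> real CARD('d::{finite,linorder}) * K" by (simp add: field_simps)
        have nt: "norm ((1 / 2 ^ n) *\<^sub>R \<tau> l) \<le> norm (\<tau> l)"
          using mult_left_mono[of 1 "2 ^ n" "norm (\<tau> l)"] by (simp add: divide_simps)
        have eq: "(1 / 2 ^ n) *\<^sub>R (rvec k + \<tau> l) = rvec k /\<^sub>R 2 ^ n + (1 / 2 ^ n) *\<^sub>R \<tau> l"
          by (simp add: scaleR_add_right divide_inverse)
        have "dist (mderiv (\<nu> l) \<eta> ((1 / 2 ^ n) *\<^sub>R (rvec k + \<tau> l))) (mderiv (\<nu> l) \<eta> (rvec k /\<^sub>R 2 ^ n)) < e"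
        proof (rule d(2))
          show "rvec k /\<^sub>R 2 ^ n \<in> cball 0 B" using nk by (simp add: B_def add_increasing2)
          show "(1 / 2 ^ n) *\<^sub>R (rvec k + \<tau> l) \<in> cball 0 B"
            unfolding eq mem_cball_0 B_def by (rule norm_triangle_le) (use nk nt in linarith)
          show "dist ((1 / 2 ^ n) *\<^sub>R (rvec k + \<tau> l)) (rvec k /\<^sub>R 2 ^ n) < d"
            using N[OF n] unfolding eq dist_norm by (simp add: power_one_over divide_simps)
        qed
        then show ?thesis by (simp add: refinement_data_eq \<eta>_def dist_norm)
      qed
      moreover have "Max (?f ` ?S) \<in> ?f ` ?S" using fin ne by (intro Max_in finite_imageI) blast+
      ultimately show "norm (Max (?f ` ?S) - 0) < e" by fastforce
    qed
  qed
  with C show "\<exists>\<eta>. Cm m \<eta> \<and>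
        (\<forall>K>0. \<forall>l.
          (\<lambda>n. Max ((\<lambda>k. cmod (refinement_data a \<nu> w0 n k $ 1 $ l
                               - mderiv (\<nu> l) \<eta> (rvec k /\<^sub>R 2 ^ n)))
                    ` {k. \<forall>i. \<bar>real_of_int (k $ i)\<bar> \<le> 2 ^ n * K})) \<longlonglongrightarrow> 0)"
    by blast
qed

text \<open>Since \<nu> idx1 = 0, the first column of the iterate consists of the exact values
  \<phi>(2^-n (k + \<tau> idx1)). The supremum runs over all k, but where both sample points have
  left the support the difference is 0.\<close>

lemma basis_vector_function:
  assumes "\<nu> idx1 = 0"
  shows "is_basis_vector_function m a \<phi>"
  unfolding is_basis_vector_function_def
proof (intro conjI Cm_\<phi>)
  let ?t = "\<tau> idx1"
  let ?D = "\<lambda>n k. norm ((subdiv a ^^ n) (\<lambda>k. mat (delta k)) k *v axis idx1 1 - \<phi> (rvec k /\<^sub>R 2 ^ n))"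
  have val: "(subdiv a ^^ n) (\<lambda>k. mat (delta k)) k *v axis idx1 1 = \<phi> ((1 / 2 ^ n) *\<^sub>R (rvec k + ?t))" for n k
  proof -
    have "(subdiv a ^^ n) (\<lambda>k. mat (delta k)) k $ q $ idx1 = \<phi> ((1 / 2 ^ n) *\<^sub>R (rvec k + ?t)) $ q" for q
    proof -
      have "row_delta q k $ 1 = (mat (delta k) :: complex^'r::{finite,linorder}^'r::{finite,linorder}) $ q"
        for k :: "int^'d::{finite,linorder}"
        by (auto simp: vec_eq_iff mat_def delta_def)
      from subdiv_pow_row[OF mask this]
      have "(subdiv a ^^ n) (\<lambda>k. mat (delta k)) k $ q $ idx1 = (subdiv a ^^ n) (row_delta q) k $ 1 $ idx1"
        by simp
      also have "\<dots> = \<phi> ((1 / 2 ^ n) *\<^sub>R (rvec k + ?t)) $ q"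
        using mderiv_shift_sum_dyadic[of idx1 "row_delta q" n k] by (simp add: assms shift_sum_row_delta)
      finally show ?thesis .
    qed
    then show ?thesis by (simp add: vec_eq_iff matrix_vector_mult_axis)
  qed
  have cont: "continuous_on UNIV \<phi>" by (rule Cm_continuous[OF Cm_\<phi>])
  have key: "\<exists>N. \<forall>n\<ge>N. \<forall>k. ?D n k \<le> e" if e: "e > 0" for e
  proof -
    \<comment> \<open>The margin 1 is matched by \<open>min d 1\<close> below: if one of the two
      sample points has norm at most R, both lie in this ball.\<close>
    define B where "B = \<bar>R\<bar> + 1"
    have "uniformly_continuous_on (cball 0 B) \<phi>"
      using cont by (intro compact_uniformly_continuous compact_cball) (auto intro: continuous_on_subset)
    then obtain d where d: "d > 0" "\<And>x y. x \<in> cball 0 B \<Longrightarrow> y \<in> cball 0 B \<Longrightarrow> dist y x < d \<Longrightarrow>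
        dist (\<phi> y) (\<phi> x) < e"
      unfolding uniformly_continuous_on_def using e by metis
    have "(\<lambda>n. norm ?t * (1 / 2) ^ n) \<longlonglongrightarrow> norm ?t * 0"
      by (intro tendsto_mult tendsto_const LIMSEQ_power_zero) simp
    then have "\<forall>\<^sub>F n in sequentially. norm ?t * (1 / 2) ^ n < min d 1"
      using d(1) by (intro order_tendstoD(2)) auto
    then obtain N where N: "\<And>n. n \<ge> N \<Longrightarrow> norm ?t * (1 / 2) ^ n < min d 1"
      by (auto simp: eventually_sequentially)
    have "?D n k \<le> e" if n: "n \<ge> N" for n k
    proof -
      let ?x = "rvec k /\<^sub>R 2 ^ n" and ?y = "(1 / 2 ^ n) *\<^sub>R (rvec k + ?t)"
      have eq: "?y = ?x + (1 / 2 ^ n) *\<^sub>R ?t"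
        by (simp add: scaleR_add_right divide_inverse)
      have dist: "dist ?y ?x < min d 1"
        using N[OF n] unfolding eq dist_norm by (simp add: power_one_over divide_simps)
      show ?thesis
      proof (cases "norm ?x \<le> R \<or> norm ?y \<le> R")
        case True
        then have "?x \<in> cball 0 B" "?y \<in> cball 0 B"
          using dist norm_triangle_ineq3[of ?x ?y] norm_triangle_ineq3[of ?y ?x]
          by (auto simp: B_def dist_norm norm_minus_commute)
        then show ?thesis using d(2)[of ?x ?y] dist by (simp add: val dist_norm)
      next
        case False
        then show ?thesis using e supp_ballD[OF supp] by (simp add: val)
      qed
    qed
    then show ?thesis by blast
  qed
  have nn: "0 \<le> (SUP k. ereal (?D n k))" for n
    by (rule SUP_upper2[of 0]) auto
  show "(\<lambda>n. SUP k. ereal (?D n k)) \<longlonglongrightarrow> 0"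
  proof (rule order_tendstoI)
    fix b :: ereal assume "b < 0"
    then show "\<forall>\<^sub>F n in sequentially. b < (SUP k. ereal (?D n k))"
      using nn by (intro always_eventually allI) (rule less_le_trans)
  next
    fix b :: ereal assume "0 < b"
    then obtain e where e: "0 < ereal e" "ereal e < b" using ereal_dense2 by blast
    then obtain N where N: "\<And>n k. n \<ge> N \<Longrightarrow> ?D n k \<le> e" using key[of e] by auto
    have "(SUP k. ereal (?D n k)) < b" if "n \<ge> N" for n
      using N[OF that] e(2) by (intro le_less_trans[OF SUP_least]) auto
    then show "\<forall>\<^sub>F n in sequentially. (SUP k. ereal (?D n k)) < b"
      by (auto simp: eventually_sequentially)
  qed
qed

end

section \<open>From the scheme to the interpolant\<close>

lemma matrix_sum_left: "(\<Sum>k\<in>S. X k) ** (M :: complex^'n^'m) = (\<Sum>k\<in>S. X k ** M)"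
  by (simp add: vec_eq_iff matrix_matrix_mult_def sum_distrib_right) (intro allI sum.swap)

lemma matrix_sum_right: "(M :: complex^'n^'m) ** (\<Sum>k\<in>S. X k) = (\<Sum>k\<in>S. M ** X k)"
  by (simp add: vec_eq_iff matrix_matrix_mult_def sum_distrib_left) (intro allI sum.swap)

lemma matrix_scaleR_left: "(c *\<^sub>R X) ** (M :: complex^'n^'m) = c *\<^sub>R (X ** M)"
  by (simp add: vec_eq_iff matrix_matrix_mult_def scaleR_sum_right)

lemma matrix_scaleR_right: "(M :: complex^'n^'m) ** (c *\<^sub>R X) = c *\<^sub>R (M ** X)"
  by (simp add: vec_eq_iff matrix_matrix_mult_def scaleR_sum_right)

lemma mat_delta: "(mat (delta k) :: complex^'n^'n) = (if k = 0 then mat 1 else 0)"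
  by (simp add: delta_def vec_eq_iff mat_def)

lemma matrix_mult_0 [simp]: "0 ** (M :: complex^'n^'m) = 0" "(M :: complex^'n^'m) ** 0 = 0"
  by (simp_all add: vec_eq_iff matrix_matrix_mult_def)

lemma subdiv_translate: "subdiv a (\<lambda>i. v (i - p)) j = subdiv a v (j - 2 *s (p :: int^'d))"
proof -
  have bij: "bij_betw (\<lambda>i. i + p) UNIV (UNIV :: (int^'d) set)"
    by (rule bij_betwI[where g = "\<lambda>j. j - p"]) auto
  have "(\<Sum>\<^sub>\<infinity>i. v (i - p) ** a (j - 2 *s i)) = (\<Sum>\<^sub>\<infinity>i. v i ** a (j - 2 *s p - 2 *s i))"
    using infsum_reindex_bij_betw[OF bij, of "\<lambda>i. v (i - p) ** a (j - 2 *s i)"]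
    by (simp add: vector_add_ldistrib algebra_simps)
  then show ?thesis by (simp add: subdiv_def)
qed

lemma subdiv_sum:
  fixes a :: "int^'d \<Rightarrow> complex^'r^'r" and v :: "'k \<Rightarrow> int^'d \<Rightarrow> complex^'r^'s"
    and B :: "'k \<Rightarrow> complex^'s^'t"
  assumes "fin_supp a"
  shows "subdiv a (\<lambda>i. c *\<^sub>R (\<Sum>k\<in>S. B k ** v k i)) j = c *\<^sub>R (\<Sum>k\<in>S. B k ** subdiv a (v k) j)"
proof -
  let ?F = "{i. a (j - 2 *s i) \<noteq> 0}"
  have F: "finite ?F" by (rule finite_mask_preimage[OF assms])
  have sub: "subdiv a u j = 2 ^ CARD('d) *\<^sub>R (\<Sum>i\<in>?F. u i ** a (j - 2 *s i))" for u :: "int^'d \<Rightarrow> complex^'r^'s"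
    by (rule subdiv_finite[OF F]) simp
  have sub': "subdiv a u j = 2 ^ CARD('d) *\<^sub>R (\<Sum>i\<in>?F. u i ** a (j - 2 *s i))" for u :: "int^'d \<Rightarrow> complex^'r^'t"
    by (rule subdiv_finite[OF F]) simp
  show ?thesis
    unfolding sub sub' matrix_scaleR_left matrix_scaleR_right matrix_sum_left matrix_sum_right
      scaleR_sum_right matrix_mul_assoc
    by (subst sum.swap) (simp add: mult.commute)
qed

section \<open>Iterates of the delta sequence and their limits at dyadic points\<close>

abbreviation subdiv_pow_delta ::
  "(int^'d \<Rightarrow> complex^'r^'r) \<Rightarrow> nat \<Rightarrow> int^'d \<Rightarrow> complex^'r^'r" where
  "subdiv_pow_delta a n \<equiv> (subdiv a ^^ n) (\<lambda>k. mat (delta k))"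

text \<open>The radius obeys r(n+1) = 2 r(n) + \<rho> with r(0) = 0. Rescaled by 2^-n it stays at
  most \<rho>, which becomes the support radius of \<phi>.\<close>

lemma subdiv_pow_delta_support:
  assumes \<rho>: "\<And>k. a k \<noteq> 0 \<Longrightarrow> norm (rvec k) \<le> \<rho>"
  shows "subdiv_pow_delta a n k \<noteq> 0 \<Longrightarrow> norm (rvec k) \<le> \<rho> * (2 ^ n - 1)"
proof (induction n arbitrary: k)
  case 0
  then show ?case by (auto simp: mat_delta split: if_splits)
next
  case (Suc n)
  have "\<exists>i. subdiv_pow_delta a n i \<noteq> 0 \<and> a (k - 2 *s i) \<noteq> 0"
  proof (rule ccontr)
    assume "\<nexists>i. subdiv_pow_delta a n i \<noteq> 0 \<and> a (k - 2 *s i) \<noteq> 0"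
    then have "subdiv_pow_delta a n i ** a (k - 2 *s i) = 0" for i by (metis matrix_mult_0)
    then have "subdiv_pow_delta a (Suc n) k = 0" by (simp add: subdiv_def)
    then show False using Suc.prems by simp
  qed
  then obtain i where i: "norm (rvec i) \<le> \<rho> * (2 ^ n - 1)" "norm (rvec (k - 2 *s i)) \<le> \<rho>"
    using Suc.IH \<rho> by blast
  have "rvec k = rvec (k - 2 *s i) + 2 *\<^sub>R rvec i" by (simp add: rvec_diff rvec_scale)
  then have "norm (rvec k) \<le> norm (rvec (k - 2 *s i)) + norm (2 *\<^sub>R rvec i)"
    by (metis norm_triangle_ineq)
  also have "\<dots> \<le> \<rho> + 2 * (\<rho> * (2 ^ n - 1))" using i by simp
  finally show ?case by (simp add: algebra_simps)
qed

text \<open>\<open>funpow\<close> multiplies by the newest mask on the right; here the mask of the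
  coarsest level is split off on the left instead. It is this form, with the shift 2^n k, that
  becomes the refinement equation in the limit.\<close>

lemma subdiv_pow_delta_Suc:
  fixes a :: "int^'d \<Rightarrow> complex^'r^'r"
  assumes a: "fin_supp a"
  shows "subdiv_pow_delta a (Suc n) j
    = 2 ^ CARD('d) *\<^sub>R (\<Sum>k | a k \<noteq> 0. a k ** subdiv_pow_delta a n (j - 2 ^ n *s k))"
proof (induction n arbitrary: j)
  case 0
  define F where "F = insert 0 {i. a (j - 2 *s i) \<noteq> 0}"
  have fF: "finite F" using finite_mask_preimage[OF a] by (simp add: F_def)
  have fS: "finite {k. a k \<noteq> 0}" using a by (simp add: fin_supp_def)
  have "subdiv a (\<lambda>k. mat (delta k) :: complex^'r^'r) j
      = 2 ^ CARD('d) *\<^sub>R (\<Sum>k\<in>F. mat (delta k) ** a (j - 2 *s k))"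
    by (rule subdiv_finite[OF fF]) (simp add: F_def)
  also have "(\<Sum>k\<in>F. mat (delta k) ** a (j - 2 *s k)) = (\<Sum>k\<in>F. if k = 0 then a j else 0)"
    by (rule sum.cong) (auto simp: mat_delta)
  also have "\<dots> = a j" using fF by (simp add: F_def)
  also have "a j = (\<Sum>k | a k \<noteq> 0. if k = j then a j else 0)"
    using fS by simp
  also have "\<dots> = (\<Sum>k | a k \<noteq> 0. a k ** mat (delta (j - 2 ^ 0 *s k)))"
    by (rule sum.cong) (auto simp: mat_delta)
  finally show ?case by simp
next
  case (Suc n)
  have "subdiv_pow_delta a (Suc (Suc n)) j = subdiv a (subdiv_pow_delta a (Suc n)) j" by simp
  also have "subdiv_pow_delta a (Suc n)
      = (\<lambda>i. 2 ^ CARD('d) *\<^sub>R (\<Sum>k | a k \<noteq> 0. a k ** subdiv_pow_delta a n (i - 2 ^ n *s k)))"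
    by (rule ext) (rule Suc.IH)
  also have "subdiv a \<dots> j = 2 ^ CARD('d) *\<^sub>R (\<Sum>k | a k \<noteq> 0. a k ** subdiv a (subdiv_pow_delta a n) (j - 2 *s (2 ^ n *s k)))"
    unfolding subdiv_sum[OF a] subdiv_translate ..
  finally show ?case by (simp add: vector_smult_assoc)
qed

text \<open>Approximation by floor(2^n x) / 2^n. The version relative to U serves the vanishing of
  \<phi> outside a ball.\<close>

lemma dyadic_dense:
  fixes f :: "real^'d \<Rightarrow> 'b::t2_space"
  assumes "continuous_on UNIV f" "open U" "x \<in> U"
    and dy: "\<And>n k. rvec k /\<^sub>R 2 ^ n \<in> U \<Longrightarrow> f (rvec k /\<^sub>R 2 ^ n) = c"
  shows "f x = c"
proof -
  define X where "X n = rvec (ivec (2 ^ n *\<^sub>R x)) /\<^sub>R 2 ^ n" for n :: nat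
  have "X \<longlonglongrightarrow> x"
  proof (rule vec_tendstoI)
    fix i
    have "(\<lambda>n. X n $ i - x $ i) \<longlonglongrightarrow> 0"
    proof (rule Lim_null_comparison)
      show "\<forall>\<^sub>F n in sequentially. norm (X n $ i - x $ i) \<le> (1 / 2) ^ n"
      proof (intro always_eventually allI)
        fix n :: nat
        have "\<bar>of_int \<lfloor>2 ^ n * x $ i\<rfloor> - 2 ^ n * x $ i\<bar> \<le> 1" by linarith
        moreover have "X n $ i - x $ i = (of_int \<lfloor>2 ^ n * x $ i\<rfloor> - 2 ^ n * x $ i) / 2 ^ n"
          by (simp add: X_def ivec_def field_simps)
        ultimately show "norm (X n $ i - x $ i) \<le> (1 / 2) ^ n"
          by (simp add: abs_divide power_one_over divide_right_mono)
      qed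
      show "(\<lambda>n. (1 / 2) ^ n :: real) \<longlonglongrightarrow> 0" by (rule LIMSEQ_power_zero) simp
    qed
    then show "(\<lambda>n. X n $ i) \<longlonglongrightarrow> x $ i" by (rule LIM_zero_cancel)
  qed
  then have ev: "\<forall>\<^sub>F n in sequentially. X n \<in> U"
    using assms(2,3) by (rule topological_tendstoD)
  have "isCont f x" using assms(1) by (simp add: continuous_on_eq_continuous_at)
  then have "(\<lambda>n. f (X n)) \<longlonglongrightarrow> f x" using \<open>X \<longlonglongrightarrow> x\<close> by (rule isCont_tendsto_compose)
  moreover have "(\<lambda>n. f (X n)) \<longlonglongrightarrow> c"
    by (rule tendsto_eventually, rule eventually_mono[OF ev]) (use dy in \<open>auto simp: X_def\<close>)
  ultimately show ?thesis using LIMSEQ_unique by blast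
qed

lemma rvec_dyadic:
  assumes "n0 \<le> n"
  shows "rvec (2 ^ (n - n0) *s k) /\<^sub>R 2 ^ n = rvec k /\<^sub>R 2 ^ n0"
proof -
  have "(2::real) ^ n = 2 ^ (n - n0) * 2 ^ n0" using assms by (simp flip: power_add)
  then show ?thesis by (simp add: rvec_scale)
qed

text \<open>A dyadic point has an index at every sufficiently fine level, and each term is dominated
  by the supremum, so the uniform limit yields a pointwise one.\<close>

lemma basis_vector_function_limit:
  fixes a :: "int^'d \<Rightarrow> complex^'r::{finite,linorder}^'r::{finite,linorder}"
  assumes basis: "is_basis_vector_function m a \<phi>"
    and K: "\<And>n. n \<ge> n0 \<Longrightarrow> rvec (K n) /\<^sub>R 2 ^ n = x"
  shows "(\<lambda>n. subdiv_pow_delta a n (K n) *v axis idx1 1) \<longlonglongrightarrow> \<phi> x"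
proof (rule LIMSEQ_I)
  let ?A = "subdiv_pow_delta a" and ?e1 = "axis idx1 1 :: complex^'r::{finite,linorder}"
  fix e :: real assume e: "e > 0"
  have "\<forall>\<^sub>F n in sequentially. (SUP k. ereal (norm (?A n k *v ?e1 - \<phi> (rvec k /\<^sub>R 2 ^ n)))) < ereal e"
    using basis e unfolding is_basis_vector_function_def
    by (intro order_tendstoD(2)[where y = 0]) auto
  then obtain N where N: "\<And>n. n \<ge> N \<Longrightarrow> (SUP k. ereal (norm (?A n k *v ?e1 - \<phi> (rvec k /\<^sub>R 2 ^ n)))) < ereal e"
    by (auto simp: eventually_sequentially)
  have "norm (?A n (K n) *v ?e1 - \<phi> x) < e" if n: "n \<ge> max N n0" for n
  proof -
    have "ereal (norm (?A n (K n) *v ?e1 - \<phi> (rvec (K n) /\<^sub>R 2 ^ n)))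
      \<le> (SUP k. ereal (norm (?A n k *v ?e1 - \<phi> (rvec k /\<^sub>R 2 ^ n))))"
      by (rule SUP_upper) simp
    from le_less_trans[OF this N] show ?thesis using n K by simp
  qed
  then show "\<exists>no. \<forall>n\<ge>no. norm (?A n (K n) *v ?e1 - \<phi> x) < e" by blast
qed

lemma basis_vector_function_continuous:
  "is_basis_vector_function m a \<phi> \<Longrightarrow> continuous_on UNIV \<phi>"
  by (auto simp: is_basis_vector_function_def intro: Cm_continuous)

lemma basis_vector_function_supp_ball:
  fixes a :: "int^'d \<Rightarrow> complex^'r::{finite,linorder}^'r::{finite,linorder}"
  assumes mask: "fin_supp a" and basis: "is_basis_vector_function m a \<phi>"
  obtains R where "supp_ball R \<phi>"
proof -
  let ?A = "subdiv_pow_delta a" and ?e1 = "axis idx1 1 :: complex^'r::{finite,linorder}"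
  note cont = basis_vector_function_continuous[OF basis] and lim = basis_vector_function_limit[OF basis]
  have fS: "finite {k. a k \<noteq> 0}" using mask by (simp add: fin_supp_def)
  \<comment> \<open>Inserting 0 makes \<open>Max\<close> meaningful for the zero mask and \<rho>
    nonnegative.\<close>
  define \<rho> where "\<rho> = Max (insert 0 ((\<lambda>k. norm (rvec k)) ` {k. a k \<noteq> 0}))"
  have \<rho>: "norm (rvec k) \<le> \<rho>" if "a k \<noteq> 0" for k
    unfolding \<rho>_def using fS that by (intro Max_ge) auto
  have \<rho>0: "0 \<le> \<rho>" unfolding \<rho>_def using fS by (intro Max_ge) auto
  have supp: "supp_ball \<rho> \<phi>"
    unfolding supp_ball_def
  proof (intro allI impI)
    fix x :: "real^'d" assume x: "\<rho> < norm x"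
    show "\<phi> x = 0"
    proof (rule dyadic_dense[OF cont, of "{x. \<rho> < norm x}"])
      show "open {x :: real^'d. \<rho> < norm x}" by (intro open_Collect_less continuous_intros)
      fix n0 and k0 :: "int^'d"
      assume y: "rvec k0 /\<^sub>R 2 ^ n0 \<in> {x. \<rho> < norm x}"
      have l: "(\<lambda>n. ?A n (2 ^ (n - n0) *s k0) *v ?e1) \<longlonglongrightarrow> \<phi> (rvec k0 /\<^sub>R 2 ^ n0)"
        by (rule lim) (rule rvec_dyadic)
      have "?A n (2 ^ (n - n0) *s k0) = 0" if n: "n \<ge> n0" for n
      proof (rule ccontr)
        assume "?A n (2 ^ (n - n0) *s k0) \<noteq> 0"
        from subdiv_pow_delta_support[OF \<rho> this]
        have "norm (rvec (2 ^ (n - n0) *s k0)) \<le> \<rho> * 2 ^ n" using \<rho>0 by (simp add: algebra_simps)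
        then have "norm (rvec (2 ^ (n - n0) *s k0) /\<^sub>R 2 ^ n) \<le> \<rho>" by (simp add: field_simps)
        then show False using y unfolding rvec_dyadic[OF n] by simp
      qed
      then have "\<forall>\<^sub>F n in sequentially. ?A n (2 ^ (n - n0) *s k0) *v ?e1 = 0"
        by (auto simp: eventually_sequentially intro!: exI[of _ n0])
      then have "(\<lambda>n. ?A n (2 ^ (n - n0) *s k0) *v ?e1) \<longlonglongrightarrow> 0" by (rule tendsto_eventually)
      with l show "\<phi> (rvec k0 /\<^sub>R 2 ^ n0) = 0" using LIMSEQ_unique by blast
    qed (use x in simp)
  qed
  then show thesis by (rule that)
qed

text \<open>The recursion \<open>subdiv_pow_delta_Suc\<close> is passed to the limit at dyadic
  points; both sides of the limit equation being continuous, density extends it to all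
  points.\<close>

lemma basis_vector_function_refinable:
  fixes a :: "int^'d \<Rightarrow> complex^'r::{finite,linorder}^'r::{finite,linorder}"
  assumes mask: "fin_supp a" and basis: "is_basis_vector_function m a \<phi>"
  shows "refinable a \<phi>"
  unfolding refinable_def
proof
  let ?A = "subdiv_pow_delta a" and ?e1 = "axis idx1 1 :: complex^'r::{finite,linorder}"
  note cont = basis_vector_function_continuous[OF basis] and lim = basis_vector_function_limit[OF basis]
  have fS: "finite {k. a k \<noteq> 0}" using mask by (simp add: fin_supp_def)
  fix x
  define G where "G x = \<phi> x - 2 ^ CARD('d) *\<^sub>R (\<Sum>k | a k \<noteq> 0. a k *v \<phi> (2 *\<^sub>R x - rvec k))" for x
  have blm: "bounded_linear ((*v) M)" for M :: "complex^'r::{finite,linorder}^'r::{finite,linorder}"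
    by (simp add: linear_conv_bounded_linear[symmetric])
  have contG: "continuous_on UNIV G"
    unfolding G_def
    by (intro continuous_intros bounded_linear.continuous_on[OF blm] cont
        continuous_on_compose2[OF cont]) auto
  have "G x = 0"
  proof (rule dyadic_dense[OF contG open_UNIV UNIV_I])
    fix n0 and k0 :: "int^'d"
    let ?x = "rvec k0 /\<^sub>R 2 ^ n0"
    have l1: "(\<lambda>n. ?A n (2 ^ (n - n0) *s k0) *v ?e1) \<longlonglongrightarrow> \<phi> ?x"
      by (rule lim) (rule rvec_dyadic)
    then have l1: "(\<lambda>n. ?A (Suc n) (2 ^ (Suc n - n0) *s k0) *v ?e1) \<longlonglongrightarrow> \<phi> ?x"
      by (rule LIMSEQ_Suc)
    \<comment> \<open>The level is n here and n + 1 on the other side: the index of x at level n + 1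
      is, at level n, the index of 2x.\<close>
    have l2: "(\<lambda>n. ?A n (2 ^ (Suc n - n0) *s k0 - 2 ^ n *s k) *v ?e1) \<longlonglongrightarrow> \<phi> (2 *\<^sub>R ?x - rvec k)" for k
    proof (rule lim)
      fix n assume n: "n0 \<le> n"
      have "rvec (2 ^ (Suc n - n0) *s k0) /\<^sub>R 2 ^ n = 2 *\<^sub>R (rvec (2 ^ (Suc n - n0) *s k0) /\<^sub>R 2 ^ Suc n)"
        by simp
      also have "\<dots> = 2 *\<^sub>R ?x" using n by (subst rvec_dyadic) auto
      finally show "rvec (2 ^ (Suc n - n0) *s k0 - 2 ^ n *s k) /\<^sub>R 2 ^ n = 2 *\<^sub>R ?x - rvec k"
        by (simp add: rvec_diff rvec_scale scaleR_diff_right)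
    qed
    have "(\<lambda>n. 2 ^ CARD('d) *\<^sub>R (\<Sum>k | a k \<noteq> 0. a k *v (?A n (2 ^ (Suc n - n0) *s k0 - 2 ^ n *s k) *v ?e1)))
        \<longlonglongrightarrow> 2 ^ CARD('d) *\<^sub>R (\<Sum>k | a k \<noteq> 0. a k *v \<phi> (2 *\<^sub>R ?x - rvec k))"
      by (intro tendsto_scaleR tendsto_const tendsto_sum bounded_linear.tendsto[OF blm] l2)
    moreover have "2 ^ CARD('d) *\<^sub>R (\<Sum>k | a k \<noteq> 0. a k *v (?A n (2 ^ (Suc n - n0) *s k0 - 2 ^ n *s k) *v ?e1))
        = ?A (Suc n) (2 ^ (Suc n - n0) *s k0) *v ?e1" for n
    proof -
      have "(M *\<^sub>R (\<Sum>k | a k \<noteq> 0. a k ** X k)) *v ?e1 = M *\<^sub>R (\<Sum>k | a k \<noteq> 0. a k *v (X k *v ?e1))" for M X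
        by (simp add: vec_eq_iff matrix_vector_mult_axis) (simp add: matrix_vector_mul_assoc matrix_vector_mult_axis)
      then show ?thesis unfolding subdiv_pow_delta_Suc[OF mask] by simp
    qed
    ultimately have "\<phi> ?x = 2 ^ CARD('d) *\<^sub>R (\<Sum>k | a k \<noteq> 0. a k *v \<phi> (2 *\<^sub>R ?x - rvec k))"
      using l1 LIMSEQ_unique by simp
    then show "G ?x = 0" by (simp add: G_def)
  qed
  moreover have "(\<Sum>\<^sub>\<infinity>k. a k *v \<phi> (2 *\<^sub>R x - rvec k)) = (\<Sum>k | a k \<noteq> 0. a k *v \<phi> (2 *\<^sub>R x - rvec k))"
    by (rule infsum_finite_support[OF fS]) simp
  ultimately show "\<phi> x = 2 ^ CARD('d) *\<^sub>R (\<Sum>\<^sub>\<infinity>k. a k *v \<phi> (2 *\<^sub>R x - rvec k))"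
    by (simp add: G_def)
qed

text \<open>The limit function \<eta> promised for the datum \<open>row_delta q\<close> is
  identified with the entry q of \<phi> through the component \<open>idx1\<close>, where no
  derivative is taken and both have the same limits at dyadic points. The remaining components then
  converge to derivatives of that entry.\<close>

lemma hermite_system_of_scheme:
  fixes m :: nat
    and \<nu> :: "'r::{finite,linorder} \<Rightarrow> nat^'d::{finite,linorder}"
    and a :: "int^'d::{finite,linorder} \<Rightarrow> complex^'r::{finite,linorder}^'r::{finite,linorder}"
  assumes \<nu>_le: "\<And>l. mabs (\<nu> l) \<le> m"
    and \<nu>1: "\<nu> idx1 = 0"
    and \<theta>_\<nu>: "\<And>l. \<nu> (\<theta> l) = \<nu> l"
    and \<theta>_\<tau>: "\<And>l i. (2 *\<^sub>R \<tau> l - \<tau> (\<theta> l)) $ i \<in> \<int>"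
    and mask: "fin_supp a"
    and conv: "scheme_convergent m \<nu> a"
    and interp: "scheme_interpolatory \<nu> \<tau> \<theta> a"
    and basis: "is_basis_vector_function m a \<phi>"
  shows "\<exists>R. hermite_system m \<nu> \<tau> a \<phi> R"
proof -
  let ?A = "subdiv_pow_delta a"
  let ?e1 = "axis idx1 1 :: complex^'r::{finite,linorder}"
  have C: "Cm m \<phi>" using basis by (simp add: is_basis_vector_function_def)
  note cont = basis_vector_function_continuous[OF basis] and lim = basis_vector_function_limit[OF basis]
  have "mderiv (\<nu> l) \<phi> (rvec k + \<tau> l) $ q = (delta k *s axis l 1) $ q" for k l q
  proof -
    obtain \<eta> where \<eta>: "Cm m \<eta>" and conv: "\<And>K l. K > 0 \<Longrightarrow>
          (\<lambda>n. Max ((\<lambda>k. cmod (refinement_data a \<nu> (row_delta q) n k $ 1 $ l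
                               - mderiv (\<nu> l) \<eta> (rvec k /\<^sub>R 2 ^ n)))
                    ` {k. \<forall>i. \<bar>real_of_int (k $ i)\<bar> \<le> 2 ^ n * K})) \<longlonglongrightarrow> 0"
      using conv unfolding scheme_convergent_def by meson
    have conv': "\<exists>N. \<forall>n\<ge>N. \<forall>k. norm (rvec k /\<^sub>R 2 ^ n) \<le> K \<longrightarrow>
        cmod (refinement_data a \<nu> (row_delta q) n k $ 1 $ l - mderiv (\<nu> l) \<eta> (rvec k /\<^sub>R 2 ^ n)) < e"
      if "K > 0" "e > 0" for K e l
    proof -
      from LIMSEQ_D[OF conv[OF that(1), of l] that(2)] obtain N where
        N: "\<And>n. n \<ge> N \<Longrightarrow> norm (Max ((\<lambda>k. cmod (refinement_data a \<nu> (row_delta q) n k $ 1 $ l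
                               - mderiv (\<nu> l) \<eta> (rvec k /\<^sub>R 2 ^ n)))
                    ` {k. \<forall>i. \<bar>real_of_int (k $ i)\<bar> \<le> 2 ^ n * K}) - 0) < e" by blast
      have "cmod (refinement_data a \<nu> (row_delta q) n k $ 1 $ l - mderiv (\<nu> l) \<eta> (rvec k /\<^sub>R 2 ^ n)) < e"
        if n: "n \<ge> N" and k: "norm (rvec k /\<^sub>R 2 ^ n) \<le> K" for n k
      proof -
        have "\<bar>real_of_int (k $ i)\<bar> \<le> 2 ^ n * K" for i
          using order_trans[OF component_le_norm_cart[of "rvec k" i], of "2 ^ n * K"] k
          by (simp add: field_simps)
        then have "cmod (refinement_data a \<nu> (row_delta q) n k $ 1 $ l - mderiv (\<nu> l) \<eta> (rvec k /\<^sub>R 2 ^ n))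
          \<le> Max ((\<lambda>k. cmod (refinement_data a \<nu> (row_delta q) n k $ 1 $ l
                               - mderiv (\<nu> l) \<eta> (rvec k /\<^sub>R 2 ^ n)))
                    ` {k. \<forall>i. \<bar>real_of_int (k $ i)\<bar> \<le> 2 ^ n * K})"
          by (intro Max_ge finite_imageI finite_int_box) auto
        then show ?thesis using N[OF n] by simp
      qed
      then show ?thesis by blast
    qed
    have row: "row_delta q k $ 1 = (mat (delta k) :: complex^'r::{finite,linorder}^'r::{finite,linorder}) $ q"
      for k :: "int^'d::{finite,linorder}"
      by (auto simp: vec_eq_iff mat_def delta_def)
    have data1: "refinement_data a \<nu> (row_delta q) n k $ 1 $ idx1 = (?A n k *v ?e1) $ q" for n k
      using subdiv_pow_row[where w = "row_delta q", OF mask row] by (simp add: refinement_data_nth \<nu>1 matrix_vector_mult_axis)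
    have \<eta>_eq: "\<eta> = (\<lambda>x. \<phi> x $ q)"
    proof
      fix x
      define G where "G x = \<eta> x - \<phi> x $ q" for x
      have "continuous_on UNIV G" unfolding G_def
        by (intro continuous_intros Cm_continuous[OF \<eta>] cont)
      then have "G x = 0"
      proof (rule dyadic_dense[OF _ open_UNIV UNIV_I])
        fix n0 and k0 :: "int^'d::{finite,linorder}"
        let ?x = "rvec k0 /\<^sub>R 2 ^ n0"
        let ?K = "\<lambda>n. 2 ^ (n - n0) *s k0"
        have "(\<lambda>n. ?A n (?K n) *v ?e1) \<longlonglongrightarrow> \<phi> ?x"
          by (rule lim) (rule rvec_dyadic)
        then have "(\<lambda>n. (?A n (?K n) *v ?e1) $ q) \<longlonglongrightarrow> \<phi> ?x $ q" by (rule tendsto_vec_nth)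
        moreover have "(\<lambda>n. (?A n (?K n) *v ?e1) $ q) \<longlonglongrightarrow> \<eta> ?x"
        proof (rule LIMSEQ_I)
          fix e :: real assume e: "e > 0"
          have "norm ?x + 1 > 0" using norm_ge_zero[of ?x] by linarith
          from conv'[OF this e, of idx1] obtain N where N: "\<And>n k. n \<ge> N \<Longrightarrow> norm (rvec k /\<^sub>R 2 ^ n) \<le> norm ?x + 1 \<Longrightarrow>
            cmod (refinement_data a \<nu> (row_delta q) n k $ 1 $ idx1 - \<eta> (rvec k /\<^sub>R 2 ^ n)) < e"
            by (auto simp: \<nu>1)
          have "norm ((?A n (?K n) *v ?e1) $ q - \<eta> ?x) < e" if "n \<ge> max N n0" for n
          proof -
            have r: "rvec (?K n) /\<^sub>R 2 ^ n = ?x" using that by (intro rvec_dyadic) auto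
            show ?thesis using N[of n "?K n"] that unfolding r data1 by simp
          qed
          then show "\<exists>no. \<forall>n\<ge>no. norm ((?A n (?K n) *v ?e1) $ q - \<eta> ?x) < e" by blast
        qed
        ultimately show "G ?x = 0" using LIMSEQ_unique by (auto simp: G_def)
      qed
      then show "\<eta> x = \<phi> x $ q" by (simp add: G_def)
    qed
    \<comment> \<open>By interpolation the datum \<open>w\<^sub>0(k) e\<^sub>l\<close> reappears at level \<open>n\<close> at the index \<open>K n\<close>, in the
      component \<open>L n\<close>, where \<open>K n + \<tau>(L n) = 2\<^sup>n (k + \<tau> l)\<close>.\<close>
    define L where "L n = (\<theta> ^^ n) l" for n
    define K where "K = rec_nat k (\<lambda>n p. 2 *s p + ivec (2 *\<^sub>R \<tau> (L n) - \<tau> (\<theta> (L n))))"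
    have K0: "K 0 = k" and KS: "K (Suc n) = 2 *s K n + ivec (2 *\<^sub>R \<tau> (L n) - \<tau> (\<theta> (L n)))" for n
      by (simp_all add: K_def)
    have LS: "L (Suc n) = \<theta> (L n)" for n by (simp add: L_def)
    have \<nu>L: "\<nu> (L n) = \<nu> l" for n by (induction n) (simp_all add: L_def \<theta>_\<nu>)
    have pos: "rvec (K n) + \<tau> (L n) = 2 ^ n *\<^sub>R (rvec k + \<tau> l)" for n
    proof (induction n)
      case 0
      then show ?case by (simp add: K0 L_def)
    next
      case (Suc n)
      have "rvec (K (Suc n)) + \<tau> (L (Suc n)) = 2 *\<^sub>R (rvec (K n) + \<tau> (L n))"
        unfolding KS LS by (simp add: rvec_add rvec_scale rvec_ivec[OF \<theta>_\<tau>] algebra_simps)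
      then show ?case using Suc by simp
    qed
    have data: "refinement_data a \<nu> (row_delta q) n (K n) $ 1 $ L n = row_delta q k $ 1 $ l" for n
    proof (induction n)
      case 0
      then show ?case by (simp add: K0 L_def refinement_data_nth)
    next
      case (Suc n)
      then show ?case using interp unfolding scheme_interpolatory_def KS LS by simp
    qed
    \<comment> \<open>The component L n changes with n, hence a bound on all \<tau> l at once; for
      the same reason the maximum over \<open>range N\<close> is taken below.\<close>
    define T where "T = Max (range (\<lambda>l. norm (\<tau> l)))"
    have T: "norm (\<tau> l) \<le> T" for l unfolding T_def by (intro Max_ge) auto
    let ?x = "rvec k + \<tau> l"
    have T0: "0 \<le> T" using T[of l] norm_ge_zero order_trans by blast
    have X_eq: "rvec (K n) /\<^sub>R 2 ^ n = ?x - \<tau> (L n) /\<^sub>R 2 ^ n" for n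
    proof -
      have "rvec (K n) = 2 ^ n *\<^sub>R ?x - \<tau> (L n)" using pos[of n] by (simp add: algebra_simps)
      then show ?thesis by (simp add: scaleR_diff_right)
    qed
    have X_lim: "(\<lambda>n. rvec (K n) /\<^sub>R 2 ^ n) \<longlonglongrightarrow> ?x"
    proof (rule LIM_zero_cancel, rule Lim_null_comparison)
      show "\<forall>\<^sub>F n in sequentially. norm (rvec (K n) /\<^sub>R 2 ^ n - ?x) \<le> T * (1 / 2) ^ n"
        unfolding X_eq using T by (intro always_eventually allI) (simp add: power_one_over divide_simps)
      have "(\<lambda>n. T * (1 / 2) ^ n) \<longlonglongrightarrow> T * 0"
        by (intro tendsto_mult tendsto_const LIMSEQ_power_zero) simp
      then show "(\<lambda>n. T * (1 / 2) ^ n) \<longlonglongrightarrow> 0" by simp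
    qed
    have "Cm 0 (mderiv (\<nu> l) \<eta>)" by (rule Cm_mderiv'[OF \<eta>]) (simp add: \<nu>_le)
    then have "isCont (mderiv (\<nu> l) \<eta>) ?x" by (simp add: continuous_on_eq_continuous_at)
    then have l1: "(\<lambda>n. mderiv (\<nu> l) \<eta> (rvec (K n) /\<^sub>R 2 ^ n)) \<longlonglongrightarrow> mderiv (\<nu> l) \<eta> ?x"
      using X_lim by (rule isCont_tendsto_compose)
    have l2: "(\<lambda>n. mderiv (\<nu> l) \<eta> (rvec (K n) /\<^sub>R 2 ^ n)) \<longlonglongrightarrow> row_delta q k $ 1 $ l"
    proof (rule LIMSEQ_I)
      fix e :: real assume e: "e > 0"
      have "norm ?x + T + 1 > 0" using norm_ge_zero[of ?x] T0 by linarith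
      from conv'[OF this e] obtain N where N: "\<And>n k l. n \<ge> N l \<Longrightarrow> norm (rvec k /\<^sub>R 2 ^ n) \<le> norm ?x + T + 1 \<Longrightarrow>
        cmod (refinement_data a \<nu> (row_delta q) n k $ 1 $ l - mderiv (\<nu> l) \<eta> (rvec k /\<^sub>R 2 ^ n)) < e"
        by metis
      have "norm (mderiv (\<nu> l) \<eta> (rvec (K n) /\<^sub>R 2 ^ n) - row_delta q k $ 1 $ l) < e"
        if n: "n \<ge> Max (range N)" for n
      proof -
        have "n \<ge> N (L n)" using n Max_ge[of "range N" "N (L n)"] by simp
        moreover have "norm (rvec (K n) /\<^sub>R 2 ^ n) \<le> norm ?x + T + 1"
        proof -
          have "norm (\<tau> (L n) /\<^sub>R 2 ^ n) \<le> norm (\<tau> (L n))"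
            using mult_left_mono[of 1 "2 ^ n" "norm (\<tau> (L n))"] by (simp add: divide_simps)
          then show ?thesis unfolding X_eq
            using norm_triangle_ineq4[of ?x "\<tau> (L n) /\<^sub>R 2 ^ n"] T[of "L n"] by linarith
        qed
        ultimately show ?thesis using N[of "L n" n "K n"] unfolding data \<nu>L by (simp add: norm_minus_commute)
      qed
      then show "\<exists>no. \<forall>n\<ge>no. norm (mderiv (\<nu> l) \<eta> (rvec (K n) /\<^sub>R 2 ^ n) - row_delta q k $ 1 $ l) < e"
        by blast
    qed
    have "mderiv (\<nu> l) \<eta> ?x = row_delta q k $ 1 $ l" using LIMSEQ_unique[OF l1 l2] .
    then show ?thesis
      unfolding \<eta>_eq mderiv_nth[OF Cm_mono[OF C \<nu>_le]] by (auto simp: delta_def axis_nth_if)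
  qed
  then have herm: "hermite_interpolant \<nu> \<tau> \<phi>" by (simp add: hermite_interpolant_def vec_eq_iff)
  obtain R where "supp_ball R \<phi>" using basis_vector_function_supp_ball[OF mask basis] by blast
  then have "hermite_system m \<nu> \<tau> a \<phi> R"
    by (intro hermite_system.intro \<nu>_le mask C basis_vector_function_refinable[OF mask basis] herm)
  then show ?thesis by blast
qed

section \<open>Integrals over the unit cube\<close>

lemma integrable_supp_ball:
  fixes g :: "real^'d \<Rightarrow> complex"
  assumes "continuous_on UNIV g" "supp_ball R g"
  shows "integrable lborel g"
proof -
  have "integrable lborel (\<lambda>x. indicator (cball 0 R) x *\<^sub>R g x)"
    using assms(1) by (intro borel_integrable_compact) (auto intro: continuous_on_subset)
  moreover have "(\<lambda>x. indicator (cball 0 R) x *\<^sub>R g x) = g"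
    using supp_ballD[OF assms(2)] by (auto simp: fun_eq_iff indicator_def not_le)
  ultimately show ?thesis by simp
qed

lemma integral_translate:
  fixes g :: "real^'d \<Rightarrow> complex"
  assumes "g \<in> borel_measurable borel"
  shows "(LINT x|lborel. g (x + c)) = (LINT x|lborel. g x)"
proof -
  have "(LINT x|lborel. g x) = (LINT x|distr lborel borel ((+) c). g x)"
    by (simp only: lborel_distr_plus)
  also have "\<dots> = (LINT x|lborel. g (c + x))"
    by (rule integral_distr) (use assms in auto)
  finally show ?thesis by (simp add: add.commute)
qed

text \<open>Half-open, so that its integer translates tile the space and each x lies in exactly one
  of them, without an exceptional null set.\<close>

definition unit_cube :: "(real^'d) set" where
  "unit_cube = {x. \<forall>i. 0 \<le> x $ i \<and> x $ i < 1}"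

lemma unit_cube_measurable [measurable]: "unit_cube \<in> sets borel"
proof -
  have eq: "unit_cube = (\<Inter>i::'a. {x. 0 \<le> x $ i} \<inter> {x. x $ i < 1})" by (auto simp: unit_cube_def)
  have "{x::real^'a. 0 \<le> x $ i} \<in> sets borel" for i
    by (intro borel_closed closed_Collect_le continuous_intros)
  moreover have "{x::real^'a. x $ i < 1} \<in> sets borel" for i
    by (intro borel_open open_Collect_less continuous_intros)
  ultimately show ?thesis unfolding eq by (intro sets.finite_INT sets.Int) simp_all
qed

lemma unit_cube_subset: "unit_cube \<subseteq> (cbox 0 1 :: (real^'d) set)"
  by (auto simp: unit_cube_def mem_box_cart) (metis less_imp_le)

lemma box_unit_cube: "x \<in> box 0 1 \<Longrightarrow> x \<in> unit_cube"
  by (simp add: unit_cube_def mem_box_cart less_imp_le)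

lemma unit_cube_norm: "x \<in> unit_cube \<Longrightarrow> norm (x :: real^'d) \<le> real CARD('d)"
proof -
  assume x: "x \<in> unit_cube"
  have "norm x \<le> (\<Sum>i\<in>UNIV. \<bar>x $ i\<bar>)" by (rule norm_le_l1_cart)
  also have "\<dots> \<le> (\<Sum>i\<in>(UNIV :: 'd set). 1)"
    using x by (intro sum_mono) (auto simp: unit_cube_def less_imp_le)
  finally show ?thesis by simp
qed

lemma integrable_unit_cube:
  fixes g :: "real^'d \<Rightarrow> complex"
  assumes "continuous_on UNIV g"
  shows "integrable lborel (\<lambda>x. indicator unit_cube x *\<^sub>R g x)"
proof -
  have "integrable lborel (\<lambda>x. indicator (cbox 0 1) x *\<^sub>R g x)"
    using assms by (intro borel_integrable_compact) (auto intro: continuous_on_subset)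
  then have "integrable lborel (\<lambda>x. indicator unit_cube x *\<^sub>R (indicator (cbox 0 1) x *\<^sub>R g x))"
    by (rule integrable_mult_indicator[rotated]) simp
  moreover have "(\<lambda>x. indicator unit_cube x *\<^sub>R (indicator (cbox 0 1) x *\<^sub>R g x))
      = (\<lambda>x. indicator unit_cube x *\<^sub>R g x)"
    using unit_cube_subset by (auto simp: fun_eq_iff indicator_def)
  ultimately show ?thesis by simp
qed

lemma floor_in_unit_cube: "x + rvec k \<in> unit_cube \<longleftrightarrow> k = - ivec x"
proof -
  have "0 \<le> a + real_of_int z \<and> a + real_of_int z < 1 \<longleftrightarrow> z = - \<lfloor>a\<rfloor>" for a z
    using floor_eq_iff[of a "- z"] by auto
  then show ?thesis by (auto simp: unit_cube_def vec_eq_iff ivec_def)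
qed

text \<open>The space is cut into translates of the cube and every piece is moved back. Only
  translates meeting the ball of radius R count, which bounds k by d + R.\<close>

lemma integral_periodize:
  fixes g :: "real^'d \<Rightarrow> complex"
  assumes cont: "continuous_on UNIV g" and supp: "supp_ball R g"
    and F: "finite F" "\<And>k. norm (rvec k) \<le> real CARD('d) + R \<Longrightarrow> k \<in> F"
  shows "(LINT x|lborel. g x) = (LINT x|lborel. indicator unit_cube x *\<^sub>R (\<Sum>k\<in>F. g (x - rvec k)))"
proof -
  have gm: "g \<in> borel_measurable borel" using cont by (rule borel_measurable_continuous_onI)
  have ct: "continuous_on UNIV (\<lambda>x. g (x - c))" for c
    by (rule continuous_on_compose2[OF cont]) (auto intro!: continuous_intros)
  have int: "integrable lborel (\<lambda>x. indicator unit_cube (x + c) *\<^sub>R g x)" for c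
  proof (rule Bochner_Integration.integrable_bound[OF integrable_supp_ball[OF cont supp]])
    show "(\<lambda>x. indicator unit_cube (x + c) *\<^sub>R g x) \<in> borel_measurable lborel"
      using gm by measurable
  qed (auto simp: indicator_def)
  have "(LINT x|lborel. g x) = (LINT x|lborel. (\<Sum>k\<in>F. indicator unit_cube (x + rvec k) *\<^sub>R g x))"
  proof (rule Bochner_Integration.integral_cong[OF refl])
    fix x
    show "g x = (\<Sum>k\<in>F. indicator unit_cube (x + rvec k) *\<^sub>R g x)"
    proof (cases "g x = 0")
      case False
      then have x: "norm x \<le> R" using supp_ballD[OF supp] not_less by blast
      have "x + rvec (- ivec x) \<in> unit_cube" unfolding floor_in_unit_cube ..
      then have "norm (x + rvec (- ivec x)) \<le> real CARD('d)" by (rule unit_cube_norm)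
      then have "norm (rvec (- ivec x)) \<le> real CARD('d) + R"
        using x norm_triangle_ineq4[of "x + rvec (- ivec x)" x] by simp
      then have mem: "- ivec x \<in> F" by (rule F(2))
      have "(\<Sum>k\<in>F. indicator unit_cube (x + rvec k) *\<^sub>R g x) = (\<Sum>k\<in>F. if k = - ivec x then g x else 0)"
        by (rule sum.cong) (auto simp: indicator_def floor_in_unit_cube)
      also have "\<dots> = g x" using F(1) mem by simp
      finally show ?thesis ..
    qed simp
  qed
  also have "\<dots> = (\<Sum>k\<in>F. LINT x|lborel. indicator unit_cube (x + rvec k) *\<^sub>R g x)"
    by (rule Bochner_Integration.integral_sum) (rule int)
  also have "\<dots> = (\<Sum>k\<in>F. LINT x|lborel. indicator unit_cube x *\<^sub>R g (x - rvec k))"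
  proof (rule sum.cong[OF refl])
    fix k
    have "(\<lambda>x. indicator unit_cube x *\<^sub>R g (x - rvec k)) \<in> borel_measurable borel"
      using borel_measurable_continuous_onI[OF ct] by measurable
    from integral_translate[OF this, of "rvec k"]
    show "(LINT x|lborel. indicator unit_cube (x + rvec k) *\<^sub>R g x)
        = (LINT x|lborel. indicator unit_cube x *\<^sub>R g (x - rvec k))" by simp
  qed
  also have "\<dots> = (LINT x|lborel. (\<Sum>k\<in>F. indicator unit_cube x *\<^sub>R g (x - rvec k)))"
    by (rule Bochner_Integration.integral_sum[symmetric]) (rule integrable_unit_cube[OF ct])
  finally show ?thesis by (simp add: scaleR_sum_right)
qed

section \<open>Uniqueness of Fourier coefficients\<close>

text \<open>The sign makes the integral of a function against it the Fourier transform at 2 pi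
  k.\<close>

definition character :: "int^'d \<Rightarrow> real^'d \<Rightarrow> complex" where
  "character k x = exp (- \<i> * of_real (2 * pi * (rvec k \<bullet> x)))"

lemma character_add: "character (k + j) x = character k x * character j x"
  by (simp add: character_def rvec_add inner_add_left algebra_simps flip: exp_add)

lemma character_0 [simp]: "character 0 x = 1"
  by (simp add: character_def)

lemma continuous_character: "continuous_on S (character k)"
  unfolding character_def by (intro continuous_intros)

lemma rvec_axis: "rvec (axis i z) = axis i (real_of_int z)"
  by (simp add: vec_eq_iff axis_def)

lemma character_translate: "character k (x + rvec j) = character k x"
proof -
  define z where "z = (\<Sum>i\<in>UNIV. k $ i * j $ i)"
  have "rvec k \<bullet> rvec j = real_of_int z"
    by (simp add: inner_vec_def z_def)
  then have "exp (- \<i> * of_real (2 * pi * (rvec k \<bullet> rvec j))) = exp ((2 * of_int (- z) * pi) * \<i>)"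
    by (simp add: mult_ac)
  also have "\<dots> = 1"
    by (rule exp_integer_2pi) simp
  finally have "exp (- \<i> * of_real (2 * pi * (rvec k \<bullet> rvec j))) = 1" .
  moreover have "character k (x + rvec j) = character k x * exp (- \<i> * of_real (2 * pi * (rvec k \<bullet> rvec j)))"
    unfolding character_def exp_add[symmetric] by (simp add: inner_add_right algebra_simps)
  ultimately show ?thesis by simp
qed

lemma ivec_frac: "x - rvec (ivec x) \<in> unit_cube"
  using floor_in_unit_cube[of x "- ivec x"] by (simp add: rvec_minus)

text \<open>An embedding of the quotient by the integer lattice as a compact set whose points are
  separated by the real and imaginary parts of coordinates.\<close>

definition torus_map :: "real^'d \<Rightarrow> complex^'d" where
  "torus_map x = (\<chi> i. cis (2 * pi * x $ i))"

lemma torus_map_translate: "torus_map (x + rvec k) = torus_map x"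
proof -
  have "cis (2 * pi * (x $ i + real_of_int (k $ i))) = cis (2 * pi * x $ i)" for i
    using cis_multiple_2pi[of "real_of_int (k $ i)"] by (simp add: distrib_left flip: cis_mult)
  then show ?thesis by (simp add: torus_map_def)
qed

lemma torus_map_eqD:
  assumes "torus_map x = torus_map y"
  shows "\<exists>k. y = x + rvec k"
proof -
  have "\<exists>n::int. y $ i = x $ i + of_int n" for i
  proof -
    have "cis (2 * pi * x $ i) = cis (2 * pi * y $ i)"
      using assms by (simp add: torus_map_def vec_eq_iff)
    then have "cos (2 * pi * y $ i - 2 * pi * x $ i) = 1"
      by (metis cis_divide cis_neq_zero complex.sel(1) divide_self_if cis.code one_complex.sel(1))
    then obtain n :: int where "2 * pi * y $ i - 2 * pi * x $ i = of_int n * 2 * pi"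
      by (auto simp: cos_one_2pi_int)
    then have "2 * pi * (y $ i) = 2 * pi * (x $ i + of_int n)" by (simp add: algebra_simps)
    then show ?thesis by (intro exI[of _ n]) simp
  qed
  then obtain n :: "'a \<Rightarrow> int" where "\<And>i. y $ i = x $ i + of_int (n i)" by metis
  then have "y = x + rvec (\<chi> i. n i)" by (simp add: vec_eq_iff)
  then show ?thesis by blast
qed

lemma continuous_torus_map: "continuous_on S torus_map"
  unfolding torus_map_def by (intro continuous_on_vec_lambda continuous_intros)

lemma torus_map_cube: "range torus_map = torus_map ` (cbox 0 1 :: (real^'d) set)"
proof
  show "range torus_map \<subseteq> torus_map ` (cbox 0 1 :: (real^'d) set)"
  proof
    fix z :: "complex^'d" assume "z \<in> range torus_map"
    then obtain x where x: "z = torus_map x" by auto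
    have "torus_map x = torus_map (x - rvec (ivec x))"
      using torus_map_translate[of "x - rvec (ivec x)" "ivec x"] by simp
    moreover have "x - rvec (ivec x) \<in> cbox 0 1" using ivec_frac unit_cube_subset by blast
    ultimately show "z \<in> torus_map ` cbox 0 1" using x by blast
  qed
qed auto

text \<open>V is defined by choosing preimages. Its continuity comes from the closed graph criterion
  for maps into a compact set: the graph is a continuous image of the closed unit cube.\<close>

lemma periodic_factor_torus:
  fixes v :: "real^'d \<Rightarrow> real"
  assumes cont: "continuous_on UNIV v" and per: "\<And>x k. v (x + rvec k) = v x"
  obtains V where "continuous_on (range (torus_map :: real^'d \<Rightarrow> _)) V" "\<And>x. V (torus_map x) = v x"
proof -
  define V where "V z = v (SOME x. torus_map x = z)" for z
  have V: "V (torus_map x) = v x" for x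
  proof -
    have "torus_map (SOME y. torus_map y = torus_map x) = torus_map x" by (rule someI) simp
    then obtain k where "x = (SOME y. torus_map y = torus_map x) + rvec k" using torus_map_eqD by blast
    then show ?thesis unfolding V_def using per by metis
  qed
  let ?Q = "cbox 0 1 :: (real^'d) set"
  have graph: "(\<lambda>z. (z, V z)) ` range torus_map = (\<lambda>x. (torus_map x, v x)) ` ?Q"
    unfolding torus_map_cube image_image V ..
  have "continuous_on (range torus_map) V"
  proof (rule continuous_from_closed_graph)
    show "compact (v ` ?Q)"
      by (rule compact_continuous_image) (auto intro: continuous_on_subset[OF cont])
    show "V \<in> range torus_map \<rightarrow> v ` ?Q" unfolding torus_map_cube using V by auto
    show "closed ((\<lambda>z. (z, V z)) ` range torus_map)"
      unfolding graph
      by (intro compact_imp_closed compact_continuous_image continuous_on_Pair continuous_torus_map)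
         (auto intro: continuous_on_subset[OF cont])
  qed
  with V show thesis using that by blast
qed

text \<open>The functions whose product with any function orthogonal to all \<open>G * character k\<close> is again
  orthogonal to them form an algebra that contains the trigonometric polynomials, so that the
  Stone--Weierstrass theorem on the torus applies to it.\<close>

lemma periodic_orthogonal_stable:
  fixes G :: "real^'d \<Rightarrow> complex" and v :: "real^'d \<Rightarrow> real"
  assumes contG: "continuous_on UNIV G"
    and orth: "\<And>k. (LINT x|lborel. indicator unit_cube x *\<^sub>R (G x * character k x)) = 0"
    and contv: "continuous_on UNIV v" and per: "\<And>x k. v (x + rvec k) = v x"
  shows "(LINT x|lborel. indicator unit_cube x *\<^sub>R (G x * of_real (v x))) = 0"
proof -
  define I where "I h = (LINT x|lborel. indicator unit_cube x *\<^sub>R (h x :: complex))" for h :: "real^'d \<Rightarrow> complex"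
  define good where "good h \<longleftrightarrow> continuous_on UNIV h \<and> (\<forall>k. I (\<lambda>x. G x * h x * character k x) = 0)" for h
  define stab where "stab p \<longleftrightarrow> continuous_on UNIV p \<and> (\<forall>h. good h \<longrightarrow> good (\<lambda>x. h x * p x))" for p
  have I_add: "I (\<lambda>x. f x + g x) = I f + I g" if "continuous_on UNIV f" "continuous_on UNIV g" for f g
    unfolding I_def scaleR_add_right
    by (rule Bochner_Integration.integral_add) (rule integrable_unit_cube that)+
  have I_cmult: "I (\<lambda>x. c * f x) = c * I f" if "continuous_on UNIV f" for f c
  proof -
    have "I (\<lambda>x. c * f x) = (LINT x|lborel. c * (indicator unit_cube x *\<^sub>R f x))"
      unfolding I_def by (simp add: mult_ac)
    also have "\<dots> = c * I f" unfolding I_def by (rule Bochner_Integration.integral_mult_right) (rule integrable_unit_cube[OF that])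
    finally show ?thesis .
  qed
  note cont = contG continuous_character
  have good_add: "good (\<lambda>x. f x + g x)" if "good f" "good g" for f g
    using that I_add unfolding good_def
    by (simp add: ring_distribs continuous_on_add continuous_on_mult cont)
  have good_cmult: "good (\<lambda>x. c * f x)" if "good f" for f c
  proof -
    have "I (\<lambda>x. G x * (c * f x) * character k x) = c * I (\<lambda>x. G x * f x * character k x)" for k
      using that I_cmult[of "\<lambda>x. G x * f x * character k x" c] unfolding good_def
      by (simp add: continuous_on_mult cont mult_ac)
    with that show ?thesis unfolding good_def by (simp add: continuous_on_mult_left)
  qed
  have stab_const: "stab (\<lambda>x. c)" for c
    using good_cmult[of _ c] by (simp add: stab_def mult.commute[of _ c])
  have stab_add: "stab (\<lambda>x. p x + q x)" if "stab p" "stab q" for p q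
    using that good_add unfolding stab_def by (simp add: distrib_left continuous_on_add)
  have stab_mult: "stab (\<lambda>x. p x * q x)" if "stab p" "stab q" for p q
    using that unfolding stab_def by (simp add: continuous_on_mult) (metis (no_types, lifting) mult.assoc ext)
  have stab_char: "stab (character k)" for k
    unfolding stab_def good_def
    by (simp add: continuous_on_mult cont) (metis (no_types, lifting) mult.assoc character_add ext)
  have stab_cos: "stab (\<lambda>x. of_real (Re (torus_map x $ i)))" for i
  proof -
    have "(\<lambda>x. (1/2) * character (axis i 1) x + (1/2) * character (- axis i 1) x)
        = (\<lambda>x. complex_of_real (Re (torus_map x $ i)))"
      by (auto simp: fun_eq_iff character_def rvec_minus rvec_axis inner_axis' torus_map_def complex_eq_iff Re_exp Im_exp)
    moreover have "stab (\<lambda>x. (1/2) * character (axis i 1) x + (1/2) * character (- axis i 1) x)"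
      by (intro stab_add stab_mult stab_const stab_char)
    ultimately show ?thesis by simp
  qed
  have stab_sin: "stab (\<lambda>x. of_real (Im (torus_map x $ i)))" for i
  proof -
    have "(\<lambda>x. (\<i>/2) * character (axis i 1) x + (-\<i>/2) * character (- axis i 1) x)
        = (\<lambda>x. complex_of_real (Im (torus_map x $ i)))"
      by (auto simp: fun_eq_iff character_def rvec_minus rvec_axis inner_axis' torus_map_def complex_eq_iff Re_exp Im_exp)
    moreover have "stab (\<lambda>x. (\<i>/2) * character (axis i 1) x + (-\<i>/2) * character (- axis i 1) x)"
      by (intro stab_add stab_mult stab_const stab_char)
    ultimately show ?thesis by simp
  qed
  define T where "T = range (torus_map :: real^'d \<Rightarrow> _)"
  define \<R> where "\<R> = {f. continuous_on T f \<and> stab (\<lambda>x. of_real (f (torus_map x)))}"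
  interpret function_ring_on \<R> T
  proof
    show "compact T" unfolding T_def torus_map_cube
      by (intro compact_continuous_image continuous_torus_map compact_cbox)
    show "\<exists>f\<in>\<R>. f z \<noteq> f w" if zw: "z \<in> T" "w \<in> T" "z \<noteq> w" for z w
    proof -
      obtain i where "z $ i \<noteq> w $ i" using zw(3) unfolding vec_eq_iff by blast
      then consider "Re (z $ i) \<noteq> Re (w $ i)" | "Im (z $ i) \<noteq> Im (w $ i)" by (auto simp: complex_eq_iff)
      then show ?thesis
      proof cases
        case 1
        then show ?thesis
          by (intro bexI[of _ "\<lambda>z. Re (z $ i)"]) (auto simp: \<R>_def stab_cos intro!: continuous_intros)
      next
        case 2
        then show ?thesis
          by (intro bexI[of _ "\<lambda>z. Im (z $ i)"]) (auto simp: \<R>_def stab_sin intro!: continuous_intros)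
      qed
    qed
  qed (auto simp: \<R>_def stab_const stab_add stab_mult intro: continuous_intros)
  obtain V where V: "continuous_on T V" "\<And>x. V (torus_map x) = v x"
    using periodic_factor_torus[OF contv per] unfolding T_def by metis
  \<comment> \<open>The function 1 is good by \<open>orth\<close>; multiplying it by a stable p and
    taking the trivial character shows that the integral of G * p vanishes.\<close>
  have good1: "good (\<lambda>x. 1)" using orth by (simp add: good_def I_def)
  have cG: "continuous_on UNIV (\<lambda>x. complex_of_real (cmod (G x)))" by (intro continuous_intros contG)
  define B where "B = (LINT x|lborel. indicator unit_cube x *\<^sub>R (cmod (G x)))"
  have intB: "integrable lborel (\<lambda>x. indicator unit_cube x *\<^sub>R (cmod (G x)))"
    using integrable_norm[OF integrable_unit_cube[OF contG]] by simp
  have B0: "0 \<le> B" unfolding B_def by (rule integral_nonneg_AE) auto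
  have bound: "norm (I (\<lambda>x. G x * of_real (v x))) \<le> e * B" if e: "e > 0" for e
  proof -
    obtain f where f: "f \<in> \<R>" "\<And>z. z \<in> T \<Longrightarrow> \<bar>V z - f z\<bar> < e"
      using Stone_Weierstrass_basic[OF V(1) e] by blast
    define p where "p x = complex_of_real (f (torus_map x))" for x
    have p: "stab p" using f(1) by (simp add: \<R>_def p_def[abs_def])
    then have "good (\<lambda>x. 1 * p x)" using good1 unfolding stab_def by blast
    then have Ip: "I (\<lambda>x. G x * p x) = 0"
      unfolding good_def by (metis (no_types, lifting) character_0 mult.right_neutral mult_1 ext)
    have cp: "continuous_on UNIV p" using p by (simp add: stab_def)
    have c1: "continuous_on UNIV (\<lambda>x. G x * of_real (v x))" by (intro continuous_intros contG contv)
    have c2: "continuous_on UNIV (\<lambda>x. G x * p x)" by (intro continuous_intros contG cp)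
    have c3: "continuous_on UNIV (\<lambda>x. G x * (of_real (v x) - p x))" by (intro continuous_intros contG contv cp)
    have "I (\<lambda>x. G x * of_real (v x)) = I (\<lambda>x. G x * (of_real (v x) - p x) + G x * p x)"
      by (simp add: algebra_simps)
    also have "\<dots> = I (\<lambda>x. G x * (of_real (v x) - p x))" using I_add[OF c3 c2] Ip by simp
    also have "norm \<dots> \<le> (LINT x|lborel. e * (indicator unit_cube x *\<^sub>R (cmod (G x))))"
      unfolding I_def
    proof (rule order_trans[OF integral_norm_bound], rule Bochner_Integration.integral_mono)
      show "integrable lborel (\<lambda>x. norm (indicator unit_cube x *\<^sub>R (G x * (of_real (v x) - p x))))"
        by (intro integrable_norm integrable_unit_cube[OF c3])
      show "integrable lborel (\<lambda>x. e * (indicator unit_cube x *\<^sub>R (cmod (G x))))"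
        by (intro integrable_mult_right intB)
      fix x :: "real^'d"
      have "cmod (of_real (v x) - p x) \<le> e"
        using f(2)[of "torus_map x"] unfolding T_def p_def V(2)
        by (metis less_imp_le norm_of_real of_real_diff rangeI)
      then show "norm (indicator unit_cube x *\<^sub>R (G x * (of_real (v x) - p x)))
          \<le> e * (indicator unit_cube x *\<^sub>R (cmod (G x)))"
        by (auto simp: indicator_def norm_mult mult.commute[of e] intro!: mult_left_mono)
    qed
    also have "\<dots> = e * B" unfolding B_def by simp
    finally show ?thesis .
  qed
  have "norm (I (\<lambda>x. G x * of_real (v x))) \<le> 0"
  proof (rule field_le_epsilon)
    fix e :: real assume e: "e > 0"
    \<comment> \<open>Scaling by B + 1 instead of B avoids a division by 0 when G vanishes.\<close>
    have "norm (I (\<lambda>x. G x * of_real (v x))) \<le> e / (B + 1) * B" using bound[of "e / (B + 1)"] e B0 by simp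
    also have "\<dots> \<le> e" using e B0 by (simp add: field_simps)
    finally show "norm (I (\<lambda>x. G x * of_real (v x))) \<le> 0 + e" by simp
  qed
  then show ?thesis by (simp add: I_def)
qed

text \<open>The square vanishes almost everywhere on the cube; the exceptional set inside the open
  cube is open and null, hence empty. Closure and periodicity carry this to all points.\<close>

lemma periodic_zero_if_square_integral_zero:
  fixes v :: "real^'d \<Rightarrow> real"
  assumes cont: "continuous_on UNIV v" and per: "\<And>x k. v (x + rvec k) = v x"
    and zero: "(LINT x|lborel. indicator unit_cube x *\<^sub>R (v x * v x)) = 0"
  shows "v x = 0"
proof -
  have c: "continuous_on UNIV (\<lambda>x. complex_of_real (v x * v x))" by (intro continuous_intros cont)
  have "integrable lborel (\<lambda>x. Re (indicator unit_cube x *\<^sub>R complex_of_real (v x * v x)))"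
    by (rule integrable_Re[OF integrable_unit_cube[OF c]])
  then have int: "integrable lborel (\<lambda>x. indicator unit_cube x *\<^sub>R (v x * v x))" by simp
  have "AE x in lborel. indicator unit_cube x *\<^sub>R (v x * v x) = 0"
    using zero by (subst (asm) integral_nonneg_eq_0_iff_AE[OF int]) auto
  then have ae: "AE x in lborel. \<not> (x \<in> box 0 1 \<and> v x \<noteq> 0)"
    by (rule AE_mp) (auto intro!: AE_I2 simp: indicator_def box_unit_cube)
  let ?U = "{x \<in> box 0 (1::real^'d). v x \<noteq> 0}"
  have "open (box 0 1 \<inter> v -` (- {0}))"
    using cont by (intro open_Int open_box open_vimage) auto
  moreover have "box 0 1 \<inter> v -` (- {0}) = ?U" by auto
  ultimately have op: "open ?U" by simp
  have "?U \<in> null_sets lborel"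
    using ae op by (subst AE_iff_null_sets) auto
  then have "negligible ?U"
    by (simp add: negligible_iff_null_sets null_sets_completionI)
  then have "?U = {}" using open_not_negligible[OF op] by blast
  then have z: "v y = 0" if "y \<in> box 0 1" for y using that by auto
  have ne: "box 0 (1::real^'d) \<noteq> {}"
  proof -
    have "(\<chi> i. 1/2) \<in> box 0 (1::real^'d)" by (simp add: mem_box_cart)
    then show ?thesis by blast
  qed
  have "v y = 0" if "y \<in> closure (box 0 1)" for y
    using continuous_constant_on_closure[of "box 0 1" v 0 y] z that continuous_on_subset[OF cont] by auto
  then have z': "v y = 0" if "y \<in> unit_cube" for y
    using that unit_cube_subset closure_box[OF ne] by auto
  have "v x = v (x - rvec (ivec x))" using per[of "x - rvec (ivec x)" "ivec x"] by simp
  then show ?thesis using z'[OF ivec_frac] by simp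
qed

text \<open>Orthogonality extends from characters to all continuous periodic real v. The choices v =
  Re G and v = Im G give the integrals of the squares of Re G and Im G.\<close>

lemma fourier_coefficients_unique:
  fixes G :: "real^'d \<Rightarrow> complex"
  assumes cont: "continuous_on UNIV G" and per: "\<And>x k. G (x + rvec k) = G x"
    and orth: "\<And>k. (LINT x|lborel. indicator unit_cube x *\<^sub>R (G x * character k x)) = 0"
  shows "G x = 0"
proof -
  have z: "(LINT x|lborel. indicator unit_cube x *\<^sub>R (G x * of_real (v x))) = 0"
    if "continuous_on UNIV v" "\<And>x k. v (x + rvec k) = v x" for v
    by (rule periodic_orthogonal_stable[OF cont orth that])
  have cRe: "continuous_on UNIV (\<lambda>x. Re (G x))" and cIm: "continuous_on UNIV (\<lambda>x. Im (G x))"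
    by (intro continuous_intros cont)+
  have int: "integrable lborel (\<lambda>x. indicator unit_cube x *\<^sub>R (G x * of_real (v x)))"
    if "continuous_on UNIV v" for v
    by (rule integrable_unit_cube) (intro continuous_intros cont that)
  have "(LINT x|lborel. indicator unit_cube x *\<^sub>R (Re (G x) * Re (G x))) = Re 0"
    using integral_Re[OF int[OF cRe]] z[OF cRe] per by simp
  then have "Re (G x) = 0"
    by (intro periodic_zero_if_square_integral_zero[OF cRe]) (simp_all add: per)
  moreover have "(LINT x|lborel. indicator unit_cube x *\<^sub>R (Im (G x) * Im (G x))) = Im 0"
    using integral_Im[OF int[OF cIm]] z[OF cIm] per by simp
  then have "Im (G x) = 0"
    by (intro periodic_zero_if_square_integral_zero[OF cIm]) (simp_all add: per)
  ultimately show ?thesis by (simp add: complex_eq_iff)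
qed

section \<open>Fourier transforms of compactly supported functions\<close>

text \<open>Unlike \<open>character\<close> it carries an arbitrary real frequency. Both arguments
  serve as the variable: x in Fourier transforms, and the frequency \<xi> in the Fourier series of
  filters.\<close>

definition wave :: "real^'d \<Rightarrow> real^'d \<Rightarrow> complex" where
  "wave \<rho> x = exp (\<i> * complex_of_real (\<rho> \<bullet> x))"

lemma wave_add_left: "wave (\<rho> + \<sigma>) x = wave \<rho> x * wave \<sigma> x"
  by (simp add: wave_def inner_add_left distrib_left flip: exp_add)

lemma wave_0 [simp]: "wave 0 x = 1" "wave \<rho> 0 = 1"
  by (simp_all add: wave_def)

lemma norm_wave [simp]: "norm (wave \<rho> x) = 1"
  by (simp add: wave_def)

lemma continuous_wave: "continuous_on S (wave \<rho>)" "continuous_on S (\<lambda>\<rho>. wave \<rho> x)"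
  unfolding wave_def by (intro continuous_intros)+

lemma has_pd_wave: "has_pd i (wave \<rho>) (\<lambda>x. (\<i> * of_real (\<rho> $ i)) * wave \<rho> x)"
  unfolding has_pd_def
proof
  fix x :: "real^'a"
  have "((\<lambda>t. exp (\<i> * complex_of_real (\<rho> \<bullet> x)) * exp (\<i> * complex_of_real (\<rho> $ i) * complex_of_real t))
      has_vector_derivative
      (exp (\<i> * complex_of_real (\<rho> \<bullet> x)) * (\<i> * complex_of_real (\<rho> $ i)))) (at 0)"
    by (rule has_vector_derivative_eq_rhs, rule has_vector_derivative_real_field)
       (auto intro!: derivative_eq_intros)
  then show "((\<lambda>t. wave \<rho> (x + t *\<^sub>R axis i 1)) has_vector_derivative
      (\<i> * of_real (\<rho> $ i)) * wave \<rho> x) (at 0)"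
    by (simp add: wave_def inner_add_right inner_axis algebra_simps exp_add)
qed

lemma Cm_wave: "Cm m (\<lambda>x. c * wave \<rho> x)"
proof (rule Cm_family[where F = "range (\<lambda>c x. c * wave \<rho> x)"])
  fix f :: "real^'a \<Rightarrow> complex" and i assume "f \<in> range (\<lambda>c x. c * wave \<rho> x)"
  then obtain c where "f = (\<lambda>x. c * wave \<rho> x)" by auto
  then have "has_pd i f (\<lambda>x. c * ((\<i> * of_real (\<rho> $ i)) * wave \<rho> x))"
    using has_pd_linear[OF bounded_linear_mult_right has_pd_wave] by simp
  then show "\<exists>f'\<in>range (\<lambda>c x. c * wave \<rho> x). has_pd i f f'"
    by (auto simp: mult.assoc[symmetric])
qed (auto intro: continuous_intros continuous_wave)

lemma mpow_add_axis: "mpow x (\<mu> + axis i 1) = x $ i * mpow x \<mu>"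
proof -
  have "mpow x (\<mu> + axis i 1) = (\<Prod>j\<in>UNIV. x $ j ^ \<mu> $ j * (if j = i then x $ i else 1))"
    unfolding mpow_def by (rule prod.cong) (auto simp: axis_def)
  then show ?thesis by (simp add: prod.distrib mpow_def)
qed

lemma mpow_0 [simp]: "mpow x 0 = 1"
  by (simp add: mpow_def)

lemma mderiv_wave: "mderiv \<mu> (\<lambda>x. c * wave \<rho> x) = (\<lambda>x. c * (\<i> ^ mabs \<mu> * of_real (mpow \<rho> \<mu>)) * wave \<rho> x)"
proof (induction \<mu> arbitrary: c rule: multiindex_induct)
  case (add \<mu> i)
  have "mderiv (\<mu> + axis i 1) (\<lambda>x. c * wave \<rho> x) = mderiv \<mu> (partial_deriv i (\<lambda>x. c * wave \<rho> x))"
    by (rule mderiv_add_axis[OF Cm_wave])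
  also have "partial_deriv i (\<lambda>x. c * wave \<rho> x) = (\<lambda>x. c * ((\<i> * of_real (\<rho> $ i)) * wave \<rho> x))"
    by (rule has_pd_partial_deriv[OF has_pd_linear[OF bounded_linear_mult_right has_pd_wave]])
  also have "\<dots> = (\<lambda>x. (c * (\<i> * of_real (\<rho> $ i))) * wave \<rho> x)" by (simp add: mult_ac)
  also have "mderiv \<mu> \<dots> = (\<lambda>x. (c * (\<i> * of_real (\<rho> $ i))) * (\<i> ^ mabs \<mu> * of_real (mpow \<rho> \<mu>)) * wave \<rho> x)"
    by (rule add.IH)
  finally show ?case by (simp add: mpow_add_axis mult_ac power_add del: One_nat_def)
qed simp

definition sft :: "(real^'d \<Rightarrow> complex) \<Rightarrow> real^'d \<Rightarrow> complex" where
  "sft f \<xi> = (LINT x|lborel. f x * wave (- \<xi>) x)"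

lemma fourier_nth: "fourier \<phi> \<xi> $ j = sft (\<lambda>x. \<phi> x $ j) \<xi>"
  by (simp add: fourier_def sft_def wave_def inner_commute)

lemma supp_ball_mult: "supp_ball R f \<Longrightarrow> supp_ball R (\<lambda>x. f x * (g x :: complex))"
  by (simp add: supp_ball_def)

lemma supp_ball_nth: "supp_ball R \<phi> \<Longrightarrow> supp_ball R (\<lambda>x. \<phi> x $ j)"
  by (simp add: supp_ball_def)

lemma integrable_sft:
  assumes "continuous_on UNIV f" "supp_ball R f"
  shows "integrable lborel (\<lambda>x. f x * wave \<xi> x)"
  by (intro integrable_supp_ball[OF _ supp_ball_mult[OF assms(2)]] continuous_intros assms(1) continuous_wave)

lemma has_vector_derivative_quotient:
  assumes "(g has_vector_derivative g') (at (0::real))"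
  shows "((\<lambda>t. (g t - g 0) /\<^sub>R t) \<longlongrightarrow> g') (at 0)"
proof -
  have "((\<lambda>t. norm (g t - g 0 - t *\<^sub>R g') / norm t) \<longlongrightarrow> 0) (at 0)"
    using assms unfolding has_vector_derivative_def has_derivative_at by simp
  moreover have "\<forall>\<^sub>F t in at 0. norm (g t - g 0 - t *\<^sub>R g') / norm t = norm ((g t - g 0) /\<^sub>R t - g')"
  proof (rule eventually_at_filter[THEN iffD2], rule always_eventually, intro allI impI)
    fix t :: real assume t: "t \<noteq> 0"
    then have "(g t - g 0) /\<^sub>R t - g' = (g t - g 0 - t *\<^sub>R g') /\<^sub>R t"
      by (simp add: scaleR_diff_right)
    then show "norm (g t - g 0 - t *\<^sub>R g') / norm t = norm ((g t - g 0) /\<^sub>R t - g')"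
      by (simp add: divide_inverse mult.commute)
  qed
  ultimately have "((\<lambda>t. norm ((g t - g 0) /\<^sub>R t - g')) \<longlongrightarrow> 0) (at 0)"
    by (rule Lim_transform_eventually)
  then show ?thesis using LIM_zero_cancel tendsto_norm_zero_iff by blast
qed

text \<open>Difference quotients of g have integral 0 by translation invariance, and dominated
  convergence carries this to the derivative. Applied to a product with a wave it becomes
  integration by parts.\<close>

lemma integral_pd_zero:
  fixes g :: "real^'d \<Rightarrow> complex"
  assumes pd: "has_pd i g g'" and cont: "continuous_on UNIV g" "continuous_on UNIV g'"
    and supp: "supp_ball R g" "supp_ball R g'"
  shows "(LINT x|lborel. g' x) = 0"
proof -
  let ?e = "axis i 1 :: real^'d"
  have "bounded (g' ` cball 0 R)"
    by (intro compact_imp_bounded compact_continuous_image) (auto intro: continuous_on_subset[OF cont(2)])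
  then obtain M0 where M0: "\<And>x. x \<in> cball 0 R \<Longrightarrow> norm (g' x) \<le> M0"
    unfolding bounded_iff by blast
  \<comment> \<open>The maximum with 0 makes the bound valid outside the ball as well, where the
    derivative vanishes.\<close>
  define M where "M = max M0 0"
  have M: "norm (g' x) \<le> M" for x
    using M0[of x] supp_ballD[OF supp(2), of x] by (cases "norm x \<le> R") (auto simp: M_def)
  define t where "t n = 1 / real (Suc n)" for n
  have t: "0 < t n" "t n \<le> 1" for n by (auto simp: t_def)
  have tlim: "t \<longlonglongrightarrow> 0" unfolding t_def by (rule lim_1_over_n[THEN LIMSEQ_Suc])
  define s where "s n x = (g (x + t n *\<^sub>R ?e) - g x) /\<^sub>R t n" for n x
  have ct: "continuous_on UNIV (\<lambda>x. g (x + t n *\<^sub>R ?e))" for n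
    by (rule continuous_on_compose2[OF cont(1)]) (auto intro!: continuous_intros)
  have st: "supp_ball (R + 1) (\<lambda>x. g (x + t n *\<^sub>R ?e))" for n
    unfolding supp_ball_def
  proof (intro allI impI)
    fix x :: "real^'d" assume x: "R + 1 < norm x"
    have "norm x \<le> norm (x + t n *\<^sub>R ?e) + norm (t n *\<^sub>R ?e)"
      using norm_triangle_ineq4[of "x + t n *\<^sub>R ?e" "t n *\<^sub>R ?e"] by simp
    then have "R < norm (x + t n *\<^sub>R ?e)" using x t[of n] by simp
    then show "g (x + t n *\<^sub>R ?e) = 0" by (rule supp_ballD[OF supp(1)])
  qed
  have int0: "(LINT x|lborel. s n x) = 0" for n
  proof -
    have "(LINT x|lborel. s n x) = ((LINT x|lborel. g (x + t n *\<^sub>R ?e)) - (LINT x|lborel. g x)) /\<^sub>R t n"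
      unfolding s_def
      by (simp add: Bochner_Integration.integral_diff[OF integrable_supp_ball[OF ct st] integrable_supp_ball[OF cont(1) supp(1)]])
    also have "(LINT x|lborel. g (x + t n *\<^sub>R ?e)) = (LINT x|lborel. g x)"
      by (rule integral_translate) (rule borel_measurable_continuous_onI[OF cont(1)])
    finally show ?thesis by simp
  qed
  have "(\<lambda>n. LINT x|lborel. s n x) \<longlonglongrightarrow> (LINT x|lborel. g' x)"
  proof (rule Bochner_Integration.integral_dominated_convergence[where w = "\<lambda>x. indicator (cball 0 (R + 1)) x *\<^sub>R M"])
    show "g' \<in> borel_measurable lborel"
      using borel_measurable_continuous_onI[OF cont(2)] by simp
    show "s n \<in> borel_measurable lborel" for n
    proof -
      have "continuous_on UNIV (s n)" unfolding s_def[abs_def] by (intro continuous_intros ct cont)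
      then show ?thesis using borel_measurable_continuous_onI by auto
    qed
    show "integrable lborel (\<lambda>x. indicator (cball 0 (R + 1)) x *\<^sub>R M)"
      by (intro borel_integrable_compact) auto
    show "AE x in lborel. (\<lambda>n. s n x) \<longlonglongrightarrow> g' x"
    proof (rule AE_I2)
      fix x
      have "((\<lambda>u. (g (x + u *\<^sub>R ?e) - g (x + 0 *\<^sub>R ?e)) /\<^sub>R u) \<longlongrightarrow> g' x) (at 0)"
        by (rule has_vector_derivative_quotient) (use pd in \<open>simp add: has_pd_def\<close>)
      moreover have "filterlim t (at 0) sequentially"
        using tlim t(1) by (auto simp: filterlim_at eventually_sequentially less_imp_neq[THEN not_sym])
      ultimately have "((\<lambda>n. (g (x + t n *\<^sub>R ?e) - g (x + 0 *\<^sub>R ?e)) /\<^sub>R t n) \<longlongrightarrow> g' x) sequentially"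
        by (rule filterlim_compose)
      then show "(\<lambda>n. s n x) \<longlonglongrightarrow> g' x" by (simp add: s_def)
    qed
    show "AE x in lborel. norm (s n x) \<le> indicator (cball 0 (R + 1)) x *\<^sub>R M" for n
    proof (rule AE_I2)
      fix x
      have "norm (g (x + t n *\<^sub>R ?e) - g (x + 0 *\<^sub>R ?e)) \<le> M * \<bar>t n\<bar>"
        by (rule mvt_bound[where g = "\<lambda>u. g (x + u *\<^sub>R ?e)"]) (rule has_pd_line[OF pd], rule M)
      moreover have "norm (s n x) = norm (g (x + t n *\<^sub>R ?e) - g (x + 0 *\<^sub>R ?e)) / t n"
        using t(1)[of n] by (simp add: s_def divide_inverse mult.commute)
      ultimately have "norm (s n x) \<le> M" using t(1)[of n] by (simp add: divide_le_eq)
      moreover have "s n x = 0" if "R + 1 < norm x"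
        using supp_ballD[OF st that] supp_ballD[OF supp(1), of x] that by (simp add: s_def)
      ultimately show "norm (s n x) \<le> indicator (cball 0 (R + 1)) x *\<^sub>R M"
        by (cases "norm x \<le> R + 1") auto
    qed
  qed
  then show ?thesis by (simp add: int0 LIMSEQ_const_iff)
qed

lemma sft_pd:
  assumes "Cm 1 f" "supp_ball R f"
  shows "sft (partial_deriv i f) \<xi> = \<i> * of_real (\<xi> $ i) * sft f \<xi>"
proof -
  have f: "has_pd i f (partial_deriv i f)" using Cm_Suc_has_pd assms(1) by (metis One_nat_def)
  have c: "continuous_on UNIV f" by (rule Cm_continuous[OF assms(1)])
  have c': "continuous_on UNIV (partial_deriv i f)" using Cm_Suc_pd assms(1) Cm_continuous by (metis One_nat_def)
  have s': "supp_ball R (partial_deriv i f)"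
    unfolding supp_ball_def
  proof (intro allI impI)
    fix x :: "real^'a" assume "R < norm x"
    then have "partial_deriv i f x = partial_deriv i (\<lambda>x. 0) x"
      by (intro pd_local[of "{x. R < norm x}"])
         (auto intro: open_Collect_less continuous_intros supp_ballD[OF assms(2)])
    also have "partial_deriv i (\<lambda>x::real^'a. 0::complex) = (\<lambda>x. 0)"
      by (rule has_pd_partial_deriv[OF has_pd_const])
    finally show "partial_deriv i f x = 0" .
  qed
  let ?w = "wave (- \<xi>)"
  let ?c = "- (\<i> * of_real (\<xi> $ i))"
  have pd: "has_pd i (\<lambda>x. f x * ?w x) (\<lambda>x. f x * (?c * ?w x) + partial_deriv i f x * ?w x)"
    using has_pd_mult[OF f has_pd_wave[of i "- \<xi>"]] by simp
  have "(LINT x|lborel. f x * (?c * ?w x) + partial_deriv i f x * ?w x) = 0"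
  proof (rule integral_pd_zero[OF pd])
    show "supp_ball R (\<lambda>x. f x * (?c * ?w x) + partial_deriv i f x * ?w x)"
      using assms(2) s' by (simp add: supp_ball_def)
  qed (intro continuous_intros c c' continuous_wave supp_ball_mult assms(2))+
  moreover have "(LINT x|lborel. f x * (?c * ?w x) + partial_deriv i f x * ?w x)
      = (LINT x|lborel. ?c * (f x * ?w x)) + (LINT x|lborel. partial_deriv i f x * ?w x)"
    using Bochner_Integration.integral_add[OF integrable_mult_right[OF integrable_sft[OF c assms(2), of "- \<xi>"], of ?c] integrable_sft[OF c' s', of "- \<xi>"]]
    by (simp add: mult_ac)
  moreover have "(LINT x|lborel. ?c * (f x * ?w x)) = ?c * sft f \<xi>"
    unfolding sft_def by (rule Bochner_Integration.integral_mult_right) (rule integrable_sft[OF c assms(2)])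
  ultimately show ?thesis by (simp add: sft_def)
qed

lemma sft_mderiv:
  fixes f :: "real^'d::{finite,linorder} \<Rightarrow> complex"
  shows "Cm (mabs \<mu>) f \<Longrightarrow> supp_ball R f \<Longrightarrow> sft (mderiv \<mu> f) \<xi> = \<i> ^ mabs \<mu> * of_real (mpow \<xi> \<mu>) * sft f \<xi>"
proof (induction \<mu> rule: multiindex_induct)
  case (add \<mu> i)
  then have C: "Cm (Suc (mabs \<mu>)) f" by simp
  have C1: "Cm 1 (mderiv \<mu> f)" by (rule Cm_mderiv) (use C in simp)
  have "sft (mderiv (\<mu> + axis i 1) f) \<xi> = \<i> * of_real (\<xi> $ i) * sft (mderiv \<mu> f) \<xi>"
    unfolding mderiv_add_axis_left[OF C] by (rule sft_pd[OF C1 supp_ball_mderiv[OF add.prems(2)]])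
  also have "sft (mderiv \<mu> f) \<xi> = \<i> ^ mabs \<mu> * of_real (mpow \<xi> \<mu>) * sft f \<xi>"
    by (rule add.IH[OF Cm_SucD[OF C] add.prems(2)])
  finally show ?case by (simp add: mpow_add_axis power_add del: One_nat_def)
qed simp

text \<open>Guarantees that a transform that is nonzero somewhere is nonzero on an open set.\<close>

lemma continuous_sft:
  assumes "continuous_on UNIV f" "supp_ball R f"
  shows "continuous_on UNIV (sft f)"
proof -
  have "(\<lambda>n. sft f (X n)) \<longlonglongrightarrow> sft f \<xi>" if X: "X \<longlonglongrightarrow> \<xi>" for X \<xi>
    unfolding sft_def
  proof (rule Bochner_Integration.integral_dominated_convergence[where w = "\<lambda>x. norm (f x)"])
    have c: "continuous_on UNIV (\<lambda>x. f x * wave \<xi> x)" for \<xi>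
      by (intro continuous_intros assms continuous_wave)
    then show "(\<lambda>x. f x * wave (- \<xi>) x) \<in> borel_measurable lborel"
      and "(\<lambda>x. f x * wave (- X n) x) \<in> borel_measurable lborel" for n
      using borel_measurable_continuous_onI by auto
    show "integrable lborel (\<lambda>x. norm (f x))" by (intro integrable_norm integrable_supp_ball[OF assms])
    show "AE x in lborel. (\<lambda>n. f x * wave (- X n) x) \<longlonglongrightarrow> f x * wave (- \<xi>) x"
      unfolding wave_def by (intro AE_I2 tendsto_intros X)
    show "AE x in lborel. norm (f x * wave (- X n) x) \<le> norm (f x)" for n
      by (simp add: norm_mult)
  qed
  then show ?thesis
    by (simp add: continuous_on_eq_continuous_at continuous_at_sequentially comp_def)
qed

text \<open>If v lies outside the span, some linear map kills the span and fixes v; the row of its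
  matrix at a nonzero entry of v is a nonzero annihilator. The pairing is bilinear, without
  conjugation, to match row times column.\<close>

lemma span_UNIV_if_no_annihilator:
  fixes S :: "(complex^'r) set"
  assumes "\<And>c :: complex^'r. (\<And>v. v \<in> S \<Longrightarrow> (\<Sum>l\<in>UNIV. c $ l * v $ l) = 0) \<Longrightarrow> c = 0"
  shows "vec.span S = UNIV"
proof (rule ccontr)
  assume "vec.span S \<noteq> UNIV"
  then obtain v where v: "v \<notin> vec.span S" by auto
  obtain B where B: "B \<subseteq> S" "vec.independent B" "S \<subseteq> vec.span B"
    by (rule vec.maximal_independent_subset)
  have "vec.span S \<subseteq> vec.span B" using B(3) by (metis vec.span_mono vec.span_span)
  then have vB: "v \<notin> vec.span B" using B v vec.span_mono[OF B(1)] by blast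
  then have ind: "vec.independent (insert v B)" by (rule vec.independent_insertI[OF _ B(2)])
  obtain f :: "complex^'r \<Rightarrow> complex^'r" where f: "Vector_Spaces.linear (*s) (*s) f"
    and fx: "\<And>x. x \<in> insert v B \<Longrightarrow> f x = (if x = v then v else 0)"
    using vec.linear_independent_extend[OF ind, of "\<lambda>x. if x = v then v else 0"] by blast
  have "v \<noteq> 0" using vB vec.span_zero by metis
  then obtain j where j: "v $ j \<noteq> 0" by (auto simp: vec_eq_iff)
  have "v \<notin> B" using vB vec.span_base by metis
  obtain A where fmat: "\<And>x. f x = A *v x" using matrix_works[OF f] by metis
  define c where "c = A $ j"
  have c: "(\<Sum>l\<in>UNIV. c $ l * x $ l) = f x $ j" for x
    unfolding fmat c_def by (simp add: matrix_vector_mult_def)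
  have "f x = 0" if "x \<in> vec.span B" for x
    using that
  proof (induction rule: vec.span_induct_alt)
    case base
    then show ?case unfolding fmat by simp
  next
    case (step a x y)
    have "f x = 0" using fx[of x] step(1) \<open>v \<notin> B\<close> by auto
    then show ?case using step(2) unfolding fmat by (simp add: matrix_vector_right_distrib vec.scale)
  qed
  then have "(\<Sum>l\<in>UNIV. c $ l * x $ l) = 0" if "x \<in> S" for x using that B(3) unfolding c by auto
  then have "c = 0" by (rule assms)
  then have "f v $ j = 0" using c[of v] by simp
  then show False using fx[of v] j by simp
qed

text \<open>With constant coefficients the shift sum is the periodization of w \<phi>, so its
  Fourier coefficients are values of the transform of w \<phi> at 2 pi k.\<close>

lemma integral_shift_sum:
  fixes \<phi> :: "real^'d \<Rightarrow> complex^'r"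
  assumes cont: "continuous_on UNIV \<phi>" and supp: "supp_ball R \<phi>"
  shows "(LINT x|lborel. indicator unit_cube x *\<^sub>R (shift_sum \<phi> (\<lambda>_. w) x * character k x))
    = (LINT x|lborel. (w *v \<phi> x) $ 1 * character k x)"
proof -
  let ?g = "\<lambda>x. (w *v \<phi> x) $ 1 * character k x"
  let ?F = "{k :: int^'d. norm (rvec k) \<le> real CARD('d) + R}"
  have "continuous_on UNIV ?g"
    by (intro continuous_intros bounded_linear.continuous_on[OF bounded_linear_row] cont continuous_character)
  moreover have "supp_ball R ?g" using supp by (simp add: supp_ball_def row_mult)
  ultimately have "(LINT x|lborel. ?g x) = (LINT x|lborel. indicator unit_cube x *\<^sub>R (\<Sum>k\<in>?F. ?g (x - rvec k)))"
    by (rule integral_periodize[OF _ _ finite_lattice_ball]) simp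
  also have "\<dots> = (LINT x|lborel. indicator unit_cube x *\<^sub>R (shift_sum \<phi> (\<lambda>_. w) x * character k x))"
  proof (rule Bochner_Integration.integral_cong[OF refl])
    fix x :: "real^'d"
    show "indicator unit_cube x *\<^sub>R (\<Sum>k\<in>?F. ?g (x - rvec k))
        = indicator unit_cube x *\<^sub>R (shift_sum \<phi> (\<lambda>_. w) x * character k x)"
    proof (cases "x \<in> unit_cube")
      case True
      then have "norm x \<le> real CARD('d)" by (rule unit_cube_norm)
      then have "shift_sum \<phi> (\<lambda>_. w) x = (\<Sum>k\<in>?F. (w *v \<phi> (x - rvec k)) $ 1)"
        by (intro shift_sum_finite[OF supp finite_lattice_ball]) auto
      moreover have "character k (x - rvec j) = character k x" for j
        using character_translate[of k "x - rvec j" j] by simp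
      ultimately show ?thesis by (simp add: sum_distrib_right)
    qed simp
  qed
  finally show ?thesis ..
qed

text \<open>The normalization of a matching filter at frequency 0 thereby becomes a mean over the
  unit cube, which can be evaluated once the shift sum is known to be constant.\<close>

lemma row_fourier_0:
  fixes \<phi> :: "real^'d \<Rightarrow> complex^'r"
  assumes cont: "continuous_on UNIV \<phi>" and supp: "supp_ball R \<phi>"
  shows "(w *v fourier \<phi> 0) $ 1 = (LINT x|lborel. indicator unit_cube x *\<^sub>R shift_sum \<phi> (\<lambda>_. w) x)"
proof -
  have int: "integrable lborel (\<lambda>x. w $ 1 $ l * \<phi> x $ l)" for l
    by (intro integrable_mult_right integrable_supp_ball[OF _ supp_ball_nth[OF supp]] continuous_intros cont)
  have "(LINT x|lborel. indicator unit_cube x *\<^sub>R shift_sum \<phi> (\<lambda>_. w) x) = (LINT x|lborel. (w *v \<phi> x) $ 1)"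
    using integral_shift_sum[OF cont supp, of w 0] by simp
  also have "\<dots> = (\<Sum>l\<in>UNIV. LINT x|lborel. w $ 1 $ l * \<phi> x $ l)"
    unfolding row_mult by (rule Bochner_Integration.integral_sum) (rule int)
  also have "\<dots> = (w *v fourier \<phi> 0) $ 1"
    unfolding row_mult fourier_nth sft_def by simp
  finally show ?thesis ..
qed

text \<open>The half-open cube lies between the open and the closed unit box, both of measure
  1.\<close>

lemma integral_unit_cube_const: "(LINT x|lborel. indicator unit_cube (x :: real^'d) *\<^sub>R (c :: complex)) = c"
proof -
  have cont: "continuous_on UNIV (\<lambda>x :: real^'d. c)" by simp
  have Q: "unit_cube = cbox 0 (1 :: real^'d) - (cbox 0 1 - unit_cube)" using unit_cube_subset by auto
  have m1: "emeasure lborel (unit_cube :: (real^'d) set) \<le> emeasure lborel (cbox 0 (1 :: real^'d))"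
    by (rule emeasure_mono[OF unit_cube_subset]) simp
  have m2: "emeasure lborel (box 0 (1 :: real^'d)) \<le> emeasure lborel (unit_cube :: (real^'d) set)"
    by (rule emeasure_mono) (auto intro: box_unit_cube)
  have eq1: "(1::real^'d) \<bullet> b = 1" if "b \<in> Basis" for b
    using that by (auto simp: Basis_vec_def inner_axis)
  have "emeasure lborel (cbox 0 (1 :: real^'d)) = 1"
    by (subst emeasure_lborel_cbox) (auto simp: eq1)
  moreover have "emeasure lborel (box 0 (1 :: real^'d)) = 1"
    by (subst emeasure_lborel_box) (auto simp: eq1)
  ultimately have "emeasure lborel (unit_cube :: (real^'d) set) = 1" using m1 m2 by auto
  then have "measure lborel (unit_cube :: (real^'d) set) = 1" by (simp add: measure_def)
  then show ?thesis using \<open>emeasure lborel unit_cube = 1\<close> by simp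
qed

context hermite_system
begin

lemma continuous_\<phi>: "continuous_on UNIV \<phi>"
  by (rule Cm_continuous[OF Cm_\<phi>])

lemma spanning: "spanning_condition \<phi>"
  unfolding spanning_condition_def
proof (rule ballI, rule span_UNIV_if_no_annihilator)
  fix \<omega> :: "int^'d::{finite,linorder}" and c :: "complex^'r::{finite,linorder}"
  assume ann: "\<And>v. v \<in> range (\<lambda>k. fourier \<phi> (pi *\<^sub>R rvec \<omega> + (2 * pi) *\<^sub>R rvec k)) \<Longrightarrow> (\<Sum>l\<in>UNIV. c $ l * v $ l) = 0"
  let ?s = "- (pi *\<^sub>R rvec \<omega>)"
  define w :: "complex^'r::{finite,linorder}^1" where "w = (\<chi> _. c)"
  \<comment> \<open>Modulation by exp(-i pi \<omega>.x) moves the coset pi \<omega> + 2 pi k to 2 pi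
    k, where ordinary periodization applies.\<close>
  define \<phi>1 where "\<phi>1 x = (\<chi> l. \<phi> x $ l * wave ?s x)" for x
  have cont1: "continuous_on UNIV \<phi>1"
    unfolding \<phi>1_def by (intro continuous_on_vec_lambda continuous_intros continuous_\<phi> continuous_wave)
  have supp1: "supp_ball R \<phi>1" using supp by (simp add: supp_ball_def \<phi>1_def vec_eq_iff)
  define G where "G = shift_sum \<phi>1 (\<lambda>_. w)"
  have contG: "continuous_on UNIV G"
    using Cm_shift_sum[of 0 \<phi>1 R "\<lambda>_. w"] cont1 supp1 unfolding G_def by simp
  have perG: "G (x + rvec k) = G x" for x k
    using shift_sum_translate[of \<phi>1 "\<lambda>_. w" k x] by (simp add: G_def add.commute)
  have int: "integrable lborel (\<lambda>x. c $ l * (\<phi> x $ l * wave \<zeta> x))" for l \<zeta>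
    by (intro integrable_mult_right integrable_sft[OF _ supp_ball_nth[OF supp]] continuous_intros continuous_\<phi>)
  have G0: "G x = 0" for x
  proof (rule fourier_coefficients_unique[OF contG perG])
    fix k
    let ?\<xi> = "pi *\<^sub>R rvec \<omega> + (2 * pi) *\<^sub>R rvec k"
    have "(w *v \<phi>1 x) $ 1 * character k x = (\<Sum>l\<in>UNIV. c $ l * (\<phi> x $ l * wave (- ?\<xi>) x))" for x
    proof -
      have "wave (- ?\<xi>) x = wave ?s x * character k x"
        unfolding character_def wave_def exp_add[symmetric]
        by (simp add: inner_add_left inner_diff_left algebra_simps)
      then show ?thesis by (simp add: row_mult w_def \<phi>1_def sum_distrib_left mult_ac)
    qed
    then have "(LINT x|lborel. (w *v \<phi>1 x) $ 1 * character k x)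
        = (LINT x|lborel. (\<Sum>l\<in>UNIV. c $ l * (\<phi> x $ l * wave (- ?\<xi>) x)))" by simp
    also have "\<dots> = (\<Sum>l\<in>UNIV. LINT x|lborel. c $ l * (\<phi> x $ l * wave (- ?\<xi>) x))"
      by (rule Bochner_Integration.integral_sum) (rule int)
    also have "\<dots> = (\<Sum>l\<in>UNIV. c $ l * fourier \<phi> ?\<xi> $ l)"
      unfolding fourier_nth sft_def by simp
    also have "\<dots> = 0" by (rule ann) simp
    finally show "(LINT x|lborel. indicator unit_cube x *\<^sub>R (G x * character k x)) = 0"
      unfolding G_def integral_shift_sum[OF cont1 supp1] .
  qed
  \<comment> \<open>Undoing the modulation turns the constant row into the coefficients exp(i pi
    \<omega>.k) c for the unmodulated \<phi>, to whose derivatives the interpolation property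
    applies.\<close>
  define u :: "int^'d::{finite,linorder} \<Rightarrow> complex^'r::{finite,linorder}^1"
    where "u k = (\<chi> _ l. wave (pi *\<^sub>R rvec \<omega>) (rvec k) * c $ l)" for k
  have "shift_sum \<phi> u x = 0" for x
  proof -
    let ?F = "{k :: int^'d::{finite,linorder}. norm (rvec k) \<le> norm x + R}"
    have "shift_sum \<phi> u x = (\<Sum>k\<in>?F. (u k *v \<phi> (x - rvec k)) $ 1)"
      by (rule shift_sum_finite[OF supp finite_lattice_ball]) simp
    also have "\<dots> = (\<Sum>k\<in>?F. wave (pi *\<^sub>R rvec \<omega>) x * (w *v \<phi>1 (x - rvec k)) $ 1)"
    proof (rule sum.cong[OF refl])
      fix k
      have "wave (pi *\<^sub>R rvec \<omega>) (rvec k) = wave (pi *\<^sub>R rvec \<omega>) x * wave ?s (x - rvec k)"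
        unfolding wave_def by (simp add: inner_diff_right algebra_simps flip: exp_add)
      then show "(u k *v \<phi> (x - rvec k)) $ 1 = wave (pi *\<^sub>R rvec \<omega>) x * (w *v \<phi>1 (x - rvec k)) $ 1"
        by (simp add: row_mult u_def w_def \<phi>1_def sum_distrib_left mult_ac)
    qed
    also have "\<dots> = wave (pi *\<^sub>R rvec \<omega>) x * G x"
      unfolding sum_distrib_left[symmetric] G_def
      by (subst shift_sum_finite[OF supp1 finite_lattice_ball, of x]) auto
    finally show ?thesis by (simp add: G0)
  qed
  then have "shift_sum \<phi> u = (\<lambda>x. 0)" by auto
  then have "mderiv (\<nu> l) (shift_sum \<phi> u) (rvec 0 + \<tau> l) = 0" for l by simp
  then have "u 0 $ 1 $ l = 0" for l
    unfolding mderiv_shift_sum[OF Cm_\<nu> supp] shift_sum_hermite[OF hermite] .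
  then show "c = 0" by (simp add: u_def vec_eq_iff)
qed

text \<open>Spanning at \<omega> = 0 excludes a transform that vanishes identically. One nonzero
  value of one entry starts the argument that a homogeneous polynomial vanishes on an open
  set.\<close>

lemma fourier_nonzero: "\<exists>\<xi> l. sft (\<lambda>x. \<phi> x $ l) \<xi> \<noteq> 0"
proof (rule ccontr)
  assume "\<not> ?thesis"
  then have "fourier \<phi> \<xi> = 0" for \<xi> by (simp add: vec_eq_iff fourier_nth)
  moreover have "(0 :: int^'d::{finite,linorder}) \<in> unit_cube_pts" by (simp add: unit_cube_pts_def)
  ultimately have "vec.span {0 :: complex^'r::{finite,linorder}} = UNIV"
    using spanning unfolding spanning_condition_def by force
  then have "(axis idx1 1 :: complex^'r::{finite,linorder}) \<in> {0}" by (simp add: vec.span_insert_0)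
  then show False by (simp add: axis_eq_0_iff)
qed

end

section \<open>Polynomial reproduction from smoothness\<close>

lemma mderiv_nmonom_scale:
  "of_real c ^ mabs \<nu> * mderiv \<nu> (nmonom \<mu>) (c *\<^sub>R x) = of_real c ^ mabs \<mu> * mderiv \<nu> (nmonom \<mu>) x"
proof (cases "\<nu> \<le> \<mu>")
  case True
  then have "complex_of_real c ^ mabs \<mu> = of_real c ^ mabs \<nu> * of_real c ^ mabs (\<mu> - \<nu>)"
    using mabs_diff[OF True] by (simp add: add.commute flip: power_add)
  with True show ?thesis by (simp add: mderiv_nmonom nmonom_scale)
qed (simp add: mderiv_nmonom)

lemma nmonom_mpow: "nmonom \<mu> x * of_nat (mfact \<mu>) = of_real (mpow x \<mu>)"
  by (simp add: nmonom_def mfact_def)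

context hermite_system
begin

text \<open>The Hermite data of the normalized monomial. It is the prospective polynomial vector
  \<open>p_\<mu>\<close>, available before any matching filter is at hand.\<close>

definition hermite_poly :: "nat^'d::{finite,linorder} \<Rightarrow> real^'d::{finite,linorder} \<Rightarrow> complex^'r::{finite,linorder}^1" where
  "hermite_poly \<mu> x = (\<chi> _ l. mderiv (\<nu> l) (nmonom \<mu>) (x + \<tau> l))"

lemma hermite_poly_nth: "hermite_poly \<mu> x $ i $ l = mderiv (\<nu> l) (nmonom \<mu>) (x + \<tau> l)"
  by (simp add: hermite_poly_def)

text \<open>On every grid \<open>2\<^sup>-\<^sup>n \<int>\<^sup>d\<close> the function \<open>F\<close> is its own Hermite interpolant (fact \<open>exact\<close> below).
  Inserting the Taylor expansions of \<open>F\<close> and its derivatives at a dyadic point and comparing the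
  powers of the mesh width \<open>t n\<close> up to order \<open>m\<close> isolates the homogeneous parts.\<close>

lemma homogeneous_defect_dyadic:
  fixes q :: "'r::{finite,linorder}" and y :: "real^'d::{finite,linorder}"
  defines "F \<equiv> \<lambda>x. \<phi> x $ q"
    and "D \<equiv> \<lambda>\<mu>. nmonom \<mu> y - shift_sum \<phi> (\<lambda>k. hermite_poly \<mu> (rvec k)) y"
  assumes "s \<le> m"
  shows "(\<Sum>\<mu> | mabs \<mu> = s. mderiv \<mu> F (rvec k0 /\<^sub>R 2 ^ n0) * D \<mu>) = 0"
proof -
  let ?x = "rvec k0 /\<^sub>R 2 ^ n0"
  let ?K = "{k :: int^'d::{finite,linorder}. norm (rvec k) \<le> norm y + R}"
  \<comment> \<open>The offset n0 makes the given dyadic point a grid point of mesh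
    \<open>t n\<close> for every n.\<close>
  define t :: "nat \<Rightarrow> real" where "t n = 1 / 2 ^ (n + n0)" for n
  have t: "0 < t n" for n by (simp add: t_def)
  have "(\<lambda>n. (1 / 2) ^ (n + n0) :: real) \<longlonglongrightarrow> 0"
    by (rule LIMSEQ_ignore_initial_segment[OF LIMSEQ_power_zero]) simp
  then have tlim: "t \<longlonglongrightarrow> 0" by (simp add: t_def[abs_def] power_one_over)
  have F: "Cm m F" unfolding F_def by (rule Cm_nth[OF Cm_\<phi>])
  have F_shift: "F = shift_sum \<phi> (row_delta q)" by (simp add: F_def fun_eq_iff shift_sum_row_delta)
  \<comment> \<open>c is the rescaled derivative and P its Taylor polynomial; the index 0 stands for
    F itself, so both sides of the interpolation identity are treated alike.\<close>
  define c where "c n \<nu>' z = of_real (t n) ^ mabs \<nu>' * mderiv \<nu>' F (?x + t n *\<^sub>R z)" for n \<nu>' z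
  define P where "P n \<nu>' z = (\<Sum>\<mu> | mabs \<mu> \<le> m. of_real (t n) ^ mabs \<mu> * mderiv \<mu> F ?x * mderiv \<nu>' (nmonom \<mu>) z)"
    for n \<nu>' z
  have lim: "(\<lambda>n. (c n \<nu>' z - P n \<nu>' z) / of_real (t n) ^ m) \<longlonglongrightarrow> 0" if "mabs \<nu>' \<le> m" for \<nu>' z
    unfolding c_def P_def by (rule taylor_mderiv_limit[OF F that t tlim])
  have exact: "c n 0 y = (\<Sum>k\<in>?K. \<Sum>l\<in>UNIV. c n (\<nu> l) (rvec k + \<tau> l) * \<phi> (y - rvec k) $ l)" for n
  proof -
    define N where "N = n + n0"
    define j where "j = 2 ^ (N - n0) *s k0"
    let ?w = "(subdiv a ^^ N) (row_delta q)"
    have j: "?x = t n *\<^sub>R rvec j"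
      using rvec_dyadic[of n0 N k0] by (simp add: N_def j_def t_def divide_inverse)
    have tN: "t n = 1 / 2 ^ N" by (simp add: t_def N_def)
    have "c n 0 y = shift_sum \<phi> (row_delta q) (?x + t n *\<^sub>R y)"
      by (simp add: c_def F_shift)
    also have "\<dots> = shift_sum \<phi> ?w (2 ^ N *\<^sub>R (?x + t n *\<^sub>R y))"
      by (rule shift_sum_refine_pow[OF refine mask supp])
    also have "2 ^ N *\<^sub>R (?x + t n *\<^sub>R y) = rvec j + y"
      unfolding j by (simp add: tN scaleR_add_right)
    also have "shift_sum \<phi> ?w (rvec j + y) = shift_sum \<phi> (\<lambda>k. ?w (k + j)) y"
      by (rule shift_sum_translate)
    also have "\<dots> = (\<Sum>k\<in>?K. ((?w (k + j)) *v \<phi> (y - rvec k)) $ 1)"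
      by (rule shift_sum_finite[OF supp finite_lattice_ball]) simp
    also have "\<dots> = (\<Sum>k\<in>?K. \<Sum>l\<in>UNIV. c n (\<nu> l) (rvec k + \<tau> l) * \<phi> (y - rvec k) $ l)"
      unfolding row_mult
    proof (intro sum.cong refl)
      fix k l
      have "mderiv (\<nu> l) F ((1 / 2 ^ N) *\<^sub>R (rvec (k + j) + \<tau> l)) = 2 ^ (N * mabs (\<nu> l)) * ?w (k + j) $ 1 $ l"
        unfolding F_shift by (rule mderiv_shift_sum_dyadic)
      moreover have "(1 / 2 ^ N) *\<^sub>R (rvec (k + j) + \<tau> l) = ?x + t n *\<^sub>R (rvec k + \<tau> l)"
        unfolding j tN by (simp add: rvec_add scaleR_add_right)
      moreover have "complex_of_real (t n) ^ mabs (\<nu> l) * 2 ^ (N * mabs (\<nu> l)) = 1"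
        by (simp add: tN power_mult power_divide)
      ultimately have "c n (\<nu> l) (rvec k + \<tau> l) = ?w (k + j) $ 1 $ l"
        by (simp add: c_def mult.assoc[symmetric])
      then show "?w (k + j) $ 1 $ l * \<phi> (y - rvec k) $ l = c n (\<nu> l) (rvec k + \<tau> l) * \<phi> (y - rvec k) $ l"
        by simp
    qed
    finally show ?thesis .
  qed
  \<comment> \<open>By \<open>exact\<close> the main terms cancel, and the polynomial in
    \<open>t n\<close> equals a fixed linear combination of Taylor remainders, each of them
    o(t^m).\<close>
  have sumD: "(\<Sum>\<mu> | mabs \<mu> \<le> m. of_real (t n) ^ mabs \<mu> * mderiv \<mu> F ?x * D \<mu>)
      = (\<Sum>k\<in>?K. \<Sum>l\<in>UNIV. (c n (\<nu> l) (rvec k + \<tau> l) - P n (\<nu> l) (rvec k + \<tau> l)) * \<phi> (y - rvec k) $ l)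
        - (c n 0 y - P n 0 y)" for n
  proof -
    have "(\<Sum>\<mu> | mabs \<mu> \<le> m. of_real (t n) ^ mabs \<mu> * mderiv \<mu> F ?x * shift_sum \<phi> (\<lambda>k. hermite_poly \<mu> (rvec k)) y)
        = (\<Sum>\<mu> | mabs \<mu> \<le> m. \<Sum>k\<in>?K. \<Sum>l\<in>UNIV.
            of_real (t n) ^ mabs \<mu> * mderiv \<mu> F ?x * mderiv (\<nu> l) (nmonom \<mu>) (rvec k + \<tau> l) * \<phi> (y - rvec k) $ l)"
    proof (rule sum.cong[OF refl])
      fix \<mu>
      have "shift_sum \<phi> (\<lambda>k. hermite_poly \<mu> (rvec k)) y = (\<Sum>k\<in>?K. (hermite_poly \<mu> (rvec k) *v \<phi> (y - rvec k)) $ 1)"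
        by (rule shift_sum_finite[OF supp finite_lattice_ball]) simp
      then show "of_real (t n) ^ mabs \<mu> * mderiv \<mu> F ?x * shift_sum \<phi> (\<lambda>k. hermite_poly \<mu> (rvec k)) y
        = (\<Sum>k\<in>?K. \<Sum>l\<in>UNIV. of_real (t n) ^ mabs \<mu> * mderiv \<mu> F ?x * mderiv (\<nu> l) (nmonom \<mu>) (rvec k + \<tau> l) * \<phi> (y - rvec k) $ l)"
        by (simp add: row_mult hermite_poly_nth sum_distrib_left mult.assoc)
    qed
    also have "\<dots> = (\<Sum>k\<in>?K. \<Sum>\<mu> | mabs \<mu> \<le> m. \<Sum>l\<in>UNIV.
            of_real (t n) ^ mabs \<mu> * mderiv \<mu> F ?x * mderiv (\<nu> l) (nmonom \<mu>) (rvec k + \<tau> l) * \<phi> (y - rvec k) $ l)"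
      by (rule sum.swap)
    also have "\<dots> = (\<Sum>k\<in>?K. \<Sum>l\<in>UNIV. \<Sum>\<mu> | mabs \<mu> \<le> m.
            of_real (t n) ^ mabs \<mu> * mderiv \<mu> F ?x * mderiv (\<nu> l) (nmonom \<mu>) (rvec k + \<tau> l) * \<phi> (y - rvec k) $ l)"
      by (rule sum.cong[OF refl], rule sum.swap)
    also have "\<dots> = (\<Sum>k\<in>?K. \<Sum>l\<in>UNIV. P n (\<nu> l) (rvec k + \<tau> l) * \<phi> (y - rvec k) $ l)"
      by (simp add: P_def sum_distrib_right)
    finally have "(\<Sum>\<mu> | mabs \<mu> \<le> m. of_real (t n) ^ mabs \<mu> * mderiv \<mu> F ?x * D \<mu>)
      = P n 0 y - (\<Sum>k\<in>?K. \<Sum>l\<in>UNIV. P n (\<nu> l) (rvec k + \<tau> l) * \<phi> (y - rvec k) $ l)"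
      by (simp add: D_def P_def right_diff_distrib sum_subtractf)
    then show ?thesis unfolding exact by (simp add: left_diff_distrib sum_subtractf)
  qed
  have "(\<lambda>n. (\<Sum>k\<in>?K. \<Sum>l\<in>UNIV. (c n (\<nu> l) (rvec k + \<tau> l) - P n (\<nu> l) (rvec k + \<tau> l)) / of_real (t n) ^ m * \<phi> (y - rvec k) $ l)
        - (c n 0 y - P n 0 y) / of_real (t n) ^ m) \<longlonglongrightarrow> (\<Sum>k\<in>?K. \<Sum>l\<in>UNIV. 0 * \<phi> (y - rvec k) $ l) - 0"
    by (intro tendsto_diff tendsto_sum tendsto_mult tendsto_const lim \<nu>_le) simp
  moreover have "(\<Sum>\<mu> | mabs \<mu> \<le> m. of_real (t n) ^ mabs \<mu> * mderiv \<mu> F ?x * D \<mu>) / of_real (t n) ^ m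
      = (\<Sum>k\<in>?K. \<Sum>l\<in>UNIV. (c n (\<nu> l) (rvec k + \<tau> l) - P n (\<nu> l) (rvec k + \<tau> l)) / of_real (t n) ^ m * \<phi> (y - rvec k) $ l)
        - (c n 0 y - P n 0 y) / of_real (t n) ^ m" for n
    unfolding sumD by (subst diff_divide_distrib) (simp add: sum_divide_distrib)
  ultimately have "(\<lambda>n. (\<Sum>\<mu> | mabs \<mu> \<le> m. of_real (t n) ^ mabs \<mu> * mderiv \<mu> F ?x * D \<mu>) / of_real (t n) ^ m) \<longlonglongrightarrow> 0"
    by simp
  moreover have "(\<Sum>\<mu> | mabs \<mu> \<le> m. of_real (t n) ^ mabs \<mu> * mderiv \<mu> F ?x * D \<mu>)
      = (\<Sum>s\<le>m. (\<Sum>\<mu> | mabs \<mu> = s. mderiv \<mu> F ?x * D \<mu>) * of_real (t n) ^ s)" for n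
  proof -
    have "(\<Sum>s\<le>m. (\<Sum>\<mu> | mabs \<mu> = s. mderiv \<mu> F ?x * D \<mu>) * of_real (t n) ^ s)
        = (\<Sum>s\<le>m. \<Sum>\<mu>\<in>{\<mu>\<in>{\<mu>. mabs \<mu> \<le> m}. mabs \<mu> = s}. of_real (t n) ^ mabs \<mu> * mderiv \<mu> F ?x * D \<mu>)"
      unfolding sum_distrib_right by (intro sum.cong) (auto simp: mult_ac)
    also have "\<dots> = (\<Sum>\<mu> | mabs \<mu> \<le> m. of_real (t n) ^ mabs \<mu> * mderiv \<mu> F ?x * D \<mu>)"
      by (rule sum.group[OF finite_mabs_le]) auto
    finally show ?thesis ..
  qed
  ultimately have "(\<lambda>n. (\<Sum>s\<le>m. (\<Sum>\<mu> | mabs \<mu> = s. mderiv \<mu> F ?x * D \<mu>) * of_real (t n) ^ s) / of_real (t n) ^ m) \<longlonglongrightarrow> 0"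
    by simp
  from polynomial_little_o_zero[OF t tlim this assms(3)] show ?thesis .
qed

text \<open>Under the Fourier transform the differential equation of the previous lemma says that a
  homogeneous polynomial vanishes on the nonempty open set where the transform of \<open>F\<close> does not.\<close>

lemma shift_sum_hermite_poly:
  assumes "mabs \<mu> \<le> m"
  shows "shift_sum \<phi> (\<lambda>k. hermite_poly \<mu> (rvec k)) y = nmonom \<mu> y"
proof -
  define s where "s = mabs \<mu>"
  obtain \<xi>0 q where q: "sft (\<lambda>x. \<phi> x $ q) \<xi>0 \<noteq> 0" using fourier_nonzero by blast
  define F where "F = (\<lambda>x. \<phi> x $ q)"
  define D where "D \<kappa> = nmonom \<kappa> y - shift_sum \<phi> (\<lambda>k. hermite_poly \<kappa> (rvec k)) y" for \<kappa>
  have F: "Cm m F" unfolding F_def by (rule Cm_nth[OF Cm_\<phi>])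
  have Fs: "supp_ball R F" unfolding F_def by (rule supp_ball_nth[OF supp])
  have C\<kappa>: "continuous_on UNIV (mderiv \<kappa> F)" if "mabs \<kappa> = s" for \<kappa>
    using Cm_mderiv'[OF F, of \<kappa> 0] that assms by (simp add: s_def)
  have zero: "(\<Sum>\<kappa> | mabs \<kappa> = s. mderiv \<kappa> F x * D \<kappa>) = 0" for x
  proof (rule dyadic_dense[where f = "\<lambda>x. \<Sum>\<kappa> | mabs \<kappa> = s. mderiv \<kappa> F x * D \<kappa>", OF _ open_UNIV UNIV_I])
    show "continuous_on UNIV (\<lambda>x. \<Sum>\<kappa> | mabs \<kappa> = s. mderiv \<kappa> F x * D \<kappa>)"
      by (intro continuous_intros C\<kappa>) simp
    show "(\<Sum>\<kappa> | mabs \<kappa> = s. mderiv \<kappa> F (rvec k0 /\<^sub>R 2 ^ n0) * D \<kappa>) = 0" for n0 k0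
      unfolding F_def D_def by (rule homogeneous_defect_dyadic) (use assms in \<open>simp add: s_def\<close>)
  qed
  \<comment> \<open>y is fixed, so the defects D \<kappa> are constants and only the derivatives of
    F are transformed.\<close>
  have ft: "(\<Sum>\<kappa> | mabs \<kappa> = s. (D \<kappa> * \<i> ^ s * of_nat (mfact \<kappa>)) * nmonom \<kappa> \<xi>) * sft F \<xi> = 0" for \<xi>
  proof -
    have int: "integrable lborel (\<lambda>x. D \<kappa> * (mderiv \<kappa> F x * wave (- \<xi>) x))" if "mabs \<kappa> = s" for \<kappa>
      by (intro integrable_mult_right integrable_sft[OF C\<kappa>[OF that] supp_ball_mderiv[OF Fs]])
    have "0 = (LINT x|lborel. (\<Sum>\<kappa> | mabs \<kappa> = s. D \<kappa> * (mderiv \<kappa> F x * wave (- \<xi>) x)))"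
    proof -
      have "(\<Sum>\<kappa> | mabs \<kappa> = s. D \<kappa> * (mderiv \<kappa> F x * wave (- \<xi>) x))
          = (\<Sum>\<kappa> | mabs \<kappa> = s. mderiv \<kappa> F x * D \<kappa>) * wave (- \<xi>) x" for x
        unfolding sum_distrib_right by (simp add: mult_ac)
      then show ?thesis using zero by simp
    qed
    also have "\<dots> = (\<Sum>\<kappa> | mabs \<kappa> = s. LINT x|lborel. D \<kappa> * (mderiv \<kappa> F x * wave (- \<xi>) x))"
      by (rule Bochner_Integration.integral_sum) (simp add: int)
    also have "\<dots> = (\<Sum>\<kappa> | mabs \<kappa> = s. D \<kappa> * sft (mderiv \<kappa> F) \<xi>)"
      by (simp add: sft_def)
    also have "\<dots> = (\<Sum>\<kappa> | mabs \<kappa> = s. (D \<kappa> * \<i> ^ s * of_nat (mfact \<kappa>)) * nmonom \<kappa> \<xi> * sft F \<xi>)"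
    proof (rule sum.cong[OF refl])
      fix \<kappa> :: "nat^'d::{finite,linorder}" assume "\<kappa> \<in> {\<kappa>. mabs \<kappa> = s}"
      then have "sft (mderiv \<kappa> F) \<xi> = \<i> ^ s * (nmonom \<kappa> \<xi> * of_nat (mfact \<kappa>)) * sft F \<xi>"
        using assms unfolding nmonom_mpow by (subst sft_mderiv[OF Cm_mono[OF F] Fs]) (auto simp: s_def)
      then show "D \<kappa> * sft (mderiv \<kappa> F) \<xi> = (D \<kappa> * \<i> ^ s * of_nat (mfact \<kappa>)) * nmonom \<kappa> \<xi> * sft F \<xi>"
        by (simp add: mult_ac)
    qed
    finally show ?thesis by (simp add: sum_distrib_right)
  qed
  have contF: "continuous_on UNIV (sft F)" by (rule continuous_sft[OF Cm_continuous[OF F] Fs])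
  have "D \<mu> * \<i> ^ s * of_nat (mfact \<mu>) = 0"
  proof (rule nmonom_sum_unique[where U = "{\<xi>. sft F \<xi> \<noteq> 0}" and s = s and c = "\<lambda>\<kappa>. D \<kappa> * \<i> ^ s * of_nat (mfact \<kappa>)"])
    have "open (sft F -` (- {0}))" using contF by (intro open_vimage) auto
    moreover have "sft F -` (- {0}) = {\<xi>. sft F \<xi> \<noteq> 0}" by auto
    ultimately show "open {\<xi>. sft F \<xi> \<noteq> 0}" by simp
    show "{\<xi>. sft F \<xi> \<noteq> 0} \<noteq> {}" using q unfolding F_def by blast
    show "(\<Sum>\<mu> | mabs \<mu> = s. (D \<mu> * \<i> ^ s * of_nat (mfact \<mu>)) * nmonom \<mu> \<xi>) = 0" if "\<xi> \<in> {\<xi>. sft F \<xi> \<noteq> 0}" for \<xi>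
      using ft[of \<xi>] that by simp
  qed (simp add: s_def)
  then have "D \<mu> = 0" by (simp add: mfact_def)
  then show ?thesis by (simp add: D_def)
qed

text \<open>The monomial is the shift sum of its own Hermite data. Level 1 of the dyadic formula
  expresses the subdivided data by its derivatives at half the nodes, and homogeneity yields the
  eigenvalue.\<close>

lemma subdiv_hermite_poly:
  assumes "mabs \<mu> \<le> m"
  shows "subdiv a (\<lambda>k. hermite_poly \<mu> (rvec k)) j = (1 / 2 ^ mabs \<mu>) *\<^sub>R hermite_poly \<mu> (rvec j)"
proof -
  let ?w = "\<lambda>k. hermite_poly \<mu> (rvec k)"
  have eq: "shift_sum \<phi> ?w = nmonom \<mu>" using shift_sum_hermite_poly[OF assms] by auto
  have "subdiv a ?w j $ 1 $ l = 1 / 2 ^ mabs \<mu> * hermite_poly \<mu> (rvec j) $ 1 $ l" for l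
  proof -
    have "2 ^ mabs (\<nu> l) * subdiv a ?w j $ 1 $ l = mderiv (\<nu> l) (nmonom \<mu>) ((1 / 2) *\<^sub>R (rvec j + \<tau> l))"
      using mderiv_shift_sum_dyadic[of l ?w 1 j] by (simp add: eq)
    moreover have "of_real (1 / 2) ^ mabs (\<nu> l) * mderiv (\<nu> l) (nmonom \<mu>) ((1 / 2) *\<^sub>R (rvec j + \<tau> l))
        = of_real (1 / 2) ^ mabs \<mu> * mderiv (\<nu> l) (nmonom \<mu>) (rvec j + \<tau> l)"
      by (rule mderiv_nmonom_scale)
    ultimately show ?thesis by (simp add: hermite_poly_nth power_divide) (metis nonzero_mult_div_cancel_left power_not_zero zero_neq_numeral)
  qed
  then show ?thesis by (simp add: vec_eq_iff forall_1) (simp add: scaleR_conv_of_real)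
qed

end

section \<open>Sum rules as moment conditions\<close>

lemma Cm_row:
  fixes f :: "real^'d \<Rightarrow> complex^'r^1"
  assumes "\<And>l. Cm m (\<lambda>\<xi>. f \<xi> $ 1 $ l)"
  shows "Cm m f"
proof (rule Cm_vec, rule Cm_vec)
  fix i :: 1 and l
  have "i = 1" by (rule num1_eq1)
  then show "Cm m (\<lambda>\<xi>. f \<xi> $ i $ l)" by (simp only: assms)
qed

lemma mderiv_row:
  assumes "\<And>m. Cm m f"
  shows "mderiv \<mu> f x $ i $ l = mderiv \<mu> (\<lambda>\<xi>. f \<xi> $ i $ l) x"
  using assms by (simp add: mderiv_nth Cm_nth)

lemma eqO_components:
  fixes f g :: "real^'d::{finite,linorder} \<Rightarrow> complex^'r^1"
  assumes "\<And>m l. Cm m (\<lambda>\<xi>. f \<xi> $ 1 $ l)" "\<And>m l. Cm m (\<lambda>\<xi>. g \<xi> $ 1 $ l)"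
  shows "eqO N f g \<longleftrightarrow> (\<forall>\<mu> l. mabs \<mu> < N \<longrightarrow>
    mderiv \<mu> (\<lambda>\<xi>. f \<xi> $ 1 $ l) 0 = mderiv \<mu> (\<lambda>\<xi>. g \<xi> $ 1 $ l) 0)"
proof -
  have C: "Cm m f" "Cm m g" for m by (intro Cm_row assms)+
  have "mderiv \<mu> f 0 = mderiv \<mu> g 0 \<longleftrightarrow> (\<forall>l. mderiv \<mu> f 0 $ 1 $ l = mderiv \<mu> g 0 $ 1 $ l)" for \<mu>
    by (simp add: vec_eq_iff forall_1)
  then show ?thesis unfolding eqO_def mderiv_row[OF C(1)] mderiv_row[OF C(2)] by auto
qed

lemma wave_scale_left: "wave \<rho> (c *\<^sub>R x) = wave (c *\<^sub>R \<rho>) x"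
  by (simp add: wave_def)

lemma wave_add_right: "wave \<rho> (x + y) = wave \<rho> x * wave \<rho> y"
  by (simp add: wave_def inner_add_right distrib_left flip: exp_add)

lemma fseries_nth:
  assumes "fin_supp u"
  shows "fseries u \<xi> $ i $ j = (\<Sum>k | u k \<noteq> 0. u k $ i $ j * wave (- rvec k) \<xi>)"
proof -
  have "(\<Sum>\<^sub>\<infinity>k. u k $ i $ j * exp (- \<i> * complex_of_real (rvec k \<bullet> \<xi>)))
      = (\<Sum>k | u k \<noteq> 0. u k $ i $ j * exp (- \<i> * complex_of_real (rvec k \<bullet> \<xi>)))"
    by (rule infsum_finite_support) (use assms in \<open>auto simp: fin_supp_def\<close>)
  then show ?thesis by (simp add: fseries_def wave_def)
qed

lemma Cm_wave_sum: "Cm m (\<lambda>\<xi>. \<Sum>x\<in>F. c x * wave (\<rho> x) \<xi>)"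
  by (intro Cm_sum Cm_wave)

lemma mderiv_wave_sum:
  "mderiv \<mu> (\<lambda>\<xi>. \<Sum>x\<in>F. c x * wave (\<rho> x) \<xi>) 0
    = \<i> ^ mabs \<mu> * of_nat (mfact \<mu>) * (\<Sum>x\<in>F. c x * nmonom \<mu> (\<rho> x))"
  by (simp add: mderiv_sum[OF Cm_wave] mderiv_wave sum_distrib_left nmonom_mpow[symmetric] mult_ac)

text \<open>This is (-1)^(\<omega>.k), written as a product over coordinates so that sums over
  \<omega> factor; by \<open>wave_parity\<close> it is the effect of the frequency shift pi \<omega>
  on the k-th exponential.\<close>

definition parity_char :: "int^'d \<Rightarrow> int^'d \<Rightarrow> complex" where
  "parity_char \<omega> k = (\<Prod>i\<in>UNIV. if even (\<omega> $ i * k $ i) then 1 else - 1)"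

lemma wave_parity: "wave (- rvec k) (pi *\<^sub>R rvec \<omega>) = parity_char \<omega> k"
proof -
  have "wave (- rvec k) (pi *\<^sub>R rvec \<omega>) = exp (\<Sum>i\<in>UNIV. \<i> * of_real (pi * of_int (- (\<omega> $ i * k $ i))))"
    unfolding wave_def by (simp add: inner_vec_def sum_distrib_left sum_negf mult_ac)
  also have "\<dots> = (\<Prod>i\<in>UNIV. cis (pi * of_int (- (\<omega> $ i * k $ i))))"
    by (simp only: exp_sum finite cis_conv_exp)
  also have "\<dots> = parity_char \<omega> k"
    unfolding parity_char_def
  proof (rule prod.cong[OF refl])
    fix i
    show "cis (pi * of_int (- (\<omega> $ i * k $ i))) = (if even (\<omega> $ i * k $ i) then 1 else - 1)"
      using cos_npi_int[of "- (\<omega> $ i * k $ i)"] sin_npi_int[of "- (\<omega> $ i * k $ i)"]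
      by (simp only: complex_eq_iff cis.sel even_minus) (simp split: if_splits)
  qed
  finally show ?thesis .
qed

lemma parity_char_commute: "parity_char \<omega> k = parity_char k \<omega>"
  by (simp add: parity_char_def mult.commute)

lemma parity_char_diff: "parity_char \<omega> (k - j) = parity_char \<omega> k * parity_char \<omega> j"
  unfolding parity_char_def prod.distrib[symmetric] by (rule prod.cong) (auto simp: right_diff_distrib)

lemma parity_char_0 [simp]: "parity_char 0 k = 1" "parity_char k 0 = 1"
  by (simp_all add: parity_char_def)

lemma unit_cube_pts_eq: "unit_cube_pts = {\<omega>. \<forall>i. \<omega> $ i \<in> {0, 1}}"
proof -
  have "0 \<le> z \<and> z \<le> 1 \<longleftrightarrow> z \<in> {0, 1}" for z :: int by auto
  then show ?thesis by (simp add: unit_cube_pts_def)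
qed

lemma finite_unit_cube_pts: "finite unit_cube_pts"
  unfolding unit_cube_pts_eq by (rule finite_vec_set) simp

lemma zero_in_unit_cube_pts: "0 \<in> unit_cube_pts"
  by (simp add: unit_cube_pts_def)

text \<open>Orthogonality of the characters of the group of parities: a product of one-dimensional
  sums of 1 and a sign.\<close>

lemma sum_parity_char:
  "(\<Sum>\<omega>\<in>unit_cube_pts. parity_char \<omega> (k :: int^'d)) = (if \<forall>i. even (k $ i) then 2 ^ CARD('d) else 0)"
proof -
  have "(\<Sum>\<omega>\<in>unit_cube_pts. parity_char \<omega> k)
      = (\<Prod>i\<in>UNIV. \<Sum>z\<in>{0, 1}. if even (z * k $ i) then 1 else - 1)"
    unfolding unit_cube_pts_eq parity_char_def by (rule prod_sum_vec[symmetric]) simp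
  also have "\<dots> = (\<Prod>i\<in>UNIV. if even (k $ i) then 2 else 0 :: complex)"
    by (rule prod.cong) auto
  also have "\<dots> = (if \<forall>i. even (k $ i) then 2 ^ CARD('d) else 0)"
    by auto
  finally show ?thesis .
qed

text \<open>Up to the factor \<open>\<i>\<^bsup>|\<mu>|\<^esup> \<mu>!\<close>, these are the derivatives of order \<open>\<mu>\<close> at \<open>0\<close> of the \<open>l\<close>-th entries of
  the Fourier series of \<open>\<upsilon>\<close> and of its product, dilated by 2, with that of \<open>a\<close> shifted by \<open>\<pi>\<omega>\<close>.\<close>

definition filter_moment :: "(int^'d \<Rightarrow> complex^'r^1) \<Rightarrow> nat^'d \<Rightarrow> 'r \<Rightarrow> complex" where
  "filter_moment \<upsilon> \<mu> l = (\<Sum>n | \<upsilon> n \<noteq> 0. \<upsilon> n $ 1 $ l * nmonom \<mu> (- rvec n))"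

definition mask_moment ::
  "(int^'d \<Rightarrow> complex^'r^'r) \<Rightarrow> (int^'d \<Rightarrow> complex^'r^1) \<Rightarrow> int^'d \<Rightarrow> nat^'d \<Rightarrow> 'r \<Rightarrow> complex" where
  "mask_moment a \<upsilon> \<omega> \<mu> l = (\<Sum>(n, k, q) \<in> {n. \<upsilon> n \<noteq> 0} \<times> {k. a k \<noteq> 0} \<times> UNIV.
     \<upsilon> n $ 1 $ q * a k $ q $ l * parity_char \<omega> k * nmonom \<mu> (- (2 *\<^sub>R rvec n + rvec k)))"

lemma poly_conv_nth:
  assumes "fin_supp \<upsilon>"
  shows "poly_conv p \<upsilon> x $ i $ l = (\<Sum>n | \<upsilon> n \<noteq> 0. p (x - rvec n) * \<upsilon> n $ i $ l)"
proof -
  have "(\<Sum>\<^sub>\<infinity>n. p (x - rvec n) * \<upsilon> n $ i $ l) = (\<Sum>n | \<upsilon> n \<noteq> 0. p (x - rvec n) * \<upsilon> n $ i $ l)"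
    by (rule infsum_finite_support) (use assms in \<open>auto simp: fin_supp_def\<close>)
  then show ?thesis by (simp add: poly_conv_def)
qed

text \<open>The coefficients of the polynomial are moments of the filter, so equal moments up to
  some degree mean equal polynomials.\<close>

lemma poly_conv_expand:
  assumes "fin_supp \<upsilon>"
  shows "poly_conv (nmonom \<mu>) \<upsilon> x $ 1 $ l = (\<Sum>\<kappa> | \<kappa> \<le> \<mu>. nmonom \<kappa> x * filter_moment \<upsilon> (\<mu> - \<kappa>) l)"
proof -
  have "poly_conv (nmonom \<mu>) \<upsilon> x $ 1 $ l
      = (\<Sum>n | \<upsilon> n \<noteq> 0. \<Sum>\<kappa> | \<kappa> \<le> \<mu>. nmonom \<kappa> x * (\<upsilon> n $ 1 $ l * nmonom (\<mu> - \<kappa>) (- rvec n)))"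
    unfolding poly_conv_nth[OF assms] using nmonom_add[of \<mu> x]
    by (intro sum.cong refl) (simp add: sum_distrib_left mult_ac flip: add_uminus_conv_diff)
  also have "\<dots> = (\<Sum>\<kappa> | \<kappa> \<le> \<mu>. nmonom \<kappa> x * filter_moment \<upsilon> (\<mu> - \<kappa>) l)"
    unfolding filter_moment_def sum_distrib_left by (rule sum.swap)
  finally show ?thesis .
qed

lemma filter_moment_poly_conv:
  "fin_supp \<upsilon> \<Longrightarrow> filter_moment \<upsilon> \<mu> l = poly_conv (nmonom \<mu>) \<upsilon> 0 $ 1 $ l"
  by (simp add: poly_conv_nth filter_moment_def mult.commute)

lemma fseries_moment:
  assumes "fin_supp \<upsilon>"
  shows "Cm m (\<lambda>\<xi>. fseries \<upsilon> \<xi> $ 1 $ l)"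
    and "mderiv \<mu> (\<lambda>\<xi>. fseries \<upsilon> \<xi> $ 1 $ l) 0 = \<i> ^ mabs \<mu> * of_nat (mfact \<mu>) * filter_moment \<upsilon> \<mu> l"
  unfolding fseries_nth[OF assms] filter_moment_def by (rule Cm_wave_sum, rule mderiv_wave_sum)

lemma fseries_mask_moment:
  fixes a :: "int^'d::{finite,linorder} \<Rightarrow> complex^'r^'r"
  assumes a: "fin_supp a" and \<upsilon>: "fin_supp \<upsilon>"
  shows "Cm m (\<lambda>\<xi>. (fseries \<upsilon> (2 *\<^sub>R \<xi>) ** fseries a (\<xi> + pi *\<^sub>R rvec \<omega>)) $ 1 $ l)"
    and "mderiv \<mu> (\<lambda>\<xi>. (fseries \<upsilon> (2 *\<^sub>R \<xi>) ** fseries a (\<xi> + pi *\<^sub>R rvec \<omega>)) $ 1 $ l) 0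
      = \<i> ^ mabs \<mu> * of_nat (mfact \<mu>) * mask_moment a \<upsilon> \<omega> \<mu> l"
proof -
  let ?A = "{n. \<upsilon> n \<noteq> 0}" and ?B = "{k. a k \<noteq> 0}"
  let ?c = "\<lambda>(n, k, q). \<upsilon> n $ 1 $ q * a k $ q $ l * parity_char \<omega> k"
  let ?\<rho> = "\<lambda>(n, k, q). - (2 *\<^sub>R rvec n + rvec k)"
  have eq: "(fseries \<upsilon> (2 *\<^sub>R \<xi>) ** fseries a (\<xi> + pi *\<^sub>R rvec \<omega>)) $ 1 $ l
      = (\<Sum>x \<in> ?A \<times> ?B \<times> UNIV. ?c x * wave (?\<rho> x) \<xi>)" for \<xi>
  proof -
    have "(fseries \<upsilon> (2 *\<^sub>R \<xi>) ** fseries a (\<xi> + pi *\<^sub>R rvec \<omega>)) $ 1 $ l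
      = (\<Sum>q\<in>UNIV. \<Sum>n\<in>?A. \<Sum>k\<in>?B. \<upsilon> n $ 1 $ q * a k $ q $ l * parity_char \<omega> k * wave (- (2 *\<^sub>R rvec n + rvec k)) \<xi>)"
    proof -
      have 1: "fseries \<upsilon> (2 *\<^sub>R \<xi>) $ 1 $ q = (\<Sum>n\<in>?A. \<upsilon> n $ 1 $ q * wave (- (2 *\<^sub>R rvec n)) \<xi>)" for q
        by (simp add: fseries_nth[OF \<upsilon>] wave_scale_left)
      have 2: "fseries a (\<xi> + pi *\<^sub>R rvec \<omega>) $ q $ l
          = (\<Sum>k\<in>?B. a k $ q $ l * (wave (- rvec k) \<xi> * parity_char \<omega> k))" for q
        by (simp add: fseries_nth[OF a] wave_add_right wave_parity)
      have 3: "wave (- (2 *\<^sub>R rvec n + rvec k)) \<xi> = wave (- (2 *\<^sub>R rvec n)) \<xi> * wave (- rvec k) \<xi>" for n k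
        unfolding minus_add_distrib wave_add_left ..
      show ?thesis unfolding 3 by (simp add: matrix_matrix_mult_def 1 2 sum_product) (simp add: mult_ac)
    qed
    also have "\<dots> = (\<Sum>n\<in>?A. \<Sum>q\<in>UNIV. \<Sum>k\<in>?B. \<upsilon> n $ 1 $ q * a k $ q $ l * parity_char \<omega> k * wave (- (2 *\<^sub>R rvec n + rvec k)) \<xi>)"
      by (rule sum.swap)
    also have "\<dots> = (\<Sum>n\<in>?A. \<Sum>k\<in>?B. \<Sum>q\<in>UNIV. \<upsilon> n $ 1 $ q * a k $ q $ l * parity_char \<omega> k * wave (- (2 *\<^sub>R rvec n + rvec k)) \<xi>)"
      by (rule sum.cong[OF refl], rule sum.swap)
    also have "\<dots> = (\<Sum>x \<in> ?A \<times> ?B \<times> UNIV. ?c x * wave (?\<rho> x) \<xi>)"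
      by (simp add: sum.cartesian_product case_prod_beta)
    finally show ?thesis .
  qed
  show "Cm m (\<lambda>\<xi>. (fseries \<upsilon> (2 *\<^sub>R \<xi>) ** fseries a (\<xi> + pi *\<^sub>R rvec \<omega>)) $ 1 $ l)"
    unfolding eq by (rule Cm_wave_sum)
  show "mderiv \<mu> (\<lambda>\<xi>. (fseries \<upsilon> (2 *\<^sub>R \<xi>) ** fseries a (\<xi> + pi *\<^sub>R rvec \<omega>)) $ 1 $ l) 0
      = \<i> ^ mabs \<mu> * of_nat (mfact \<mu>) * mask_moment a \<upsilon> \<omega> \<mu> l"
    unfolding eq mderiv_wave_sum mask_moment_def by (simp add: case_prod_beta)
qed

text \<open>Both sides of each condition carry the factor i^|\<mu>| \<mu>!, which cancels. The
  frequency 0 becomes one case of a condition over all \<omega>, ready for Fourier inversion over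
  the parities.\<close>

lemma sum_rules_iff_moments:
  fixes a :: "int^'d::{finite,linorder} \<Rightarrow> complex^'r^'r"
  assumes a: "fin_supp a"
  shows "sum_rules N a \<upsilon> \<longleftrightarrow> fin_supp \<upsilon> \<and> fseries \<upsilon> 0 \<noteq> 0 \<and>
    (\<forall>\<mu> l. mabs \<mu> < N \<longrightarrow> (\<forall>\<omega>\<in>unit_cube_pts.
       mask_moment a \<upsilon> \<omega> \<mu> l = (if \<omega> = 0 then filter_moment \<upsilon> \<mu> l else 0)))"
proof (cases "fin_supp \<upsilon>")
  case True
  have nz: "\<i> ^ mabs \<mu> * of_nat (mfact \<mu>) * x = \<i> ^ mabs \<mu> * of_nat (mfact \<mu>) * y \<longleftrightarrow> x = y"
    for \<mu> :: "nat^'d::{finite,linorder}" and x y :: complex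
    by (simp add: mfact_def)
  note D = fseries_mask_moment[OF a True] fseries_moment[OF True]
  have 1: "eqO N (\<lambda>\<xi>. fseries \<upsilon> (2 *\<^sub>R \<xi>) ** fseries a (\<xi> + pi *\<^sub>R rvec 0)) (fseries \<upsilon>) \<longleftrightarrow>
      (\<forall>\<mu> l. mabs \<mu> < N \<longrightarrow> mask_moment a \<upsilon> 0 \<mu> l = filter_moment \<upsilon> \<mu> l)"
    unfolding eqO_components[OF D(1) D(3)] D(2,4) nz ..
  have 2: "eqO N (\<lambda>\<xi>. fseries \<upsilon> (2 *\<^sub>R \<xi>) ** fseries a (\<xi> + pi *\<^sub>R rvec \<omega>)) (\<lambda>\<xi>. 0) \<longleftrightarrow>
      (\<forall>\<mu> l. mabs \<mu> < N \<longrightarrow> mask_moment a \<upsilon> \<omega> \<mu> l = 0)" for \<omega>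
    using nz[where y = 0] by (subst eqO_components[OF D(1)]) (simp_all add: D(2) Cm_const)
  note 1 = 1[unfolded rvec_0 scaleR_zero_right add_0_right]
  show ?thesis unfolding sum_rules_def 1 2 using True zero_in_unit_cube_pts by auto
qed (simp add: sum_rules_def)

text \<open>In \<open>subdiv\<close> at j only mask indices of the same parity as j occur. That
  restriction is written as a sum over characters, and the binomial formula separates the dependence
  on j from the moments.\<close>

lemma subdiv_poly_conv:
  fixes a :: "int^'d \<Rightarrow> complex^'r^'r"
  assumes a: "fin_supp a" and \<upsilon>: "fin_supp \<upsilon>"
  shows "2 ^ mabs \<mu> * subdiv a (\<lambda>k. poly_conv (nmonom \<mu>) \<upsilon> (rvec k)) j $ 1 $ l
    = (\<Sum>\<kappa> | \<kappa> \<le> \<mu>. nmonom \<kappa> (rvec j) * (\<Sum>\<omega>\<in>unit_cube_pts. parity_char \<omega> j * mask_moment a \<upsilon> \<omega> (\<mu> - \<kappa>) l))"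
proof -
  let ?A = "{n. \<upsilon> n \<noteq> 0}" and ?B = "{k. a k \<noteq> 0}" and ?F = "{k. a (j - 2 *s k) \<noteq> 0}"
  \<comment> \<open>2^d times the indicator of even differences: it absorbs the factor 2^d of
    \<open>subdiv\<close> and is a full character sum.\<close>
  let ?ev = "\<lambda>k. if \<forall>i. even ((j - k) $ i) then 2 ^ CARD('d) else (0::complex)"
  let ?g = "\<lambda>n k q. \<upsilon> n $ 1 $ q * a k $ q $ l * nmonom \<mu> (rvec j - (2 *\<^sub>R rvec n + rvec k))"
  have fA: "finite ?A" and fB: "finite ?B" using a \<upsilon> by (auto simp: fin_supp_def)
  have fF: "finite ?F" by (rule finite_mask_preimage[OF a])
  have half: "2 ^ mabs \<mu> * nmonom \<mu> (rvec k - rvec n) = nmonom \<mu> (rvec j - (2 *\<^sub>R rvec n + rvec (j - 2 *s k)))" for k n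
    using nmonom_scale[of \<mu> 2 "rvec k - rvec n"] by (simp add: rvec_diff rvec_scale algebra_simps)
  have "2 ^ mabs \<mu> * subdiv a (\<lambda>k. poly_conv (nmonom \<mu>) \<upsilon> (rvec k)) j $ 1 $ l
      = 2 ^ CARD('d) * (\<Sum>k\<in>?F. \<Sum>q\<in>UNIV. \<Sum>n\<in>?A. ?g n (j - 2 *s k) q)"
    unfolding half[symmetric] by (subst subdiv_nth[OF fF]) (auto simp: poly_conv_nth[OF \<upsilon>] sum_distrib_left sum_distrib_right mult_ac)
  also have "(\<Sum>k\<in>?F. \<Sum>q\<in>UNIV. \<Sum>n\<in>?A. ?g n (j - 2 *s k) q)
      = (\<Sum>k\<in>{k \<in> ?B. \<forall>i. even ((j - k) $ i)}. \<Sum>q\<in>UNIV. \<Sum>n\<in>?A. ?g n k q)"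
  proof (rule sum.reindex_bij_witness[of _ "\<lambda>k. \<chi> i. (j - k) $ i div 2" "\<lambda>k. j - 2 *s k"])
    fix k assume k: "k \<in> {k \<in> ?B. \<forall>i. even ((j - k) $ i)}"
    show eq: "j - 2 *s (\<chi> i. (j - k) $ i div 2) = k"
      using k by (auto simp: vec_eq_iff)
    then show "(\<chi> i. (j - k) $ i div 2) \<in> ?F" using k by simp
  qed (auto simp: vec_eq_iff)
  also have "2 ^ CARD('d) * (\<Sum>k\<in>{k \<in> ?B. \<forall>i. even ((j - k) $ i)}. \<Sum>q\<in>UNIV. \<Sum>n\<in>?A. ?g n k q)
      = (\<Sum>k\<in>{k \<in> ?B. \<forall>i. even ((j - k) $ i)}. ?ev k * (\<Sum>q\<in>UNIV. \<Sum>n\<in>?A. ?g n k q))"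
    by (simp add: sum_distrib_left)
  also have "\<dots> = (\<Sum>k\<in>?B. ?ev k * (\<Sum>q\<in>UNIV. \<Sum>n\<in>?A. ?g n k q))"
    by (rule sum.mono_neutral_left[OF fB]) auto
  also have "\<dots> = (\<Sum>k\<in>?B. \<Sum>n\<in>?A. \<Sum>q\<in>UNIV. ?ev k * ?g n k q)"
    unfolding sum_distrib_left by (rule sum.cong[OF refl], rule sum.swap)
  also have "\<dots> = (\<Sum>n\<in>?A. \<Sum>k\<in>?B. \<Sum>q\<in>UNIV. ?ev k * ?g n k q)"
    by (rule sum.swap)
  also have "\<dots> = (\<Sum>(n, k, q)\<in>?A \<times> ?B \<times> UNIV. ?ev k * ?g n k q)"
    by (simp add: sum.cartesian_product)
  also have "\<dots> = (\<Sum>(n, k, q)\<in>?A \<times> ?B \<times> UNIV. \<Sum>\<kappa> | \<kappa> \<le> \<mu>. \<Sum>\<omega>\<in>unit_cube_pts.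
      nmonom \<kappa> (rvec j) * (parity_char \<omega> j * (\<upsilon> n $ 1 $ q * a k $ q $ l * parity_char \<omega> k * nmonom (\<mu> - \<kappa>) (- (2 *\<^sub>R rvec n + rvec k)))))"
  proof (rule sum.cong[OF refl], clarify)
    fix n k q
    have ev: "?ev k = (\<Sum>\<omega>\<in>unit_cube_pts. parity_char \<omega> j * parity_char \<omega> k)"
      unfolding sum_parity_char[symmetric] parity_char_diff ..
    have mo: "nmonom \<mu> (rvec j - (2 *\<^sub>R rvec n + rvec k))
        = (\<Sum>\<kappa> | \<kappa> \<le> \<mu>. nmonom \<kappa> (rvec j) * nmonom (\<mu> - \<kappa>) (- (2 *\<^sub>R rvec n + rvec k)))"
      unfolding diff_conv_add_uminus by (rule nmonom_add)
    show "?ev k * ?g n k q = (\<Sum>\<kappa> | \<kappa> \<le> \<mu>. \<Sum>\<omega>\<in>unit_cube_pts.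
      nmonom \<kappa> (rvec j) * (parity_char \<omega> j * (\<upsilon> n $ 1 $ q * a k $ q $ l * parity_char \<omega> k * nmonom (\<mu> - \<kappa>) (- (2 *\<^sub>R rvec n + rvec k)))))"
      unfolding ev mo sum_distrib_left sum_distrib_right
      by (intro sum.cong refl) (simp only: mult_ac)
  qed
  also have "\<dots> = (\<Sum>\<kappa> | \<kappa> \<le> \<mu>. \<Sum>\<omega>\<in>unit_cube_pts. \<Sum>(n, k, q)\<in>?A \<times> ?B \<times> UNIV.
      nmonom \<kappa> (rvec j) * (parity_char \<omega> j * (\<upsilon> n $ 1 $ q * a k $ q $ l * parity_char \<omega> k * nmonom (\<mu> - \<kappa>) (- (2 *\<^sub>R rvec n + rvec k)))))"
    unfolding case_prod_beta by (rule trans[OF sum.swap]) (rule sum.cong[OF refl], rule sum.swap)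
  also have "\<dots> = (\<Sum>\<kappa> | \<kappa> \<le> \<mu>. nmonom \<kappa> (rvec j) * (\<Sum>\<omega>\<in>unit_cube_pts. parity_char \<omega> j * mask_moment a \<upsilon> \<omega> (\<mu> - \<kappa>) l))"
    unfolding mask_moment_def case_prod_beta sum_distrib_left ..
  finally show ?thesis .
qed

text \<open>The value of the subdivision operator at \<open>j\<close> only involves the coset of \<open>j\<close> modulo 2; the passage
  between cosets and frequencies \<open>\<omega>\<close> is the Fourier transform of the group \<open>(\<int>/2)\<^sup>d\<close>.\<close>

lemma moments_iff_eigen:
  fixes a :: "int^'d \<Rightarrow> complex^'r^'r"
  assumes a: "fin_supp a" and \<upsilon>: "fin_supp \<upsilon>"
  shows "(\<forall>\<mu> l. mabs \<mu> < N \<longrightarrow> (\<forall>\<omega>\<in>unit_cube_pts.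
       mask_moment a \<upsilon> \<omega> \<mu> l = (if \<omega> = 0 then filter_moment \<upsilon> \<mu> l else 0))) \<longleftrightarrow>
    (\<forall>\<mu> j. mabs \<mu> < N \<longrightarrow> subdiv a (\<lambda>k. poly_conv (nmonom \<mu>) \<upsilon> (rvec k)) j
       = (1 / 2 ^ mabs \<mu>) *\<^sub>R poly_conv (nmonom \<mu>) \<upsilon> (rvec j))" (is "?M \<longleftrightarrow> ?E")
proof -
  \<comment> \<open>The defect of the moment condition on the parity class of j; the eigenvalue
    equation is triangular in these defects.\<close>
  define Z where "Z j \<mu> l = (\<Sum>\<omega>\<in>unit_cube_pts. parity_char \<omega> j * mask_moment a \<upsilon> \<omega> \<mu> l) - filter_moment \<upsilon> \<mu> l"
    for j \<mu> l
  have eig: "subdiv a (\<lambda>k. poly_conv (nmonom \<mu>) \<upsilon> (rvec k)) j = (1 / 2 ^ mabs \<mu>) *\<^sub>R poly_conv (nmonom \<mu>) \<upsilon> (rvec j)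
      \<longleftrightarrow> (\<forall>l. (\<Sum>\<kappa> | \<kappa> \<le> \<mu>. nmonom \<kappa> (rvec j) * Z j (\<mu> - \<kappa>) l) = 0)" for \<mu> j
  proof -
    let ?S = "subdiv a (\<lambda>k. poly_conv (nmonom \<mu>) \<upsilon> (rvec k)) j" and ?p = "poly_conv (nmonom \<mu>) \<upsilon> (rvec j)"
    have "?S = (1 / 2 ^ mabs \<mu>) *\<^sub>R ?p \<longleftrightarrow> (\<forall>l. ?S $ 1 $ l = ((1 / 2 ^ mabs \<mu>) *\<^sub>R ?p) $ 1 $ l)"
      by (simp only: vec_eq_iff forall_1)
    also have "\<dots> \<longleftrightarrow> (\<forall>l. 2 ^ mabs \<mu> * ?S $ 1 $ l - ?p $ 1 $ l = 0)"
    proof -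
      have "?S $ 1 $ l = ((1 / 2 ^ mabs \<mu>) *\<^sub>R ?p) $ 1 $ l \<longleftrightarrow> 2 ^ mabs \<mu> * ?S $ 1 $ l - ?p $ 1 $ l = 0" for l
        by (simp only: vector_scaleR_component) (auto simp: scaleR_conv_of_real field_simps)
      then show ?thesis by simp
    qed
    also have "\<dots> \<longleftrightarrow> (\<forall>l. (\<Sum>\<kappa> | \<kappa> \<le> \<mu>. nmonom \<kappa> (rvec j) * Z j (\<mu> - \<kappa>) l) = 0)"
      unfolding subdiv_poly_conv[OF a \<upsilon>] poly_conv_expand[OF \<upsilon>] Z_def
      by (simp add: sum_subtractf right_diff_distrib)
    finally show ?thesis .
  qed
  show ?thesis
  proof
    assume M: ?M
    have "Z j \<mu> l = 0" if "mabs \<mu> < N" for j \<mu> l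
    proof -
      have "(\<Sum>\<omega>\<in>unit_cube_pts. parity_char \<omega> j * mask_moment a \<upsilon> \<omega> \<mu> l)
          = (\<Sum>\<omega>\<in>(unit_cube_pts :: (int^'d) set). if \<omega> = 0 then filter_moment \<upsilon> \<mu> l else 0)"
        using M that by (intro sum.cong) auto
      also have "\<dots> = filter_moment \<upsilon> \<mu> l"
        by (simp add: finite_unit_cube_pts zero_in_unit_cube_pts)
      finally show ?thesis by (simp add: Z_def)
    qed
    moreover have "mabs (\<mu> - \<kappa>) < N" if "mabs \<mu> < N" "\<kappa> \<le> \<mu>" for \<mu> \<kappa> :: "nat^'d"
      using mabs_diff[OF that(2)] that(1) by linarith
    ultimately show ?E unfolding eig by (auto intro!: sum.neutral)
  next
    assume E: ?E
    have E': "(\<Sum>\<kappa> | \<kappa> \<le> \<mu>. nmonom \<kappa> (rvec j) * Z j (\<mu> - \<kappa>) l) = 0" if "mabs \<mu> < N" for \<mu> j l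
      using E that unfolding eig by blast
    \<comment> \<open>The term \<kappa> = 0 is the defect of order \<mu> itself and all others have
      lower order, so induction on the degree applies.\<close>
    have Z: "Z j \<mu> l = 0" if "mabs \<mu> < N" for j \<mu> l
      using that
    proof (induction "mabs \<mu>" arbitrary: \<mu> rule: less_induct)
      case less
      have "0 = (\<Sum>\<kappa> | \<kappa> \<le> \<mu>. nmonom \<kappa> (rvec j) * Z j (\<mu> - \<kappa>) l)"
        using E'[OF less.prems] by simp
      also have "\<dots> = (\<Sum>\<kappa> | \<kappa> \<le> \<mu>. if \<kappa> = 0 then Z j \<mu> l else 0)"
      proof (rule sum.cong[OF refl])
        fix \<kappa> assume "\<kappa> \<in> {\<kappa>. \<kappa> \<le> \<mu>}"
        then have s: "mabs (\<mu> - \<kappa>) + mabs \<kappa> = mabs \<mu>" using mabs_diff by blast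
        show "nmonom \<kappa> (rvec j) * Z j (\<mu> - \<kappa>) l = (if \<kappa> = 0 then Z j \<mu> l else 0)"
        proof (cases "\<kappa> = 0")
          case False
          then have "mabs \<kappa> \<noteq> 0" by (simp add: mabs_eq_0_iff)
          then have "Z j (\<mu> - \<kappa>) l = 0" using s less.prems by (intro less.hyps) linarith+
          then show ?thesis using False by simp
        qed simp
      qed
      also have "\<dots> = Z j \<mu> l" using finite_multiindex_le[of \<mu>] by (simp add: less_eq_vec_def)
      finally show ?case by simp
    qed
    show ?M
    proof (intro allI impI ballI)
      fix \<mu> :: "nat^'d" and l and \<omega>' :: "int^'d" assume \<mu>: "mabs \<mu> < N" and \<omega>': "\<omega>' \<in> unit_cube_pts"
      let ?L = "\<lambda>\<omega>. mask_moment a \<upsilon> \<omega> \<mu> l"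
      \<comment> \<open>Fourier inversion: weighting by the character of \<omega>' and summing over
        the parities j isolates the frequency \<omega>'.\<close>
      have "(\<Sum>j\<in>unit_cube_pts. parity_char j \<omega>' * (\<Sum>\<omega>\<in>unit_cube_pts. parity_char \<omega> j * ?L \<omega>))
          = (\<Sum>j\<in>unit_cube_pts. parity_char j \<omega>' * filter_moment \<upsilon> \<mu> l)"
        using Z[OF \<mu>] by (simp add: Z_def)
      moreover have "(\<Sum>j\<in>unit_cube_pts. parity_char j \<omega>' * (\<Sum>\<omega>\<in>unit_cube_pts. parity_char \<omega> j * ?L \<omega>))
          = (\<Sum>\<omega>\<in>unit_cube_pts. (\<Sum>j\<in>unit_cube_pts. parity_char j (\<omega>' - \<omega>)) * ?L \<omega>)"
        unfolding sum_distrib_left sum_distrib_right parity_char_diff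
        by (subst sum.swap) (simp add: parity_char_commute mult_ac)
      moreover have "(\<Sum>j\<in>unit_cube_pts. parity_char j (\<omega>' - \<omega>)) = (if \<omega> = \<omega>' then 2 ^ CARD('d) else 0)"
        if "\<omega> \<in> unit_cube_pts" for \<omega>
      proof -
        have "(\<forall>i. even ((\<omega>' - \<omega>) $ i)) \<longleftrightarrow> \<omega> = \<omega>'"
        proof
          assume ev: "\<forall>i. even ((\<omega>' - \<omega>) $ i)"
          have "\<omega> $ i = \<omega>' $ i" for i
          proof -
            have "\<omega> $ i \<in> {0, 1}" "\<omega>' $ i \<in> {0, 1}" using that \<omega>' unfolding unit_cube_pts_eq by auto
            moreover have "even (\<omega>' $ i - \<omega> $ i)" using ev by (metis vector_minus_component)
            ultimately show ?thesis by auto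
          qed
          then show "\<omega> = \<omega>'" by (simp add: vec_eq_iff)
        qed simp
        then show ?thesis unfolding sum_parity_char by simp
      qed
      ultimately have "(\<Sum>\<omega>\<in>unit_cube_pts. (if \<omega> = \<omega>' then 2 ^ CARD('d) else 0) * ?L \<omega>)
          = (\<Sum>j\<in>unit_cube_pts. parity_char j \<omega>') * filter_moment \<upsilon> \<mu> l"
        by (simp add: sum_distrib_right)
      also have "(\<Sum>j\<in>unit_cube_pts. parity_char j \<omega>') = (if \<omega>' = 0 then 2 ^ CARD('d) else 0)"
      proof -
        have "(\<forall>i. even (\<omega>' $ i)) \<longleftrightarrow> \<omega>' = 0"
        proof
          assume ev: "\<forall>i. even (\<omega>' $ i)"
          have "\<omega>' $ i = 0" for i
          proof -
            have "\<omega>' $ i \<in> {0, 1}" using \<omega>' unfolding unit_cube_pts_eq by auto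
            then show ?thesis using ev by (metis empty_iff insert_iff odd_one)
          qed
          then show "\<omega>' = 0" by (simp add: vec_eq_iff)
        qed simp
        then show ?thesis unfolding sum_parity_char by simp
      qed
      also have "(\<Sum>\<omega>\<in>unit_cube_pts. (if \<omega> = \<omega>' then 2 ^ CARD('d) else 0) * ?L \<omega>) = 2 ^ CARD('d) * ?L \<omega>'"
        using \<omega>' by (simp add: finite_unit_cube_pts if_distrib[of "\<lambda>x. x * y" for y] cong: if_cong)
      finally show "?L \<omega>' = (if \<omega>' = 0 then filter_moment \<upsilon> \<mu> l else 0)"
        by (auto split: if_splits)
    qed
  qed
qed

section \<open>Matching filters\<close>

lemma Cm_mult:
  fixes f g :: "real^'d \<Rightarrow> complex"
  shows "Cm m f \<Longrightarrow> Cm m g \<Longrightarrow> Cm m (\<lambda>x. f x * g x)"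
proof (induction m arbitrary: f g)
  case 0
  then show ?case by (auto intro: continuous_intros)
next
  case (Suc m)
  have "has_pd i (\<lambda>x. f x * g x) (\<lambda>x. f x * partial_deriv i g x + partial_deriv i f x * g x)" for i
    by (rule has_pd_mult[OF Cm_Suc_has_pd[OF Suc.prems(1)] Cm_Suc_has_pd[OF Suc.prems(2)]])
  moreover have "Cm m (\<lambda>x. f x * partial_deriv i g x + partial_deriv i f x * g x)" for i
    by (rule Cm_add[OF Suc.IH[OF Cm_SucD[OF Suc.prems(1)] Cm_Suc_pd[OF Suc.prems(2)]]
          Suc.IH[OF Cm_Suc_pd[OF Suc.prems(1)] Cm_SucD[OF Suc.prems(2)]]])
  moreover have "continuous_on UNIV (\<lambda>x. f x * g x)"
    by (rule continuous_on_mult[OF Cm_continuous[OF Suc.prems(1)] Cm_continuous[OF Suc.prems(2)]])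
  ultimately show ?case unfolding Cm_Suc_iff by blast
qed

text \<open>Leibniz's rule at 0 in each coordinate: only the terms where exactly
  \<open>\<nu> $ i\<close> derivatives hit the monomial survive. The induction over \<mu> amounts to
  Pascal's rule, \<open>b_Suc\<close>.\<close>

lemma mderiv_nmonom_wave:
  fixes \<rho> :: "real^'d::{finite,linorder}"
  shows "mderiv \<mu> (\<lambda>x. nmonom \<nu> x * wave \<rho> x) 0
    = (\<Prod>i\<in>UNIV. of_nat (\<mu> $ i choose \<nu> $ i) * (\<i> * of_real (\<rho> $ i)) ^ (\<mu> $ i - \<nu> $ i))"
proof (induction \<mu> arbitrary: \<nu> rule: multiindex_induct)
  case zero
  show ?case
  proof (cases "\<nu> = 0")
    case False
    then obtain i where "\<nu> $ i \<noteq> 0" by (auto simp: vec_eq_iff)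
    then have "of_nat ((0 :: nat^'d::{finite,linorder}) $ i choose \<nu> $ i)
        * (\<i> * complex_of_real (\<rho> $ i)) ^ ((0 :: nat^'d::{finite,linorder}) $ i - \<nu> $ i) = 0"
      by (simp add: binomial_eq_0)
    then show ?thesis using False by (subst prod_zero) (auto simp: nmonom_at_0)
  qed simp
next
  case (add \<mu> i)
  have C: "Cm m (\<lambda>x. nmonom \<kappa> x * wave \<rho> x)" for m \<kappa>
    using Cm_mult[OF Cm_nmonom Cm_wave[of _ 1]] by simp
  have C0: "Cm m (\<lambda>x. if \<nu> $ i = 0 then 0 else nmonom (\<nu> - axis i 1) x * wave \<rho> x)" for m
    using C Cm_const[of m "0::complex"] by (cases "\<nu> $ i = 0") simp_all
  define b where "b n k z = of_nat (n choose k) * z ^ (n - k)" for n k :: nat and z :: complex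
  let ?z = "\<lambda>j. \<i> * complex_of_real (\<rho> $ j)"
  let ?rest = "\<lambda>\<kappa> :: nat^'d::{finite,linorder}. \<Prod>j\<in>UNIV - {i}. b (\<mu> $ j) (\<kappa> $ j) (?z j)"
  have IH: "mderiv \<mu> (\<lambda>x. nmonom \<kappa> x * wave \<rho> x) 0 = b (\<mu> $ i) (\<kappa> $ i) (?z i) * ?rest \<kappa>" for \<kappa>
    unfolding add.IH b_def by (subst prod.remove[of UNIV i]) auto
  have b_0: "b (Suc n) 0 z = z * b n 0 z" for n z by (simp add: b_def)
  have b_Suc: "b (Suc n) (Suc k) z = b n k z + z * b n (Suc k) z" for n k z
  proof (cases "n \<le> k")
    case True
    then show ?thesis by (cases "n = k") (simp_all add: b_def binomial_eq_0)
  next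
    case False
    then have "n - k = Suc (n - Suc k)" by simp
    then show ?thesis by (simp add: b_def algebra_simps)
  qed
  have "has_pd i (\<lambda>x. nmonom \<nu> x * wave \<rho> x)
      (\<lambda>x. nmonom \<nu> x * (\<i> * of_real (\<rho> $ i) * wave \<rho> x) + (if \<nu> $ i = 0 then 0 else nmonom (\<nu> - axis i 1) x) * wave \<rho> x)"
    by (rule has_pd_mult[OF has_pd_nmonom has_pd_wave])
  moreover have "(\<lambda>x. nmonom \<nu> x * (\<i> * of_real (\<rho> $ i) * wave \<rho> x) + (if \<nu> $ i = 0 then 0 else nmonom (\<nu> - axis i 1) x) * wave \<rho> x)
      = (\<lambda>x. ?z i * (nmonom \<nu> x * wave \<rho> x) + (if \<nu> $ i = 0 then 0 else nmonom (\<nu> - axis i 1) x * wave \<rho> x))"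
    by (auto simp: fun_eq_iff)
  ultimately have "has_pd i (\<lambda>x. nmonom \<nu> x * wave \<rho> x)
      (\<lambda>x. ?z i * (nmonom \<nu> x * wave \<rho> x) + (if \<nu> $ i = 0 then 0 else nmonom (\<nu> - axis i 1) x * wave \<rho> x))"
    by (simp only:)
  from has_pd_partial_deriv[OF this] have "mderiv (\<mu> + axis i 1) (\<lambda>x. nmonom \<nu> x * wave \<rho> x) 0
      = mderiv \<mu> (\<lambda>x. ?z i * (nmonom \<nu> x * wave \<rho> x) + (if \<nu> $ i = 0 then 0 else nmonom (\<nu> - axis i 1) x * wave \<rho> x)) 0"
    by (simp only: mderiv_add_axis[OF C])
  also have "\<dots> = ?z i * mderiv \<mu> (\<lambda>x. nmonom \<nu> x * wave \<rho> x) 0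
      + mderiv \<mu> (\<lambda>x. if \<nu> $ i = 0 then 0 else nmonom (\<nu> - axis i 1) x * wave \<rho> x) 0"
    by (subst mderiv_add[OF Cm_linear[OF bounded_linear_mult_right C] C0])
       (simp only: mderiv_linear[OF bounded_linear_mult_right C])
  also have "mderiv \<mu> (\<lambda>x. if \<nu> $ i = 0 then 0 else nmonom (\<nu> - axis i 1) x * wave \<rho> x) 0
      = (if \<nu> $ i = 0 then 0 else mderiv \<mu> (\<lambda>x. nmonom (\<nu> - axis i 1) x * wave \<rho> x) 0)"
    by (cases "\<nu> $ i = 0") simp_all
  also have "?z i * mderiv \<mu> (\<lambda>x. nmonom \<nu> x * wave \<rho> x) 0
      + (if \<nu> $ i = 0 then 0 else mderiv \<mu> (\<lambda>x. nmonom (\<nu> - axis i 1) x * wave \<rho> x) 0)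
      = b (Suc (\<mu> $ i)) (\<nu> $ i) (?z i) * ?rest \<nu>"
  proof (cases "\<nu> $ i")
    case 0
    then show ?thesis by (simp add: IH b_0)
  next
    case (Suc k)
    have "?rest (\<nu> - axis i 1) = ?rest \<nu>" by (rule prod.cong) (auto simp: axis_def)
    moreover have "(\<nu> - axis i 1) $ i = k" using Suc by simp
    ultimately show ?thesis using Suc unfolding IH by (simp add: b_Suc algebra_simps)
  qed
  also have "\<dots> = (\<Prod>j\<in>UNIV. b ((\<mu> + axis i 1) $ j) (\<nu> $ j) (?z j))"
    by (subst prod.remove[of UNIV i]) (auto simp: axis_def intro!: prod.cong)
  finally show ?case by (simp only: b_def)
qed

text \<open>The factor i^|\<mu>| \<mu>! is the same as in \<open>fseries_moment\<close>, so
  agreement of a filter with the target says that its moments are the derivatives of the normalized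
  monomials at the translation points.\<close>

lemma mderiv_matching_target:
  fixes \<rho> :: "real^'d::{finite,linorder}"
  shows "Cm m (\<lambda>\<xi>. \<i> ^ mabs \<nu> * complex_of_real (mpow \<xi> \<nu>) * exp (\<i> * complex_of_real (\<rho> \<bullet> \<xi>)))"
    and "mderiv \<mu> (\<lambda>\<xi>. \<i> ^ mabs \<nu> * complex_of_real (mpow \<xi> \<nu>) * exp (\<i> * complex_of_real (\<rho> \<bullet> \<xi>))) 0
      = \<i> ^ mabs \<mu> * of_nat (mfact \<mu>) * mderiv \<nu> (nmonom \<mu>) \<rho>"
proof -
  have eq: "(\<lambda>\<xi>. \<i> ^ mabs \<nu> * complex_of_real (mpow \<xi> \<nu>) * exp (\<i> * complex_of_real (\<rho> \<bullet> \<xi>)))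
      = (\<lambda>\<xi>. (\<i> ^ mabs \<nu> * of_nat (mfact \<nu>)) * (nmonom \<nu> \<xi> * wave \<rho> \<xi>))"
    by (simp add: fun_eq_iff wave_def mult_ac flip: nmonom_mpow)
  have C: "Cm m (\<lambda>x. nmonom \<nu> x * wave \<rho> x)" for m
    using Cm_mult[OF Cm_nmonom Cm_wave[of _ 1]] by simp
  show "Cm m (\<lambda>\<xi>. \<i> ^ mabs \<nu> * complex_of_real (mpow \<xi> \<nu>) * exp (\<i> * complex_of_real (\<rho> \<bullet> \<xi>)))"
    unfolding eq by (rule Cm_linear[OF bounded_linear_mult_right C])
  let ?t = "\<lambda>i. of_nat (\<mu> $ i choose \<nu> $ i) * (\<i> * complex_of_real (\<rho> $ i)) ^ (\<mu> $ i - \<nu> $ i)"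
  have val: "mderiv \<mu> (\<lambda>\<xi>. \<i> ^ mabs \<nu> * complex_of_real (mpow \<xi> \<nu>) * exp (\<i> * complex_of_real (\<rho> \<bullet> \<xi>))) 0
      = \<i> ^ mabs \<nu> * of_nat (mfact \<nu>) * (\<Prod>i\<in>UNIV. ?t i)"
    unfolding eq mderiv_linear[OF bounded_linear_mult_right C] mderiv_nmonom_wave ..
  show "mderiv \<mu> (\<lambda>\<xi>. \<i> ^ mabs \<nu> * complex_of_real (mpow \<xi> \<nu>) * exp (\<i> * complex_of_real (\<rho> \<bullet> \<xi>))) 0
      = \<i> ^ mabs \<mu> * of_nat (mfact \<mu>) * mderiv \<nu> (nmonom \<mu>) \<rho>"
  proof (cases "\<nu> \<le> \<mu>")
    case True
    have "\<i> ^ mabs \<nu> * of_nat (mfact \<nu>) * (\<Prod>i\<in>UNIV. ?t i)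
        = (\<Prod>i\<in>UNIV. \<i> ^ (\<nu> $ i) * fact (\<nu> $ i) * ?t i)"
      by (simp add: mabs_def mfact_def power_sum prod.distrib)
    also have "\<dots> = (\<Prod>i\<in>UNIV. \<i> ^ (\<mu> $ i) * fact (\<mu> $ i) * of_real ((\<rho> $ i) ^ ((\<mu> - \<nu>) $ i) / fact ((\<mu> - \<nu>) $ i)))"
    proof (rule prod.cong[OF refl])
      fix i
      have le: "\<nu> $ i \<le> \<mu> $ i" using True by (simp add: less_eq_vec_def)
      then have "\<i> ^ (\<mu> $ i) = \<i> ^ (\<nu> $ i) * \<i> ^ (\<mu> $ i - \<nu> $ i)" by (simp flip: power_add)
      then show "\<i> ^ (\<nu> $ i) * fact (\<nu> $ i) * ?t i
          = \<i> ^ (\<mu> $ i) * fact (\<mu> $ i) * of_real ((\<rho> $ i) ^ ((\<mu> - \<nu>) $ i) / fact ((\<mu> - \<nu>) $ i))"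
        using le by (simp add: binomial_fact power_mult_distrib field_simps)
    qed
    also have "\<dots> = \<i> ^ mabs \<mu> * of_nat (mfact \<mu>) * nmonom (\<mu> - \<nu>) \<rho>"
      unfolding nmonom_prod prod.distrib mabs_def mfact_def power_sum by simp
    finally show ?thesis using True unfolding val by (simp add: mderiv_nmonom)
  next
    case False
    then obtain i where "\<mu> $ i < \<nu> $ i" by (auto simp: less_eq_vec_def not_le)
    then have "?t i = 0" by (simp add: binomial_eq_0)
    then have "(\<Prod>i\<in>UNIV. ?t i) = 0" by (intro prod_zero) auto
    then show ?thesis using False unfolding val by (simp add: mderiv_nmonom)
  qed
qed

text \<open>On the m + 1 nodes -z the weights are s! times the s-th coefficients of the Lagrange
  basis polynomials, because interpolation is exact up to degree m. The minus sign matches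
  \<open>filter_moment\<close>, which evaluates at \<open>- rvec n\<close>.\<close>

lemma lagrange_weights:
  obtains c :: "nat \<Rightarrow> int \<Rightarrow> complex" where
    "\<And>s t. s \<le> m \<Longrightarrow> t \<le> m \<Longrightarrow> (\<Sum>z\<in>{0..int m}. c s z * ((- of_int z) ^ t / fact t)) = (if s = t then 1 else 0)"
proof -
  define N where "N = {0..int m}"
  define x :: "int \<Rightarrow> complex" where "x z = - of_int z" for z
  define Q where "Q z = (\<Prod>w\<in>N - {z}. [:- x w, 1:])" for z
  define L where "L z = smult (1 / poly (Q z) (x z)) (Q z)" for z
  have fN: "finite N" and cN: "card N = Suc m" by (simp_all add: N_def)
  have xi: "x z = x w \<longleftrightarrow> z = w" for z w by (simp add: x_def)
  have Qz: "poly (Q z) (x w) = (\<Prod>v\<in>N - {z}. x w - x v)" for z w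
    by (simp add: Q_def poly_prod)
  have Qnz: "poly (Q z) (x z) \<noteq> 0" for z using fN by (simp add: Qz xi)
  have Lz: "poly (L z) (x w) = (if z = w then 1 else 0)" if "w \<in> N" for z w
  proof (cases "z = w")
    case True
    then show ?thesis using Qnz by (simp add: L_def)
  next
    case False
    then have "poly (Q z) (x w) = 0" unfolding Qz using that fN by (intro prod_zero) auto
    then show ?thesis using False by (simp add: L_def)
  qed
  have degQ: "degree (Q z) \<le> m" if "z \<in> N" for z
  proof -
    have "degree (Q z) \<le> (\<Sum>w\<in>N - {z}. degree [:- x w, 1:])"
      using degree_prod_sum_le[of "N - {z}" "\<lambda>w. [:- x w, 1:]"] fN by (simp add: Q_def o_def)
    also have "\<dots> = m" using fN cN that by simp
    finally show ?thesis .
  qed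
  have degL: "degree (L z) \<le> m" if "z \<in> N" for z
    unfolding L_def by (rule order_trans[OF degree_smult_le degQ[OF that]])
  \<comment> \<open>The difference has degree at most m and m + 1 roots.\<close>
  have interp: "(\<Sum>z\<in>N. smult (poly p (x z)) (L z)) = p" if "degree p \<le> m" for p
  proof (rule ccontr)
    let ?d = "(\<Sum>z\<in>N. smult (poly p (x z)) (L z)) - p"
    assume "(\<Sum>z\<in>N. smult (poly p (x z)) (L z)) \<noteq> p"
    then have nz: "?d \<noteq> 0" by simp
    have "degree ?d \<le> m"
      using degL that by (intro degree_diff_le degree_sum_le[OF fN]) (auto intro: order_trans[OF degree_smult_le])
    moreover have "x ` N \<subseteq> {y. poly ?d y = 0}"
    proof
      fix y assume "y \<in> x ` N"
      then obtain w where w: "w \<in> N" "y = x w" by auto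
      have "(\<Sum>z\<in>N. poly p (x z) * poly (L z) (x w)) = (\<Sum>z\<in>N. if z = w then poly p (x w) else 0)"
        using w by (intro sum.cong) (auto simp: Lz)
      then show "y \<in> {y. poly ?d y = 0}" using w fN by (simp add: poly_sum)
    qed
    then have "card (x ` N) \<le> card {y. poly ?d y = 0}"
      by (rule card_mono[OF poly_roots_finite[OF nz]])
    moreover have "card (x ` N) = Suc m" using cN by (subst card_image) (auto simp: inj_on_def xi)
    moreover have "card {y. poly ?d y = 0} \<le> degree ?d" by (rule card_poly_roots_bound[OF nz])
    ultimately show False by simp
  qed
  show thesis
  proof (rule that[of "\<lambda>s z. coeff (L z) s * fact s"])
    fix s t assume "s \<le> m" "t \<le> m"
    have "(\<Sum>z\<in>N. smult (poly (monom 1 t) (x z)) (L z)) = monom 1 t"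
      using \<open>t \<le> m\<close> by (intro interp) (simp add: degree_monom_eq)
    then have "(\<Sum>z\<in>N. x z ^ t * coeff (L z) s) = (if s = t then 1 else 0)"
      by (metis (no_types, lifting) coeff_monom coeff_smult coeff_sum mult_1 poly_monom sum.cong)
    then have "(fact s / fact t) * (\<Sum>z\<in>N. x z ^ t * coeff (L z) s) = (if s = t then 1 else 0)"
      by simp
    then show "(\<Sum>z\<in>{0..int m}. coeff (L z) s * fact s * ((- of_int z) ^ t / fact t)) = (if s = t then 1 else 0)"
      by (simp add: sum_distrib_left N_def x_def mult_ac)
  qed
qed

text \<open>Tensor products of the one-dimensional weights are dual to the normalized monomials, so
  the filter is the combination of them with coefficients h.\<close>

lemma exists_filter_moments:
  fixes h :: "nat^'d \<Rightarrow> 'r::finite \<Rightarrow> complex"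
  obtains \<upsilon> :: "int^'d \<Rightarrow> complex^'r^1" where "fin_supp \<upsilon>"
    "\<And>\<mu> l. mabs \<mu> \<le> m \<Longrightarrow> filter_moment \<upsilon> \<mu> l = h \<mu> l"
proof -
  obtain c :: "nat \<Rightarrow> int \<Rightarrow> complex" where c: "\<And>s t. s \<le> m \<Longrightarrow> t \<le> m \<Longrightarrow>
      (\<Sum>z\<in>{0..int m}. c s z * ((- of_int z) ^ t / fact t)) = (if s = t then 1 else 0)"
    using lagrange_weights by blast
  let ?B = "{n :: int^'d. \<forall>i. n $ i \<in> {0..int m}}"
  define \<upsilon> :: "int^'d \<Rightarrow> complex^'r^1" where
    "\<upsilon> n = (\<chi> _ l. if n \<in> ?B then (\<Sum>\<kappa> | mabs \<kappa> \<le> m. h \<kappa> l * (\<Prod>i\<in>UNIV. c (\<kappa> $ i) (n $ i))) else 0)" for n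
  have fB: "finite ?B" by (rule finite_vec_set) simp
  have supp: "{n. \<upsilon> n \<noteq> 0} \<subseteq> ?B" by (auto simp: \<upsilon>_def vec_eq_iff split: if_splits)
  have le: "\<kappa> $ i \<le> m" if "mabs \<kappa> \<le> m" for \<kappa> :: "nat^'d" and i
    using that member_le_sum[of i UNIV "\<lambda>i. \<kappa> $ i"] by (simp add: mabs_def)
  have dual: "(\<Sum>n\<in>?B. (\<Prod>i\<in>UNIV. c (\<kappa> $ i) (n $ i)) * nmonom \<mu> (- rvec n)) = (if \<kappa> = \<mu> then 1 else 0)"
    if "mabs \<kappa> \<le> m" "mabs \<mu> \<le> m" for \<kappa> \<mu> :: "nat^'d"
  proof -
    have "(\<Sum>n\<in>?B. (\<Prod>i\<in>UNIV. c (\<kappa> $ i) (n $ i)) * nmonom \<mu> (- rvec n))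
        = (\<Sum>n\<in>?B. \<Prod>i\<in>UNIV. c (\<kappa> $ i) (n $ i) * ((- of_int (n $ i)) ^ (\<mu> $ i) / fact (\<mu> $ i)))"
      unfolding nmonom_prod prod.distrib[symmetric] by simp
    also have "\<dots> = (\<Prod>i\<in>UNIV. \<Sum>z\<in>{0..int m}. c (\<kappa> $ i) z * ((- of_int z) ^ (\<mu> $ i) / fact (\<mu> $ i)))"
      by (rule prod_sum_vec[symmetric]) simp
    also have "\<dots> = (\<Prod>i\<in>UNIV. if \<kappa> $ i = \<mu> $ i then 1 else 0)"
      by (intro prod.cong refl c le that)
    also have "\<dots> = (if \<kappa> = \<mu> then 1 else 0)" by (auto simp: vec_eq_iff)
    finally show ?thesis .
  qed
  show thesis
  proof (rule that[of \<upsilon>])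
    show "fin_supp \<upsilon>" unfolding fin_supp_def by (rule finite_subset[OF supp fB])
    fix \<mu> :: "nat^'d" and l assume \<mu>: "mabs \<mu> \<le> m"
    have "filter_moment \<upsilon> \<mu> l = (\<Sum>n\<in>?B. \<upsilon> n $ 1 $ l * nmonom \<mu> (- rvec n))"
      unfolding filter_moment_def by (rule sum.mono_neutral_left[OF fB supp]) auto
    also have "\<dots> = (\<Sum>n\<in>?B. \<Sum>\<kappa> | mabs \<kappa> \<le> m. h \<kappa> l * ((\<Prod>i\<in>UNIV. c (\<kappa> $ i) (n $ i)) * nmonom \<mu> (- rvec n)))"
      by (intro sum.cong refl) (simp add: \<upsilon>_def sum_distrib_right mult.assoc)
    also have "\<dots> = (\<Sum>\<kappa> | mabs \<kappa> \<le> m. h \<kappa> l * (\<Sum>n\<in>?B. (\<Prod>i\<in>UNIV. c (\<kappa> $ i) (n $ i)) * nmonom \<mu> (- rvec n)))"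
      unfolding sum_distrib_left by (rule sum.swap)
    also have "\<dots> = (\<Sum>\<kappa> | mabs \<kappa> \<le> m. if \<kappa> = \<mu> then h \<mu> l else 0)"
      using \<mu> by (intro sum.cong refl, subst dual) auto
    also have "\<dots> = h \<mu> l" using \<mu> by (simp add: finite_mabs_le)
    finally show "filter_moment \<upsilon> \<mu> l = h \<mu> l" .
  qed
qed

text \<open>Elimination: with a pivot s0, each other vector \<open>A s\<close> is reduced by a
  multiple of \<open>A s0\<close> so that its entry at e vanishes. A dependence of the reduced
  vectors lifts to the original ones with the coefficient - r at s0.\<close>

lemma linear_dependence:
  fixes A :: "'s \<Rightarrow> 'e \<Rightarrow> complex"
  assumes "finite E" "finite S" "card E < card S"
  shows "\<exists>\<alpha>. (\<exists>s\<in>S. \<alpha> s \<noteq> 0) \<and> (\<forall>e\<in>E. (\<Sum>s\<in>S. \<alpha> s * A s e) = 0)"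
  using assms
proof (induction E arbitrary: S A rule: finite_induct)
  case empty
  then have "S \<noteq> {}" by auto
  then show ?case by (intro exI[of _ "\<lambda>_. 1"]) auto
next
  case (insert e E)
  show ?case
  proof (cases "\<forall>s\<in>S. A s e = 0")
    case True
    have "card E < card S" using insert by simp
    then obtain \<alpha> where "\<exists>s\<in>S. \<alpha> s \<noteq> 0" "\<forall>x\<in>E. (\<Sum>s\<in>S. \<alpha> s * A s x) = 0"
      using insert.IH[OF insert.prems(1), of A] by blast
    then show ?thesis using True by (intro exI[of _ \<alpha>]) auto
  next
    case False
    then obtain s0 where s0: "s0 \<in> S" "A s0 e \<noteq> 0" by auto
    define A' where "A' s x = A s x - A s e / A s0 e * A s0 x" for s x
    have "card E < card (S - {s0})" using insert s0 by simp
    then obtain \<alpha> where \<alpha>: "\<exists>s\<in>S - {s0}. \<alpha> s \<noteq> 0" "\<forall>x\<in>E. (\<Sum>s\<in>S - {s0}. \<alpha> s * A' s x) = 0"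
      using insert.IH[of "S - {s0}" A'] insert.prems(1) by blast
    define r where "r = (\<Sum>s\<in>S - {s0}. \<alpha> s * (A s e / A s0 e))"
    define \<beta> where "\<beta> s = (if s = s0 then - r else \<alpha> s)" for s
    have split: "(\<Sum>s\<in>S. \<beta> s * A s x) = - r * A s0 x + (\<Sum>s\<in>S - {s0}. \<alpha> s * A s x)" for x
    proof -
      have "(\<Sum>s\<in>S. \<beta> s * A s x) = \<beta> s0 * A s0 x + (\<Sum>s\<in>S - {s0}. \<beta> s * A s x)"
        using insert.prems(1) s0(1) by (rule sum.remove)
      also have "(\<Sum>s\<in>S - {s0}. \<beta> s * A s x) = (\<Sum>s\<in>S - {s0}. \<alpha> s * A s x)"
        by (rule sum.cong) (auto simp: \<beta>_def)
      finally show ?thesis by (simp add: \<beta>_def)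
    qed
    have "(\<Sum>s\<in>S. \<beta> s * A s e) = 0"
      unfolding split r_def using s0(2) by (simp add: sum_distrib_right)
    moreover have "(\<Sum>s\<in>S. \<beta> s * A s x) = 0" if "x \<in> E" for x
    proof -
      have "(\<Sum>s\<in>S - {s0}. \<alpha> s * A' s x) = (\<Sum>s\<in>S - {s0}. \<alpha> s * A s x) - r * A s0 x"
        unfolding A'_def r_def sum_distrib_right by (simp add: right_diff_distrib sum_subtractf mult_ac)
      then show ?thesis using \<alpha>(2) that unfolding split by simp
    qed
    moreover have "\<exists>s\<in>S. \<beta> s \<noteq> 0" using \<alpha>(1) by (auto simp: \<beta>_def)
    ultimately show ?thesis by (intro exI[of _ \<beta>]) auto
  qed
qed

section \<open>Reproduction of polynomials by the interpolant\<close>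

lemma periodic_bounded:
  fixes g :: "real^'d \<Rightarrow> complex"
  assumes cont: "continuous_on UNIV g" and per: "\<And>x k. g (x + rvec k) = g x"
  obtains B where "0 \<le> B" "\<And>x. norm (g x) \<le> B"
proof -
  have "bounded (g ` cbox 0 1)"
    by (intro compact_imp_bounded compact_continuous_image) (auto intro: continuous_on_subset[OF cont])
  then obtain B where B: "\<forall>y\<in>g ` cbox 0 1. norm y \<le> B" unfolding bounded_iff by blast
  have bd: "norm (g x) \<le> B" for x
  proof -
    have "g x = g (x - rvec (ivec x))" using per[of "x - rvec (ivec x)" "ivec x"] by simp
    moreover have "x - rvec (ivec x) \<in> cbox 0 1" using ivec_frac unit_cube_subset by blast
    ultimately show ?thesis using B by simp
  qed
  moreover have "0 \<le> B" using order_trans[OF norm_ge_zero bd[of 0]] .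
  ultimately show thesis using that by blast
qed

text \<open>Along x, 2x, 4x, ... the values grow by the factor 2^s while periodicity keeps them
  bounded.\<close>

lemma homogeneous_periodic_zero:
  fixes g :: "real^'d \<Rightarrow> complex"
  assumes "continuous_on UNIV g" "\<And>x k. g (x + rvec k) = g x"
    and hom: "\<And>x. g (2 *\<^sub>R x) = 2 ^ s * g x" and "s \<noteq> 0"
  shows "g x = 0"
proof -
  obtain B where B: "\<And>x. norm (g x) \<le> B" using periodic_bounded[OF assms(1,2)] by metis
  have pow: "g (2 ^ n *\<^sub>R x) = 2 ^ (s * n) * g x" for n
  proof (induction n)
    case (Suc n)
    have "g (2 ^ Suc n *\<^sub>R x) = 2 ^ s * g (2 ^ n *\<^sub>R x)" using hom[of "2 ^ n *\<^sub>R x"] by simp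
    then show ?case by (simp add: Suc power_add)
  qed simp
  have "norm (g x) \<le> B * (1 / 2) ^ n" for n
  proof -
    have "(2::real) ^ n * norm (g x) \<le> 2 ^ (s * n) * norm (g x)"
      using assms(4) by (intro mult_right_mono power_increasing) auto
    also have "\<dots> \<le> B" using B[of "2 ^ n *\<^sub>R x"] unfolding pow by (simp add: norm_mult norm_power)
    finally show ?thesis by (simp add: power_one_over field_simps)
  qed
  moreover have "(\<lambda>n. B * (1 / 2) ^ n) \<longlonglongrightarrow> B * 0"
    by (intro tendsto_mult tendsto_const LIMSEQ_power_zero) simp
  ultimately have "norm (g x) \<le> B * 0" by (intro LIMSEQ_le_const) auto
  then show ?thesis by simp
qed

text \<open>The values at x and 2^-n x agree, and the latter tend to the value at 0.\<close>

lemma dilation_invariant_const: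
  fixes g :: "real^'d \<Rightarrow> complex"
  assumes "continuous_on UNIV g" and inv: "\<And>x. g (2 *\<^sub>R x) = g x"
  shows "g x = g 0"
proof -
  have "g ((1 / 2) ^ n *\<^sub>R x) = g x" for n
  proof (induction n)
    case (Suc n)
    then show ?case using inv[of "(1 / 2) ^ Suc n *\<^sub>R x"] by simp
  qed simp
  moreover have "(\<lambda>n. (1 / 2) ^ n *\<^sub>R x) \<longlonglongrightarrow> 0 *\<^sub>R x"
    by (intro tendsto_scaleR tendsto_const LIMSEQ_power_zero) simp
  then have "(\<lambda>n. g ((1 / 2) ^ n *\<^sub>R x)) \<longlonglongrightarrow> g 0"
    using assms(1) by (intro isCont_tendsto_compose[of 0 g]) (simp_all add: continuous_on_eq_continuous_at)
  ultimately show ?thesis by (simp add: LIMSEQ_const_iff)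
qed

lemma fseries_0:
  assumes "fin_supp \<upsilon>"
  shows "poly_conv (nmonom 0) \<upsilon> x = (fseries \<upsilon> 0 :: complex^'r^1)"
proof -
  have "poly_conv (nmonom 0) \<upsilon> x $ 1 $ l = fseries \<upsilon> 0 $ 1 $ l" for l
    by (simp add: poly_conv_nth[OF assms] fseries_nth[OF assms])
  then show ?thesis by (simp add: vec_eq_iff forall_1)
qed

lemma fin_supp_matching_filter: "normalized_matching_filter N a \<phi> \<upsilon> \<Longrightarrow> fin_supp \<upsilon>"
  by (simp add: normalized_matching_filter_def sum_rules_def)

context hermite_system
begin

text \<open>Integer translation acts on these functions exactly as on monomials. Hence the error of
  reproduction at degree \<mu> is periodic once all lower errors vanish.\<close>

lemma shift_sum_poly_conv_translate:
  assumes \<upsilon>: "fin_supp \<upsilon>"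
  shows "shift_sum \<phi> (\<lambda>k. poly_conv (nmonom \<mu>) \<upsilon> (rvec k)) (rvec n + x)
    = (\<Sum>\<kappa> | \<kappa> \<le> \<mu>. nmonom \<kappa> (rvec n) * shift_sum \<phi> (\<lambda>k. poly_conv (nmonom (\<mu> - \<kappa>)) \<upsilon> (rvec k)) x)"
proof -
  let ?K = "{k :: int^'d::{finite,linorder}. norm (rvec k) \<le> norm x + R}"
  note fin = shift_sum_finite[OF supp finite_lattice_ball]
  have shift: "poly_conv (nmonom \<mu>) \<upsilon> (rvec (k + n)) $ 1 $ l
      = (\<Sum>\<kappa> | \<kappa> \<le> \<mu>. nmonom \<kappa> (rvec n) * poly_conv (nmonom (\<mu> - \<kappa>)) \<upsilon> (rvec k) $ 1 $ l)" for k l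
  proof -
    have "nmonom \<mu> (rvec (k + n) - rvec p) = (\<Sum>\<kappa> | \<kappa> \<le> \<mu>. nmonom \<kappa> (rvec n) * nmonom (\<mu> - \<kappa>) (rvec k - rvec p))" for p
      using nmonom_add[of \<mu> "rvec n" "rvec k - rvec p"] by (simp add: rvec_add algebra_simps)
    then have "poly_conv (nmonom \<mu>) \<upsilon> (rvec (k + n)) $ 1 $ l
        = (\<Sum>p | \<upsilon> p \<noteq> 0. \<Sum>\<kappa> | \<kappa> \<le> \<mu>. nmonom \<kappa> (rvec n) * (nmonom (\<mu> - \<kappa>) (rvec k - rvec p) * \<upsilon> p $ 1 $ l))"
      by (simp add: poly_conv_nth[OF \<upsilon>] sum_distrib_right mult.assoc)
    then show ?thesis
      unfolding poly_conv_nth[OF \<upsilon>] sum_distrib_left by (rule trans) (rule sum.swap)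
  qed
  have "shift_sum \<phi> (\<lambda>k. poly_conv (nmonom \<mu>) \<upsilon> (rvec k)) (rvec n + x)
      = (\<Sum>k\<in>?K. (poly_conv (nmonom \<mu>) \<upsilon> (rvec (k + n)) *v \<phi> (x - rvec k)) $ 1)"
    unfolding shift_sum_translate by (rule fin) simp
  also have "\<dots> = (\<Sum>k\<in>?K. \<Sum>l\<in>UNIV. \<Sum>\<kappa> | \<kappa> \<le> \<mu>.
      nmonom \<kappa> (rvec n) * (poly_conv (nmonom (\<mu> - \<kappa>)) \<upsilon> (rvec k) $ 1 $ l * \<phi> (x - rvec k) $ l))"
    unfolding row_mult shift sum_distrib_right mult.assoc ..
  also have "\<dots> = (\<Sum>k\<in>?K. \<Sum>\<kappa> | \<kappa> \<le> \<mu>. \<Sum>l\<in>UNIV.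
      nmonom \<kappa> (rvec n) * (poly_conv (nmonom (\<mu> - \<kappa>)) \<upsilon> (rvec k) $ 1 $ l * \<phi> (x - rvec k) $ l))"
    by (rule sum.cong[OF refl], rule sum.swap)
  also have "\<dots> = (\<Sum>\<kappa> | \<kappa> \<le> \<mu>. \<Sum>k\<in>?K. \<Sum>l\<in>UNIV.
      nmonom \<kappa> (rvec n) * (poly_conv (nmonom (\<mu> - \<kappa>)) \<upsilon> (rvec k) $ 1 $ l * \<phi> (x - rvec k) $ l))"
    by (rule sum.swap)
  also have "\<dots> = (\<Sum>\<kappa> | \<kappa> \<le> \<mu>. nmonom \<kappa> (rvec n) * shift_sum \<phi> (\<lambda>k. poly_conv (nmonom (\<mu> - \<kappa>)) \<upsilon> (rvec k)) x)"
  proof (rule sum.cong[OF refl])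
    fix \<kappa>
    have "shift_sum \<phi> (\<lambda>k. poly_conv (nmonom (\<mu> - \<kappa>)) \<upsilon> (rvec k)) x
        = (\<Sum>k\<in>?K. (poly_conv (nmonom (\<mu> - \<kappa>)) \<upsilon> (rvec k) *v \<phi> (x - rvec k)) $ 1)"
      by (rule fin) simp
    then show "(\<Sum>k\<in>?K. \<Sum>l\<in>UNIV.
      nmonom \<kappa> (rvec n) * (poly_conv (nmonom (\<mu> - \<kappa>)) \<upsilon> (rvec k) $ 1 $ l * \<phi> (x - rvec k) $ l))
      = nmonom \<kappa> (rvec n) * shift_sum \<phi> (\<lambda>k. poly_conv (nmonom (\<mu> - \<kappa>)) \<upsilon> (rvec k)) x"
      by (simp add: row_mult sum_distrib_left)
  qed
  finally show ?thesis .
qed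

lemma filter_eigen:
  assumes "normalized_matching_filter N a \<phi> \<upsilon>" "mabs \<mu> < N"
  shows "subdiv a (\<lambda>k. poly_conv (nmonom \<mu>) \<upsilon> (rvec k)) j = (1 / 2 ^ mabs \<mu>) *\<^sub>R poly_conv (nmonom \<mu>) \<upsilon> (rvec j)"
proof -
  have "sum_rules N a \<upsilon>" using assms(1) by (simp add: normalized_matching_filter_def)
  then have \<upsilon>: "fin_supp \<upsilon>" and M: "\<forall>\<mu> l. mabs \<mu> < N \<longrightarrow> (\<forall>\<omega>\<in>unit_cube_pts.
       mask_moment a \<upsilon> \<omega> \<mu> l = (if \<omega> = 0 then filter_moment \<upsilon> \<mu> l else 0))"
    unfolding sum_rules_iff_moments[OF mask] by blast+
  from M[unfolded moments_iff_eigen[OF mask \<upsilon>]] assms(2) show ?thesis by blast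
qed

text \<open>The sum rules supply the homogeneity. In degree 0 it gives only a constant, which is
  identified as 1 through its mean over the unit cube, that is, through the normalization of the
  filter.\<close>

lemma filter_reproduction:
  assumes nf: "normalized_matching_filter N a \<phi> \<upsilon>" and "mabs \<mu> < N"
  shows "shift_sum \<phi> (\<lambda>k. poly_conv (nmonom \<mu>) \<upsilon> (rvec k)) x = nmonom \<mu> x"
  using assms(2)
proof (induction "mabs \<mu>" arbitrary: \<mu> x rule: less_induct)
  case less
  have \<upsilon>: "fin_supp \<upsilon>" using nf by (rule fin_supp_matching_filter)
  let ?f = "\<lambda>\<mu>. shift_sum \<phi> (\<lambda>k. poly_conv (nmonom \<mu>) \<upsilon> (rvec k))"
  have cont: "continuous_on UNIV (?f \<mu>)"
    by (rule Cm_continuous[OF Cm_shift_sum[OF Cm_\<phi> supp]])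
  have scale: "?f \<mu> (2 *\<^sub>R x) = 2 ^ mabs \<mu> * ?f \<mu> x" for x
  proof -
    let ?K = "{k :: int^'d::{finite,linorder}. norm (rvec k) \<le> norm (2 *\<^sub>R x) + R}"
    have "?f \<mu> x = shift_sum \<phi> (\<lambda>k. (1 / 2 ^ mabs \<mu>) *\<^sub>R poly_conv (nmonom \<mu>) \<upsilon> (rvec k)) (2 *\<^sub>R x)"
      unfolding shift_sum_refine[OF refine mask supp, of _ x] filter_eigen[OF nf less.prems, abs_def] ..
    also have "\<dots> = 1 / 2 ^ mabs \<mu> * ?f \<mu> (2 *\<^sub>R x)"
      by (subst (1 2) shift_sum_finite[OF supp finite_lattice_ball[of "norm (2 *\<^sub>R x) + R"]])
         (auto simp: row_mult sum_distrib_left scaleR_conv_of_real[where 'a = complex])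
    finally show ?thesis by simp
  qed
  show ?case
  proof (cases "\<mu> = 0")
    case True
    have const: "?f 0 x = ?f 0 0" for x
    proof (rule dilation_invariant_const[OF cont[unfolded True]])
      show "?f 0 (2 *\<^sub>R x) = ?f 0 x" for x using scale[of x] by (simp only: True mabs_0 power_0 mult_1)
    qed
    have f0: "?f 0 = shift_sum \<phi> (\<lambda>_. fseries \<upsilon> 0)" by (simp add: fseries_0[OF \<upsilon>])
    have "1 = (fseries \<upsilon> 0 *v fourier \<phi> 0) $ 1" using nf by (simp add: normalized_matching_filter_def)
    also have "\<dots> = (LINT x|lborel. indicator unit_cube x *\<^sub>R ?f 0 x)"
      unfolding f0 by (rule row_fourier_0[OF continuous_\<phi> supp])
    also have "\<dots> = (LINT x|lborel. indicator unit_cube (x :: real^'d::{finite,linorder}) *\<^sub>R ?f 0 0)"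
      using const by (intro Bochner_Integration.integral_cong refl) simp
    also have "\<dots> = ?f 0 0" by (rule integral_unit_cube_const)
    finally show ?thesis using const[of x] True by simp
  next
    case False
    define g where "g x = ?f \<mu> x - nmonom \<mu> x" for x
    have "g x = 0"
    proof (rule homogeneous_periodic_zero[where s = "mabs \<mu>"])
      show "continuous_on UNIV g"
        unfolding g_def by (intro continuous_intros cont continuous_nmonom)
      show "g (2 *\<^sub>R x) = 2 ^ mabs \<mu> * g x" for x
        by (simp add: g_def scale nmonom_scale right_diff_distrib)
      show "mabs \<mu> \<noteq> 0" using False by (simp add: mabs_eq_0_iff)
      fix x n
      have "g (x + rvec n) = (\<Sum>\<kappa> | \<kappa> \<le> \<mu>. nmonom \<kappa> (rvec n) * (?f (\<mu> - \<kappa>) x - nmonom (\<mu> - \<kappa>) x))"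
        unfolding g_def add.commute[of x] shift_sum_poly_conv_translate[OF \<upsilon>] nmonom_add
        by (simp add: right_diff_distrib sum_subtractf)
      also have "\<dots> = (\<Sum>\<kappa> | \<kappa> \<le> \<mu>. if \<kappa> = 0 then g x else 0)"
      proof (rule sum.cong[OF refl])
        fix \<kappa> assume "\<kappa> \<in> {\<kappa>. \<kappa> \<le> \<mu>}"
        then have s: "mabs (\<mu> - \<kappa>) + mabs \<kappa> = mabs \<mu>" using mabs_diff by blast
        show "nmonom \<kappa> (rvec n) * (?f (\<mu> - \<kappa>) x - nmonom (\<mu> - \<kappa>) x) = (if \<kappa> = 0 then g x else 0)"
        proof (cases "\<kappa> = 0")
          case False
          then have "mabs \<kappa> \<noteq> 0" by (simp add: mabs_eq_0_iff)
          then have "?f (\<mu> - \<kappa>) x = nmonom (\<mu> - \<kappa>) x" using s less.prems by (intro less.hyps) linarith+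
          then show ?thesis using False by simp
        qed (simp add: g_def)
      qed
      also have "\<dots> = g x" using finite_multiindex_le[of \<mu>] by (simp add: less_eq_vec_def)
      finally show "g (x + rvec n) = g x" .
    qed
    then show ?thesis by (simp add: g_def)
  qed
qed

lemma hermite_poly_expand:
  "hermite_poly \<mu> x $ 1 $ l = (\<Sum>\<kappa> | \<kappa> \<le> \<mu>. nmonom \<kappa> x * mderiv (\<nu> l) (nmonom (\<mu> - \<kappa>)) (\<tau> l))"
proof -
  have "hermite_poly \<mu> x $ 1 $ l = mderiv (\<nu> l) (\<lambda>y. nmonom \<mu> (y + x)) (\<tau> l)"
    by (simp add: hermite_poly_nth mderiv_translate[OF Cm_nmonom] add.commute)
  also have "(\<lambda>y. nmonom \<mu> (y + x)) = (\<lambda>y. \<Sum>\<kappa> | \<kappa> \<le> \<mu>. nmonom \<kappa> x * nmonom (\<mu> - \<kappa>) y)"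
    using nmonom_add[of \<mu> x] by (simp add: add.commute)
  also have "mderiv (\<nu> l) \<dots> (\<tau> l) = (\<Sum>\<kappa> | \<kappa> \<le> \<mu>. nmonom \<kappa> x * mderiv (\<nu> l) (nmonom (\<mu> - \<kappa>)) (\<tau> l))"
    by (simp add: mderiv_sum[OF Cm_linear[OF bounded_linear_mult_right Cm_nmonom]]
        mderiv_linear[OF bounded_linear_mult_right Cm_nmonom])
  finally show ?thesis .
qed

text \<open>Both polynomials have the same binomial expansion, with moments and with derivatives at
  \<tau> l as coefficients.\<close>

lemma poly_conv_hermite_poly:
  assumes \<upsilon>: "fin_supp \<upsilon>"
    and mom: "\<And>\<mu> l. mabs \<mu> < N \<Longrightarrow> filter_moment \<upsilon> \<mu> l = mderiv (\<nu> l) (nmonom \<mu>) (\<tau> l)"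
    and "mabs \<mu> < N"
  shows "poly_conv (nmonom \<mu>) \<upsilon> x = hermite_poly \<mu> x"
proof -
  have "poly_conv (nmonom \<mu>) \<upsilon> x $ 1 $ l = hermite_poly \<mu> x $ 1 $ l" for l
    unfolding poly_conv_expand[OF \<upsilon>] hermite_poly_expand
  proof (rule sum.cong[OF refl])
    fix \<kappa> assume "\<kappa> \<in> {\<kappa>. \<kappa> \<le> \<mu>}"
    then have "mabs (\<mu> - \<kappa>) < N" using mabs_diff[of \<kappa> \<mu>] assms(3) by simp
    then show "nmonom \<kappa> x * filter_moment \<upsilon> (\<mu> - \<kappa>) l = nmonom \<kappa> x * mderiv (\<nu> l) (nmonom (\<mu> - \<kappa>)) (\<tau> l)"
      using mom by simp
  qed
  then show ?thesis by (simp add: vec_eq_iff forall_1)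
qed

text \<open>The monomial is the shift sum of \<open>p_\<mu>\<close>, so its derivative \<nu> l at
  \<tau> l reads off the entry l of \<open>p_\<mu>\<close> at 0, which is the moment.\<close>

lemma filter_moment_eq:
  assumes nf: "normalized_matching_filter N a \<phi> \<upsilon>" and "mabs \<mu> < N"
  shows "filter_moment \<upsilon> \<mu> l = mderiv (\<nu> l) (nmonom \<mu>) (\<tau> l)"
proof -
  have \<upsilon>: "fin_supp \<upsilon>" using nf by (rule fin_supp_matching_filter)
  let ?w = "\<lambda>k. poly_conv (nmonom \<mu>) \<upsilon> (rvec k)"
  have "shift_sum \<phi> ?w = nmonom \<mu>" using filter_reproduction[OF assms] by auto
  then show ?thesis
    using mderiv_shift_sum[OF Cm_\<nu> supp, of l ?w "rvec 0 + \<tau> l"] shift_sum_hermite[OF hermite, of l ?w 0]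
    by (simp add: filter_moment_poly_conv[OF \<upsilon>])
qed

text \<open>A filter is chosen with the moments of the target. Its polynomials are then the Hermite
  data of the monomials, for which reproduction and the eigenvalue equation are known up to degree
  m.\<close>

lemma exists_matching_filter: "\<exists>\<upsilon>. normalized_matching_filter (m + 1) a \<phi> \<upsilon>"
proof -
  obtain \<upsilon> :: "int^'d::{finite,linorder} \<Rightarrow> complex^'r::{finite,linorder}^1" where \<upsilon>: "fin_supp \<upsilon>"
    and mom: "\<And>\<mu> l. mabs \<mu> \<le> m \<Longrightarrow> filter_moment \<upsilon> \<mu> l = mderiv (\<nu> l) (nmonom \<mu>) (\<tau> l)"
    using exists_filter_moments[of m "\<lambda>\<mu> l. mderiv (\<nu> l) (nmonom \<mu>) (\<tau> l)"] by metis
  have pc: "poly_conv (nmonom \<mu>) \<upsilon> x = hermite_poly \<mu> x" if "mabs \<mu> < m + 1" for \<mu> x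
    by (rule poly_conv_hermite_poly[OF \<upsilon> _ that]) (simp add: mom)
  have "(fseries \<upsilon> 0 *v fourier \<phi> 0) $ 1 = (LINT x|lborel. indicator unit_cube x *\<^sub>R shift_sum \<phi> (\<lambda>_. fseries \<upsilon> 0) x)"
    by (rule row_fourier_0[OF continuous_\<phi> supp])
  \<comment> \<open>Reproduction in degree 0 is what yields the normalization.\<close>
  also have "shift_sum \<phi> (\<lambda>_. fseries \<upsilon> 0) x = 1" for x
  proof -
    have "(\<lambda>_. fseries \<upsilon> 0) = (\<lambda>k. hermite_poly 0 (rvec k))"
      using pc[of 0] fseries_0[OF \<upsilon>] by auto
    then show ?thesis using shift_sum_hermite_poly[of 0 x] by simp
  qed
  then have "(LINT x|lborel. indicator unit_cube x *\<^sub>R shift_sum \<phi> (\<lambda>_. fseries \<upsilon> 0) x) = 1"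
    using integral_unit_cube_const[of 1] by simp
  finally have norm: "(fseries \<upsilon> 0 *v fourier \<phi> 0) $ 1 = 1" .
  then have "fseries \<upsilon> 0 \<noteq> 0" by (auto simp: row_mult)
  moreover have "\<forall>\<mu> l. mabs \<mu> < m + 1 \<longrightarrow> (\<forall>\<omega>\<in>unit_cube_pts.
       mask_moment a \<upsilon> \<omega> \<mu> l = (if \<omega> = 0 then filter_moment \<upsilon> \<mu> l else 0))"
    unfolding moments_iff_eigen[OF mask \<upsilon>]
    by (simp add: pc subdiv_hermite_poly)
  ultimately have "sum_rules (m + 1) a \<upsilon>" unfolding sum_rules_iff_moments[OF mask] using \<upsilon> by blast
  then show ?thesis using norm unfolding normalized_matching_filter_def by blast
qed

text \<open>On the unit ball only finitely many shifts of the entries of \<open>\<phi>\<close> are nonzero, whereas the powers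
  of one coordinate are linearly independent.\<close>

lemma sum_rule_order_bounded:
  assumes nf: "normalized_matching_filter (n + 1) a \<phi> \<upsilon>"
  shows "n \<le> card ({k :: int^'d::{finite,linorder}. norm (rvec k) \<le> 1 + R} \<times> (UNIV :: 'r::{finite,linorder} set))"
proof (rule ccontr)
  let ?K = "{k :: int^'d::{finite,linorder}. norm (rvec k) \<le> 1 + R}"
  \<comment> \<open>Any one coordinate serves; \<open>undefined\<close> merely names one.\<close>
  let ?i = "undefined :: 'd::{finite,linorder}"
  let ?p = "\<lambda>s. poly_conv (nmonom (axis ?i s)) \<upsilon>"
  assume "\<not> n \<le> card (?K \<times> (UNIV :: 'r::{finite,linorder} set))"
  then have "card (?K \<times> (UNIV :: 'r::{finite,linorder} set)) < card {..n}" by simp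
  moreover have "finite (?K \<times> (UNIV :: 'r::{finite,linorder} set))"
    by (intro finite_cartesian_product finite_lattice_ball finite)
  ultimately obtain \<alpha> where \<alpha>: "\<exists>s\<in>{..n}. \<alpha> s \<noteq> 0"
    and dep0: "\<forall>e\<in>?K \<times> (UNIV :: 'r::{finite,linorder} set). (\<Sum>s\<le>n. \<alpha> s * ?p s (rvec (fst e)) $ 1 $ snd e) = 0"
    using linear_dependence[of "?K \<times> (UNIV :: 'r::{finite,linorder} set)" "{..n}" "\<lambda>s e. ?p s (rvec (fst e)) $ 1 $ snd e"]
    by blast
  have dep: "(\<Sum>s\<le>n. \<alpha> s * ?p s (rvec k) $ 1 $ l) = 0" if "k \<in> ?K" for k l
  proof -
    have "(k, l) \<in> ?K \<times> (UNIV :: 'r::{finite,linorder} set)" using that by blast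
    from bspec[OF dep0 this] show ?thesis by (simp only: fst_conv snd_conv)
  qed
  have zero: "(\<Sum>s\<le>n. \<alpha> s * nmonom (axis ?i s) x) = 0" if x: "norm x \<le> 1" for x
  proof -
    have "(\<Sum>s\<le>n. \<alpha> s * nmonom (axis ?i s) x) = (\<Sum>s\<le>n. \<alpha> s * shift_sum \<phi> (\<lambda>k. ?p s (rvec k)) x)"
      by (intro sum.cong refl) (simp add: filter_reproduction[OF nf])
    also have "\<dots> = (\<Sum>s\<le>n. \<Sum>k\<in>?K. \<Sum>l\<in>UNIV. \<alpha> s * ?p s (rvec k) $ 1 $ l * \<phi> (x - rvec k) $ l)"
    proof -
      have "shift_sum \<phi> w x = (\<Sum>k\<in>?K. (w k *v \<phi> (x - rvec k)) $ 1)" for w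
        using x by (intro shift_sum_finite[OF supp finite_lattice_ball]) simp
      then show ?thesis by (simp add: row_mult sum_distrib_left mult.assoc)
    qed
    also have "\<dots> = (\<Sum>k\<in>?K. \<Sum>s\<le>n. \<Sum>l\<in>UNIV. \<alpha> s * ?p s (rvec k) $ 1 $ l * \<phi> (x - rvec k) $ l)"
      by (rule sum.swap)
    also have "\<dots> = (\<Sum>k\<in>?K. \<Sum>l\<in>UNIV. \<Sum>s\<le>n. \<alpha> s * ?p s (rvec k) $ 1 $ l * \<phi> (x - rvec k) $ l)"
      by (rule sum.cong[OF refl], rule sum.swap)
    also have "\<dots> = (\<Sum>k\<in>?K. \<Sum>l\<in>UNIV. (\<Sum>s\<le>n. \<alpha> s * ?p s (rvec k) $ 1 $ l) * \<phi> (x - rvec k) $ l)"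
      by (simp add: sum_distrib_right)
    also have "\<dots> = 0"
    proof (intro sum.neutral ballI)
      fix k l assume "k \<in> ?K"
      then have "(\<Sum>s\<le>n. \<alpha> s * ?p s (rvec k) $ 1 $ l) = 0" by (rule dep)
      then show "(\<Sum>s\<le>n. \<alpha> s * ?p s (rvec k) $ 1 $ l) * \<phi> (x - rvec k) $ l = 0" by simp
    qed
    finally show ?thesis .
  qed
  \<comment> \<open>Points tending to 0 along the axis: a polynomial vanishing at all of them has
    zero coefficients.\<close>
  define t where "t j = 1 / real (Suc j)" for j
  have t: "0 < t j" "t j \<le> 1" for j by (auto simp: t_def)
  have tlim: "t \<longlonglongrightarrow> 0" unfolding t_def by (rule lim_1_over_n[THEN LIMSEQ_Suc])
  have mon: "nmonom (axis ?i s) (u *\<^sub>R axis ?i 1) = of_real u ^ s / fact s" for u s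
    unfolding nmonom_prod by (subst prod.remove[of UNIV ?i]) (auto simp: axis_def)
  have "(\<Sum>s\<le>n. \<alpha> s / fact s * of_real (t j) ^ s) = 0" for j
  proof -
    have "norm (t j *\<^sub>R (axis ?i 1 :: real^'d::{finite,linorder})) \<le> 1" using t[of j] by simp
    from zero[OF this] show ?thesis unfolding mon by simp
  qed
  then have "(\<lambda>j. (\<Sum>s\<le>n. \<alpha> s / fact s * of_real (t j) ^ s) / of_real (t j) ^ n) \<longlonglongrightarrow> 0" by simp
  from polynomial_little_o_zero[OF t(1) tlim this] have "\<alpha> s / fact s = 0" if "s \<le> n" for s using that .
  then show False using \<alpha> by auto
qed

lemma matching_filter_property: "matching_filter_property m \<nu> \<tau> a \<phi>"
proof -
  let ?P = "\<lambda>n. \<exists>\<upsilon>. normalized_matching_filter (n + 1) a \<phi> \<upsilon>"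
  let ?B = "card ({k :: int^'d::{finite,linorder}. norm (rvec k) \<le> 1 + R} \<times> (UNIV :: 'r::{finite,linorder} set))"
  have bd: "?P n \<Longrightarrow> n \<le> ?B" for n using sum_rule_order_bounded by blast
  \<comment> \<open>The greatest n exists because m is admissible and \<open>?B\<close> bounds all
    admissible n.\<close>
  define M where "M = (GREATEST n. ?P n)"
  have PM: "?P M" unfolding M_def by (rule GreatestI_nat[where P = ?P and k = m and b = ?B]) (fact exists_matching_filter, fact bd)
  have max: "n \<le> M" if "?P n" for n unfolding M_def by (rule Greatest_le_nat[where P = ?P and b = ?B]) (fact that, fact bd)
  have "largest_sum_rules M a \<phi>" unfolding largest_sum_rules_def using PM max by blast
  moreover have "m \<le> M" by (rule max[OF exists_matching_filter])
  moreover have "eqO (M + 1) (fseries \<upsilon>)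
      (\<lambda>\<xi>. \<chi> i l. \<i> ^ mabs (\<nu> l) * complex_of_real (mpow \<xi> (\<nu> l)) * exp (\<i> * complex_of_real (\<tau> l \<bullet> \<xi>)))"
    if nf: "normalized_matching_filter (M + 1) a \<phi> \<upsilon>" for \<upsilon>
  proof -
    have \<upsilon>: "fin_supp \<upsilon>" using nf by (rule fin_supp_matching_filter)
    show ?thesis
      by (subst eqO_components)
         (simp_all add: fseries_moment[OF \<upsilon>] mderiv_matching_target filter_moment_eq[OF nf])
  qed
  ultimately show ?thesis unfolding matching_filter_property_def by blast
qed

lemma polynomial_property: "polynomial_property \<nu> \<tau> a \<phi>"
  unfolding polynomial_property_def Let_def
proof (intro allI impI conjI)
  fix M \<upsilon> and \<mu> :: "nat^'d::{finite,linorder}" assume nf: "normalized_matching_filter (M + 1) a \<phi> \<upsilon>" and "mabs \<mu> \<le> M"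
  then have \<mu>: "mabs \<mu> < M + 1" by simp
  have \<upsilon>: "fin_supp \<upsilon>" using nf by (rule fin_supp_matching_filter)
  show "subdiv a (\<lambda>k. poly_conv (nmonom \<mu>) \<upsilon> (rvec k)) j = (1 / 2 ^ mabs \<mu>) *\<^sub>R poly_conv (nmonom \<mu>) \<upsilon> (rvec j)" for j
    by (rule filter_eigen[OF nf \<mu>])
  show "(\<Sum>\<^sub>\<infinity>k. (poly_conv (nmonom \<mu>) \<upsilon> (rvec k) *v \<phi> (x - rvec k)) $ 1) = nmonom \<mu> x" for x
    using filter_reproduction[OF nf \<mu>, of x] by (simp add: shift_sum_def)
  have tr: "mderiv (\<nu> l) (\<lambda>y. nmonom \<mu> (y + \<tau> l)) x = mderiv (\<nu> l) (nmonom \<mu>) (x + \<tau> l)" for x l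
    by (simp add: mderiv_translate[OF Cm_nmonom])
  show "poly_conv (nmonom \<mu>) \<upsilon> x $ 1 $ l = mderiv (\<nu> l) (\<lambda>y. nmonom \<mu> (y + \<tau> l)) x" for x l
  proof -
    have "poly_conv (nmonom \<mu>) \<upsilon> x = hermite_poly \<mu> x"
      by (rule poly_conv_hermite_poly[OF \<upsilon> _ \<mu>]) (rule filter_moment_eq[OF nf])
    then show ?thesis unfolding tr by (simp add: hermite_poly_nth)
  qed
  show "mderiv (\<nu> l) (\<lambda>y. nmonom \<mu> (y + \<tau> l)) x = (if \<nu> l \<le> \<mu> then nmonom (\<mu> - \<nu> l) (x + \<tau> l) else 0)" for x l
    unfolding tr mderiv_nmonom ..
qed

end

theorem theorem1p3:
  fixes m :: nat
    and \<nu> :: "'r::{finite,linorder} \<Rightarrow> nat^'d::{finite,linorder}"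
    and \<tau> :: "'r::{finite,linorder} \<Rightarrow> real^'d::{finite,linorder}"
    and \<theta> :: "'r::{finite,linorder} \<Rightarrow> 'r::{finite,linorder}"
    and a :: "int^'d::{finite,linorder} \<Rightarrow> complex^'r::{finite,linorder}^'r::{finite,linorder}"
    and \<phi> :: "real^'d::{finite,linorder} \<Rightarrow> complex^'r::{finite,linorder}"
  assumes \<Lambda>_sub: "\<And>l. mabs (\<nu> l) \<le> m"
    and \<nu>1: "\<nu> idx1 = 0"
    and \<theta>_\<nu>: "\<And>l. \<nu> (\<theta> l) = \<nu> l"
    and \<theta>_\<tau>: "\<And>l i. (2 *\<^sub>R \<tau> l - \<tau> (\<theta> l)) $ i \<in> \<int>"
    and mask: "fin_supp a"
  shows
    "(scheme_convergent m \<nu> a \<and>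
      scheme_interpolatory \<nu> \<tau> \<theta> a \<and>
      is_basis_vector_function m a \<phi> \<and> spanning_condition \<phi>
      \<longrightarrow>
      interpolatory_mask \<nu> \<tau> \<theta> a \<and>
      (refinable a \<phi> \<and> hermite_interpolant \<nu> \<tau> \<phi>) \<and>
      matching_filter_property m \<nu> \<tau> a \<phi> \<and>
      polynomial_property \<nu> \<tau> a \<phi>)
     \<and>
     (compactly_supported \<phi> \<and> Cm m \<phi> \<and> refinable a \<phi> \<and> hermite_interpolant \<nu> \<tau> \<phi>
      \<longrightarrow>
      scheme_convergent m \<nu> a \<and>
      scheme_interpolatory \<nu> \<tau> \<theta> a \<and>
      (is_basis_vector_function m a \<phi> \<and> spanning_condition \<phi>) \<and>
      interpolatory_mask \<nu> \<tau> \<theta> a \<and>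
      (refinable a \<phi> \<and> hermite_interpolant \<nu> \<tau> \<phi>) \<and>
      matching_filter_property m \<nu> \<tau> a \<phi> \<and>
      polynomial_property \<nu> \<tau> a \<phi>)"
proof -
  \<comment> \<open>Either set of premises yields every item, so both implications are read off one
    conjunction.\<close>
  define full where "full \<longleftrightarrow>
    scheme_convergent m \<nu> a \<and> scheme_interpolatory \<nu> \<tau> \<theta> a \<and>
    (is_basis_vector_function m a \<phi> \<and> spanning_condition \<phi>) \<and>
    interpolatory_mask \<nu> \<tau> \<theta> a \<and> (refinable a \<phi> \<and> hermite_interpolant \<nu> \<tau> \<phi>) \<and>
    matching_filter_property m \<nu> \<tau> a \<phi> \<and> polynomial_property \<nu> \<tau> a \<phi>"
  have core: full if "hermite_system m \<nu> \<tau> a \<phi> R" for R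
  proof -
    interpret hermite_system m \<nu> \<tau> a \<phi> R by (rule that)
    show ?thesis unfolding full_def
      by (intro conjI convergent interpolatory[OF \<theta>_\<nu> \<theta>_\<tau>] basis_vector_function[OF \<nu>1] spanning
          refine hermite matching_filter_property polynomial_property)
  qed
  have 1: full
    if s: "scheme_convergent m \<nu> a" "scheme_interpolatory \<nu> \<tau> \<theta> a" "is_basis_vector_function m a \<phi>"
  proof -
    obtain R where "hermite_system m \<nu> \<tau> a \<phi> R"
      using hermite_system_of_scheme[OF \<Lambda>_sub \<nu>1 \<theta>_\<nu> \<theta>_\<tau> mask s] by (rule exE)
    then show ?thesis by (rule core)
  qed
  have 2: full
    if h: "compactly_supported \<phi>" "Cm m \<phi>" "refinable a \<phi>" "hermite_interpolant \<nu> \<tau> \<phi>"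
  proof -
    have "bounded (closure {x. \<phi> x \<noteq> 0})"
      using h(1) by (simp add: compactly_supported_def compact_imp_bounded)
    then obtain R where R: "\<forall>x\<in>closure {x. \<phi> x \<noteq> 0}. norm x \<le> R" unfolding bounded_iff by (rule exE)
    have "supp_ball R \<phi>"
      unfolding supp_ball_def
    proof (intro allI impI, rule ccontr)
      fix x assume x: "R < norm x" "\<phi> x \<noteq> 0"
      have "x \<in> closure {x. \<phi> x \<noteq> 0}" by (rule subsetD[OF closure_subset]) (simp add: x(2))
      then have "norm x \<le> R" using R by (rule bspec[rotated])
      then show False using x(1) by simp
    qed
    then have "hermite_system m \<nu> \<tau> a \<phi> R" by (intro hermite_system.intro \<Lambda>_sub mask h)
    then show ?thesis by (rule core)
  qed
  show ?thesis using 1 2 unfolding full_def by blast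
qed

end
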